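(* Let $(a_i)_{i\in\mathbb{Z}}$ be i.i.d. real random variables, almost surely nonzero, such that $\sigma^2=\mathrm{Var}\,\log|a_i|<\infty$. Let $H$ be the random Schroedinger operator $$(Hf)(i)=a_{i-1}f(i-1)+a_i f(i+1),\qquad i\in\mathbb{Z},$$ and let $\mu_H$ be its expected spectral measure. Then, as $\varepsilon\to 0^+$, $$\mu_H(-\varepsilon,\varepsilon)=\frac{\sigma^2}{|\log\varepsilon|^2}\,(1+o(1)).$$
   Context: Expected spectral measure: for $n\ge 1$ let $H_n$ be the random symmetric $(n+1)\times(n+1)$ matrix indexed by $\{1,\dots,n+1\}$ with $(H_n)_{i,i+1}=(H_n)_{i+1,i}=a_i$ for $1\le i\le n$ and all other entries $0$ (the restriction of $H$ to $\{1,\dots,n+1\}$). Let $\mu_{H_n}$ be the (random) empirical eigenvalue distribution of $H_n$ (mass $\frac1{n+1}$ at each eigenvalue, with multiplicity) and let $\mu_n=\mathbb{E}\,\mu_{H_n}$ be its average over the random weights. The expected spectral measure $\mu_H$ is defined as the weak limit of the sequence $\mu_{2^k-1}$ as $k\to\infty$ (this limit exists for any shift-invariant law of the weights).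
   Formalization: For σ = 0 the displayed formula would say that μ_H(-ε,ε) vanishes for small ε, which is false (a_i = 1 gives an arcsine law); in that case the statement proved is μ_H(-ε,ε) = o(1/|log ε|²). *)

theory Defs
  imports
    "HOL-Probability.Probability"
    "Jordan_Normal_Form.Char_Poly"
begin

definition schroedinger_op :: "(int \<Rightarrow> real) \<Rightarrow> (int \<Rightarrow> real) \<Rightarrow> (int \<Rightarrow> real)" where
  "schroedinger_op b f i = b (i - 1) * f (i - 1) + b i * f (i + 1)"

text \<open>
  The compression of an operator to the sites \<open>{1..n+1}\<close>, as a matrix. Matrix indices start
  at \<open>0\<close>, so matrix index \<open>i\<close> stands for the site \<open>i + 1\<close>.
\<close>

definition restrict_op :: "((int \<Rightarrow> real) \<Rightarrow> (int \<Rightarrow> real)) \<Rightarrow> nat \<Rightarrow> real mat" where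
  "restrict_op T n = Matrix.mat (n + 1) (n + 1) (\<lambda>(i, j). T (indicator {int j + 1}) (int i + 1))"

lemma restrict_schroedinger_op:
  "restrict_op (schroedinger_op b) n =
     Matrix.mat (n + 1) (n + 1)
       (\<lambda>(i, j). if j = i + 1 then b (int i + 1) else if i = j + 1 then b (int j + 1) else 0)"
  by (intro eq_matI) (auto simp: restrict_op_def schroedinger_op_def indicator_def add.commute)

text \<open>
  The order of \<open>x\<close> as a root of the characteristic polynomial is the algebraic multiplicity of
  the eigenvalue; for the symmetric matrices considered here it agrees with the geometric one,
  and the total mass is one.
\<close>

definition empirical_eigenvalue_distr :: "real mat \<Rightarrow> real measure" where
  "empirical_eigenvalue_distr A =
     distr
       (point_measure {x. eigenvalue A x}
         (\<lambda>x. ennreal (real (Polynomial.order x (char_poly A)) / real (dim_row A))))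
       borel (\<lambda>x. x)"

text \<open>
  Averaging a random measure is the bind of the Giry monad: the measure of \<open>B\<close> is the integral
  over \<open>\<omega>\<close> of the measure of \<open>B\<close> under the empirical distribution of the matrix at \<open>\<omega>\<close>.
\<close>

definition expected_empirical_distr ::
    "'s measure \<Rightarrow> ('s \<Rightarrow> (int \<Rightarrow> real) \<Rightarrow> (int \<Rightarrow> real)) \<Rightarrow> nat \<Rightarrow> real measure" where
  "expected_empirical_distr M T n =
     Giry_Monad.bind M (\<lambda>\<omega>. empirical_eigenvalue_distr (restrict_op (T \<omega>) n))"

text \<open>
  A weak limit that is a probability measure on the Borel sets is unique, since it is determined
  by its distribution function.
\<close>

definition expected_spectral_measure ::
    "'s measure \<Rightarrow> ('s \<Rightarrow> (int \<Rightarrow> real) \<Rightarrow> (int \<Rightarrow> real)) \<Rightarrow> real measure" where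
  "expected_spectral_measure M T =
     (THE \<mu>. real_distribution \<mu> \<and>
             weak_conv_m (\<lambda>k. expected_empirical_distr M T (2 ^ k - 1)) \<mu>)"

end

theory Submission
  imports Defs "HOL-Real_Asymp.Real_Asymp"
begin

text \<open>
  \<^bold>\<open>Zero energy.\<close> At energy \<open>0\<close> the equation \<open>b\<^sub>i\<^sub>-\<^sub>1 x\<^sub>i\<^sub>-\<^sub>1 + b\<^sub>i x\<^sub>i\<^sub>+\<^sub>1 = 0\<close> decouples even from odd
  sites, and its solutions have modulus \<open>exp (v\<^sub>i)\<close>, where \<open>v\<^sub>i\<^sub>+\<^sub>1 = - v\<^sub>i - \<xi>\<^sub>i\<close> and \<open>\<xi>\<^sub>i\<close> is
  \<open>ln \<bar>b\<^sub>i\<bar>\<close> minus its mean \<open>m\<close>. Thus \<open>(-1)\<^sup>i v\<^sub>i\<close> is a centred random walk whose steps have variance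
  \<open>\<sigma>\<^sup>2\<close>, and \<open>v\<^sub>i + v\<^sub>j\<close> is, up to sign, its displacement between two times of opposite parity.

  \<^bold>\<open>Eigenvalues are alternations.\<close> Let \<open>C\<close> be the number of moves of size at least \<open>L\<close>, alternately
  downwards and upwards, that the walk makes along the \<open>N\<close> sites. Two consecutive moves enclose a
  piece of a zero-energy solution that is smaller by \<open>exp (- L)\<close> at both ends than inside; these
  almost null vectors have disjoint supports, so there are at least \<open>C - 1\<close> eigenvalues of modulus
  about \<open>exp (- L)\<close> or less (\<open>count_small_eigenvalues_ge\<close>). Conversely, one linear constraint at
  each completion of a move leaves only vectors that can be recovered from their images with a loss
  of at most \<open>exp L\<close>, so there are at most \<open>C + 1\<close> such eigenvalues
  (\<open>count_small_eigenvalues_le\<close>). Factors polynomial in \<open>N\<close> are harmless.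

  \<^bold>\<open>Counting alternations.\<close> Let \<open>D\<close> be the progress of the current move. Its square grows by
  \<open>\<sigma>\<^sup>2\<close> per step in expectation and drops by about \<open>L\<^sup>2\<close> whenever a move is completed, hence
  \<open>E C \<approx> N \<sigma>\<^sup>2 / L\<^sup>2\<close>. The upper bound is immediate (\<open>expected_completions_le\<close>); for the lower
  bound the losses by reflection at \<open>0\<close> are controlled by the first moment of \<open>D\<close>, and the overshoot
  by the tails of the steps (\<open>expected_completions_ge\<close>).

  \<^bold>\<open>The limit.\<close> Cutting a matrix into two halves changes each eigenvalue count by at most \<open>1\<close>. So the
  distribution functions of \<open>\<mu>\<^sub>n\<close> for \<open>n + 1 = N = 2\<^sup>k\<close> converge uniformly, with error \<open>1 / N\<close>
  (\<open>expected_spectral_measure_approx\<close>), and a single matrix with \<open>N\<close> of order \<open>\<bar>ln \<epsilon>\<bar>\<^sup>3\<close> and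
  \<open>L \<approx> \<bar>ln \<epsilon>\<bar>\<close> determines \<open>\<mu>\<^sub>H(-\<epsilon>, \<epsilon>)\<close> up to \<open>o(\<bar>ln \<epsilon>\<bar>\<^sup>-\<^sup>2)\<close>.
\<close>

section \<open>Symmetric kernels and the min-max principle\<close>

definition dot :: "nat \<Rightarrow> (nat \<Rightarrow> real) \<Rightarrow> (nat \<Rightarrow> real) \<Rightarrow> real" where
  "dot N x y = (\<Sum>i<N. x i * y i)"

definition apply_kernel :: "nat \<Rightarrow> (nat \<Rightarrow> nat \<Rightarrow> real) \<Rightarrow> (nat \<Rightarrow> real) \<Rightarrow> nat \<Rightarrow> real" where
  "apply_kernel N A x i = (\<Sum>j<N. A i j * x j)"

lemma dot_commute: "dot N x y = dot N y x"
  by (simp add: dot_def mult.commute)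

lemma dot_sum_left: "dot N (\<lambda>i. \<Sum>k\<in>I. c k * v k i) y = (\<Sum>k\<in>I. c k * dot N (v k) y)"
  by (simp add: dot_def sum_distrib_left sum_distrib_right sum.swap[of _ I] mult.assoc)

lemma dot_sum_right: "dot N y (\<lambda>i. \<Sum>k\<in>I. c k * v k i) = (\<Sum>k\<in>I. c k * dot N y (v k))"
  by (simp add: dot_commute[of N y] dot_sum_left)

lemma dot_nonneg [simp]: "0 \<le> dot N x x"
  by (simp add: dot_def sum_nonneg)

lemma dot_self_eq_0_iff: "dot N x x = 0 \<longleftrightarrow> (\<forall>i<N. x i = 0)"
  by (auto simp: dot_def sum_nonneg_eq_0_iff)

lemma dot_cong: "(\<And>i. i < N \<Longrightarrow> x i = x' i) \<Longrightarrow> (\<And>i. i < N \<Longrightarrow> y i = y' i) \<Longrightarrow> dot N x y = dot N x' y'"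
  by (simp add: dot_def)

lemma apply_kernel_sum: "apply_kernel N A (\<lambda>i. \<Sum>k\<in>I. c k * v k i) i = (\<Sum>k\<in>I. c k * apply_kernel N A (v k) i)"
  by (simp add: apply_kernel_def sum_distrib_left sum.swap[of _ I] mult_ac)

lemma apply_kernel_symmetric:
  assumes "\<And>i j. i < N \<Longrightarrow> j < N \<Longrightarrow> A i j = A j i"
  shows "dot N (apply_kernel N A x) y = dot N x (apply_kernel N A y)"
proof -
  have "dot N (apply_kernel N A x) y = (\<Sum>i<N. \<Sum>j<N. A i j * x j * y i)"
    by (simp add: dot_def apply_kernel_def sum_distrib_right)
  also have "\<dots> = (\<Sum>j<N. \<Sum>i<N. A i j * x j * y i)" by (rule sum.swap)
  also have "\<dots> = dot N x (apply_kernel N A y)"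
    unfolding dot_def apply_kernel_def sum_distrib_left
    by (intro sum.cong refl) (use assms in auto)
  finally show ?thesis .
qed

text \<open>
  The dimension count behind all eigenvalue estimates below.
\<close>

lemma homogeneous_system_nontrivial:
  fixes \<phi> :: "'j \<Rightarrow> 'i \<Rightarrow> real"
  assumes "finite J" "finite I" "card J < card I"
  shows "\<exists>y. (\<exists>i\<in>I. y i \<noteq> 0) \<and> (\<forall>j\<in>J. (\<Sum>i\<in>I. \<phi> j i * y i) = 0)"
  using assms
proof (induction J arbitrary: I \<phi> rule: finite_induct)
  case empty
  then have "I \<noteq> {}" by auto
  then show ?case by (intro exI[of _ "\<lambda>_. 1"]) auto
next
  case (insert j0 J)
  show ?case
  proof (cases "\<forall>i\<in>I. \<phi> j0 i = 0")
    case True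
    have "card J < card I" using insert by auto
    from insert.IH[OF insert.prems(1) this, of \<phi>] obtain y where
      "\<exists>i\<in>I. y i \<noteq> 0" "\<forall>j\<in>J. (\<Sum>i\<in>I. \<phi> j i * y i) = 0" by blast
    with True show ?thesis by (intro exI[of _ y]) auto
  next
    case False
    then obtain i0 where i0: "i0 \<in> I" "\<phi> j0 i0 \<noteq> 0" by auto
    \<comment> \<open>eliminate the unknown \<open>i0\<close> by means of the equation \<open>j0\<close>\<close>
    let ?I = "I - {i0}"
    let ?\<phi> = "\<lambda>j i. \<phi> j i - \<phi> j i0 * \<phi> j0 i / \<phi> j0 i0"
    have fin: "finite ?I" and c: "card J < card ?I" using insert i0 by auto
    from insert.IH[OF fin c, of ?\<phi>] obtain y where
      y: "\<exists>i\<in>?I. y i \<noteq> 0" "\<forall>j\<in>J. (\<Sum>i\<in>?I. ?\<phi> j i * y i) = 0" by blast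
    define z where "z = - (\<Sum>i\<in>?I. \<phi> j0 i * y i) / \<phi> j0 i0"
    have split: "(\<Sum>i\<in>I. \<phi> j i * (y(i0 := z)) i) = \<phi> j i0 * z + (\<Sum>i\<in>?I. \<phi> j i * y i)" for j
      using insert.prems(1) i0 by (subst sum.remove[of I i0]) (auto intro!: sum.cong)
    have "(\<Sum>i\<in>I. \<phi> j i * (y(i0 := z)) i) = 0" if "j \<in> insert j0 J" for j
    proof (cases "j = j0")
      case True
      then show ?thesis unfolding split using i0 by (simp add: z_def)
    next
      case False
      with that have "(\<Sum>i\<in>?I. ?\<phi> j i * y i) = 0" using y by auto
      then have "(\<Sum>i\<in>?I. \<phi> j i * y i) = (\<Sum>i\<in>?I. \<phi> j i0 * \<phi> j0 i / \<phi> j0 i0 * y i)"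
        by (simp add: left_diff_distrib sum_subtractf)
      also have "\<dots> = \<phi> j i0 / \<phi> j0 i0 * (\<Sum>i\<in>?I. \<phi> j0 i * y i)"
        by (simp add: sum_distrib_left mult_ac)
      finally show ?thesis unfolding split by (simp add: z_def)
    qed
    moreover have "\<exists>i\<in>I. (y(i0 := z)) i \<noteq> 0" using y(1) by auto
    ultimately show ?thesis by blast
  qed
qed

lemma quadratic_nonpos_imp_linear_zero:
  fixes \<alpha> \<beta> :: real
  assumes "\<And>t. 2 * t * \<alpha> + t\<^sup>2 * \<beta> \<le> 0"
  shows "\<alpha> = 0"
proof (rule ccontr)
  assume "\<alpha> \<noteq> 0"
  define t where "t = \<alpha> / (\<bar>\<beta>\<bar> + 1)"
  have pos: "\<bar>\<beta>\<bar> + 1 > 0" by simp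
  have "\<alpha> = t * (\<bar>\<beta>\<bar> + 1)" using pos by (simp add: t_def)
  then have "2 * t * \<alpha> + t\<^sup>2 * \<beta> = t\<^sup>2 * (2 * (\<bar>\<beta>\<bar> + 1) + \<beta>)"
    by (simp only: power2_eq_square) (simp add: algebra_simps)
  moreover have "t\<^sup>2 > 0" using \<open>\<alpha> \<noteq> 0\<close> pos by (simp add: t_def)
  moreover have "2 * (\<bar>\<beta>\<bar> + 1) + \<beta> > 0" by (cases "\<beta> \<ge> 0") auto
  ultimately show False using assms[of t] mult_pos_pos[of "t\<^sup>2" "2 * (\<bar>\<beta>\<bar> + 1) + \<beta>"] by linarith
qed

lemma continuous_on_dot [continuous_intros]:
  assumes "\<And>i. continuous_on U (\<lambda>x. f x i)" "\<And>i. continuous_on U (\<lambda>x. g x i)"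
  shows "continuous_on U (\<lambda>x. dot N (f x) (g x))"
  unfolding dot_def by (intro continuous_intros assms)

lemma compact_sphere_upto:
  "compact {x :: nat \<Rightarrow> real. (\<forall>i\<ge>N. x i = 0) \<and> dot N x x = 1 \<and> (\<forall>k<r. dot N (v k) x = 0)}"
  (is "compact ?S")
proof -
  let ?K = "\<lambda>i::nat. if i < N then {-1..1::real} else {0}"
  have "compactin (product_topology (\<lambda>_. euclidean) UNIV) (PiE UNIV ?K)"
    by (subst compactin_PiE) auto
  then have comp: "compact (PiE UNIV ?K)"
    by (simp add: euclidean_product_topology)
  have "closed ((\<Inter>i\<in>{N..}. {x::nat \<Rightarrow> real. x i = 0}) \<inter> {x. dot N x x = 1} \<inter> (\<Inter>k\<in>{..<r}. {x. dot N (v k) x = 0}))"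
    by (intro closed_Int closed_INT ballI closed_Collect_eq continuous_intros continuous_on_product_coordinates)
  then have cl: "closed ?S" by (rule back_subst[of closed]) auto
  have "?S \<subseteq> PiE UNIV ?K"
  proof
    fix x assume x: "x \<in> ?S"
    have "x i \<in> {-1..1}" if "i < N" for i
    proof -
      have "x i * x i \<le> (\<Sum>i<N. x i * x i)" by (rule member_le_sum) (use that in auto)
      then have "(x i)\<^sup>2 \<le> 1" using x by (simp add: dot_def power2_eq_square)
      then show ?thesis using abs_square_le_1[of "x i"] by (auto simp: abs_le_iff)
    qed
    with x show "x \<in> PiE UNIV ?K" by auto
  qed
  then have "?S = PiE UNIV ?K \<inter> ?S" by blast
  then show ?thesis using compact_Int_closed[OF comp cl] by simp
qed

text \<open>
  Let \<open>x\<close> maximise the quadratic form, with maximum \<open>\<mu>\<close>, on the unit vectors orthogonal to the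
  eigenvectors found so far. The residue \<open>d = A x - \<mu> x\<close> is orthogonal to them too, so moving from \<open>x\<close>
  to \<open>x + t d\<close> is admissible; maximality for both signs of \<open>t\<close> forces \<open>d = 0\<close>.
\<close>

lemma next_eigenvector:
  assumes sym: "\<And>i j. i < N \<Longrightarrow> j < N \<Longrightarrow> A i j = A j i"
    and eig: "\<And>k i. k < r \<Longrightarrow> i < N \<Longrightarrow> apply_kernel N A (v k) i = e k * v k i"
    and r: "r < N"
  shows "\<exists>x \<mu>. dot N x x = 1 \<and> (\<forall>k<r. dot N (v k) x = 0) \<and>
           (\<forall>i<N. apply_kernel N A x i = \<mu> * x i)"
proof -
  let ?ip = "dot N" and ?A = "apply_kernel N A"
  let ?S = "{x :: nat \<Rightarrow> real. (\<forall>i\<ge>N. x i = 0) \<and> ?ip x x = 1 \<and> (\<forall>k<r. ?ip (v k) x = 0)}"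
  have norm1: "(\<lambda>i. y i / sqrt (?ip y y)) \<in> ?S"
    if "\<forall>i\<ge>N. y i = 0" "\<forall>k<r. ?ip (v k) y = 0" "?ip y y \<noteq> 0" for y
  proof -
    have p: "?ip y y > 0" using that(3) dot_nonneg[of N y] by linarith
    have "?ip (\<lambda>i. y i / sqrt (?ip y y)) (\<lambda>i. y i / sqrt (?ip y y)) = (\<Sum>i<N. y i * y i) / ?ip y y"
      using p by (simp add: dot_def[of N "\<lambda>i. y i / sqrt (?ip y y)"] sum_divide_distrib)
    also have "\<dots> = 1" using p by (simp add: dot_def)
    finally have 1: "?ip (\<lambda>i. y i / sqrt (?ip y y)) (\<lambda>i. y i / sqrt (?ip y y)) = 1" .
    have "?ip (v k) (\<lambda>i. y i / sqrt (?ip y y)) = ?ip (v k) y / sqrt (?ip y y)" for k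
      by (simp add: dot_def[of N "v k"] sum_divide_distrib)
    with 1 that show ?thesis by simp
  qed
  obtain y where y: "\<exists>i\<in>{..<N}. y i \<noteq> 0" "\<forall>k\<in>{..<r}. (\<Sum>i<N. v k i * y i) = 0"
    using homogeneous_system_nontrivial[of "{..<r}" "{..<N}" v] r by auto
  define y' where "y' i = (if i < N then y i else 0)" for i
  have y': "\<forall>k<r. ?ip (v k) y' = 0" "?ip y' y' \<noteq> 0" "\<forall>i\<ge>N. y' i = 0"
    unfolding dot_self_eq_0_iff using y by (auto simp: y'_def dot_def)
  have ne: "?S \<noteq> {}" using norm1[OF y'(3,1,2)] by (rule ex_in_conv[THEN iffD1, OF exI])
  have cont: "continuous_on ?S (\<lambda>x. ?ip x (?A x))"
    unfolding apply_kernel_def by (intro continuous_intros continuous_on_product_coordinates continuous_on_subset[OF continuous_on_product_coordinates]) auto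
  obtain x where x: "x \<in> ?S" and max: "\<And>z. z \<in> ?S \<Longrightarrow> ?ip z (?A z) \<le> ?ip x (?A x)"
    using continuous_attains_sup[OF compact_sphere_upto ne cont] by blast
  define \<mu> where "\<mu> = ?ip x (?A x)"
  have le: "?ip z (?A z) \<le> \<mu> * ?ip z z" if z: "\<forall>i\<ge>N. z i = 0" "\<forall>k<r. ?ip (v k) z = 0" for z
  proof (cases "?ip z z = 0")
    case True
    then have "\<forall>i<N. z i = 0" by (simp add: dot_self_eq_0_iff)
    then show ?thesis by (simp add: dot_def)
  next
    case False
    then have p: "?ip z z > 0" using dot_nonneg[of N z] by linarith
    let ?s = "sqrt (?ip z z)"
    have Az: "?A (\<lambda>i. z i / ?s) = (\<lambda>i. ?A z i / ?s)"
      by (auto simp: apply_kernel_def sum_divide_distrib)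
    have "?ip (\<lambda>i. z i / ?s) (?A (\<lambda>i. z i / ?s)) = ?ip z (?A z) / ?ip z z"
      unfolding Az using p by (simp add: dot_def[of N "\<lambda>i. z i / ?s"] dot_def[of N z "?A z"] sum_divide_distrib)
    then have "?ip z (?A z) / ?ip z z \<le> \<mu>"
      using max[OF norm1[OF z False]] by (simp add: \<mu>_def)
    then show ?thesis using p by (simp add: field_simps)
  qed
  define d where "d i = (if i < N then ?A x i - \<mu> * x i else 0)" for i
  have ip_d: "?ip y d = ?ip y (?A x) - \<mu> * ?ip y x" for y
    unfolding dot_def d_def by (simp add: sum_subtractf[symmetric] sum_distrib_left algebra_simps)
  have dS: "\<forall>i\<ge>N. d i = 0" "\<forall>k<r. ?ip (v k) d = 0"
  proof -
    show "\<forall>k<r. ?ip (v k) d = 0"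
    proof (intro allI impI)
      fix k assume k: "k < r"
      have "?ip (v k) (?A x) = ?ip (?A (v k)) x" by (rule apply_kernel_symmetric[symmetric, OF sym])
      also have "\<dots> = e k * ?ip (v k) x" using eig[OF k]
        by (simp add: dot_def sum_distrib_left mult.assoc)
      finally show "?ip (v k) d = 0" using x k by (simp add: ip_d)
    qed
  qed (simp add: d_def)
  have "2 * t * ?ip d d + t\<^sup>2 * (?ip d (?A d) - \<mu> * ?ip d d) \<le> 0" for t
  proof -
    let ?z = "\<lambda>i. x i + t * d i"
    have ipl: "?ip (\<lambda>i. f i + t * g i) h = ?ip f h + t * ?ip g h" for f g h
      by (simp add: dot_def algebra_simps sum.distrib sum_distrib_left)
    have ipr: "?ip h (\<lambda>i. f i + t * g i) = ?ip h f + t * ?ip h g" for f g h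
      by (simp add: dot_def algebra_simps sum.distrib sum_distrib_left)
    have A: "?A ?z = (\<lambda>i. ?A x i + t * ?A d i)"
      by (auto simp: apply_kernel_def algebra_simps sum.distrib sum_distrib_left)
    have "?ip ?z (?A ?z) \<le> \<mu> * ?ip ?z ?z"
      using x dS by (intro le) (auto simp: ipr)
    then have "?ip x (?A x) + t * ?ip x (?A d) + t * (?ip d (?A x) + t * ?ip d (?A d))
        \<le> \<mu> * (?ip x x + t * ?ip x d + t * (?ip d x + t * ?ip d d))"
      unfolding A ipl ipr by (simp add: algebra_simps)
    moreover have "?ip x (?A d) = ?ip d (?A x)"
      by (subst apply_kernel_symmetric[OF sym, symmetric]) (auto simp: dot_commute)
    moreover have "?ip x d = ?ip d x" by (rule dot_commute)
    moreover have "?ip d (?A x) = ?ip d d + \<mu> * ?ip d x" using ip_d[of d] by simp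
    moreover have "?ip x x = 1" using x by simp
    ultimately show ?thesis by (simp add: \<mu>_def[symmetric] power2_eq_square algebra_simps)
  qed
  then have "?ip d d = 0" by (rule quadratic_nonpos_imp_linear_zero)
  then have "\<forall>i<N. d i = 0" by (simp add: dot_self_eq_0_iff)
  then have "\<forall>i<N. ?A x i = \<mu> * x i" by (auto simp: d_def)
  then show ?thesis using x by blast
qed

text \<open>
  Vectors are functions of which only the values at indices below \<open>N\<close> count, so that the dimension
  may vary within one proof.
\<close>

locale eigensystem =
  fixes N :: nat and A :: "nat \<Rightarrow> nat \<Rightarrow> real" and e :: "nat \<Rightarrow> real" and v :: "nat \<Rightarrow> nat \<Rightarrow> real"
  assumes symmetric: "\<And>i j. i < N \<Longrightarrow> j < N \<Longrightarrow> A i j = A j i"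
    and orthonormal: "\<And>k l. k < N \<Longrightarrow> l < N \<Longrightarrow> dot N (v k) (v l) = (if k = l then 1 else 0)"
    and eigenvector: "\<And>k i. k < N \<Longrightarrow> i < N \<Longrightarrow> apply_kernel N A (v k) i = e k * v k i"

lemma eigensystem_exists:
  assumes sym: "\<And>i j. i < N \<Longrightarrow> j < N \<Longrightarrow> A i j = A j i"
  shows "\<exists>e v. eigensystem N A e v"
proof -
  have "\<exists>e v. (\<forall>k<r. \<forall>l<r. dot N (v k) (v l) = (if k = l then 1 else 0)) \<and>
         (\<forall>k<r. \<forall>i<N. apply_kernel N A (v k) i = e k * v k i)" if "r \<le> N" for r
    using that
  proof (induction r)
    case (Suc r)
    then obtain e v where ortho: "\<forall>k<r. \<forall>l<r. dot N (v k) (v l) = (if k = l then 1 else 0)"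
      and eig: "\<forall>k<r. \<forall>i<N. apply_kernel N A (v k) i = e k * v k i" by auto
    obtain x \<mu> where x: "dot N x x = 1" "\<forall>k<r. dot N (v k) x = 0"
      "\<forall>i<N. apply_kernel N A x i = \<mu> * x i"
      using next_eigenvector[of N A r v e] sym eig Suc.prems by auto
    have x': "dot N x (v k) = 0" if "k < r" for k
      using x(2) that by (simp add: dot_commute)
    show ?case
      by (rule exI[of _ "e(r := \<mu>)"], rule exI[of _ "v(r := x)"])
         (use ortho eig x x' in \<open>auto simp: less_Suc_eq\<close>)
  qed simp
  from this[of N] show ?thesis using sym by (auto simp: eigensystem_def)
qed

context eigensystem
begin

lemma completeness:
  assumes "i < N" "j < N"
  shows "(\<Sum>k<N. v k i * v k j) = (if i = j then 1 else 0)"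
proof -
  let ?P = "Matrix.mat N N (\<lambda>(i, k). v k i)"
  have 1: "transpose_mat ?P * ?P = 1\<^sub>m N"
    by (rule eq_matI) (use orthonormal in \<open>auto simp: scalar_prod_def dot_def lessThan_atLeast0\<close>)
  have "?P * transpose_mat ?P = 1\<^sub>m N"
    by (rule mat_mult_left_right_inverse[OF _ _ 1]) auto
  then have "(?P * transpose_mat ?P) $$ (i, j) = 1\<^sub>m N $$ (i, j)" by simp
  then show ?thesis using assms by (simp add: scalar_prod_def lessThan_atLeast0)
qed

lemma expansion:
  assumes "i < N"
  shows "x i = (\<Sum>k<N. dot N (v k) x * v k i)"
proof -
  have "(\<Sum>k<N. dot N (v k) x * v k i) = (\<Sum>j<N. x j * (\<Sum>k<N. v k j * v k i))"
    by (simp add: dot_def sum_distrib_left sum_distrib_right mult_ac) (rule sum.swap)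
  also have "\<dots> = (\<Sum>j<N. if j = i then x j else 0)"
    using assms by (intro sum.cong refl) (auto simp: completeness)
  also have "\<dots> = x i" using assms by simp
  finally show ?thesis ..
qed

lemma inner_combination:
  assumes I: "I \<subseteq> {..<N}"
  shows "dot N (\<lambda>i. \<Sum>k\<in>I. c k * v k i) (\<lambda>i. \<Sum>k\<in>I. d k * v k i) = (\<Sum>k\<in>I. c k * d k)"
proof -
  have fin: "finite I" using I finite_subset by blast
  have "(\<Sum>l\<in>I. d l * dot N (v k) (v l)) = (\<Sum>l\<in>I. if k = l then d l else 0)" if "k \<in> I" for k
    using I that by (intro sum.cong refl) (auto simp: orthonormal subset_iff)
  then show ?thesis
    unfolding dot_sum_left dot_sum_right using fin by (auto intro!: sum.cong)
qed

lemma kernel_combination: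
  assumes "I \<subseteq> {..<N}" "i < N"
  shows "apply_kernel N A (\<lambda>i. \<Sum>k\<in>I. c k * v k i) i = (\<Sum>k\<in>I. (e k * c k) * v k i)"
  unfolding apply_kernel_sum using assms by (intro sum.cong refl) (auto simp: eigenvector subset_iff)

lemma forms_combination:
  assumes I: "I \<subseteq> {..<N}" and x: "\<And>i. i < N \<Longrightarrow> x i = (\<Sum>k\<in>I. c k * v k i)"
  shows "dot N x x = (\<Sum>k\<in>I. (c k)\<^sup>2)"
    and "dot N x (apply_kernel N A x) = (\<Sum>k\<in>I. e k * (c k)\<^sup>2)"
    and "dot N (apply_kernel N A x) (apply_kernel N A x) = (\<Sum>k\<in>I. (e k)\<^sup>2 * (c k)\<^sup>2)"
proof -
  let ?x = "\<lambda>i. \<Sum>k\<in>I. c k * v k i" and ?y = "\<lambda>i. \<Sum>k\<in>I. (e k * c k) * v k i"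
  have A: "apply_kernel N A x i = ?y i" if "i < N" for i
    using kernel_combination[OF I that, of c] x by (simp add: apply_kernel_def)
  have 1: "dot N x x = dot N ?x ?x"
    by (rule dot_cong) (auto simp: x)
  have 2: "dot N x (apply_kernel N A x) = dot N ?x ?y"
    by (rule dot_cong) (auto simp: x A)
  have 3: "dot N (apply_kernel N A x) (apply_kernel N A x) = dot N ?y ?y"
    by (rule dot_cong) (auto simp: A)
  show "dot N x x = (\<Sum>k\<in>I. (c k)\<^sup>2)"
    unfolding 1 inner_combination[OF I] by (simp add: power2_eq_square)
  show "dot N x (apply_kernel N A x) = (\<Sum>k\<in>I. e k * (c k)\<^sup>2)"
    unfolding 2 inner_combination[OF I] by (simp add: power2_eq_square mult_ac)
  show "dot N (apply_kernel N A x) (apply_kernel N A x) = (\<Sum>k\<in>I. (e k)\<^sup>2 * (c k)\<^sup>2)"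
    unfolding 3 inner_combination[OF I] by (simp add: power2_eq_square mult_ac)
qed

lemma orthogonal_expansion:
  assumes "\<And>k. k < N \<Longrightarrow> P k \<Longrightarrow> dot N (v k) x = 0" "i < N"
  shows "x i = (\<Sum>k\<in>{k. k < N \<and> \<not> P k}. dot N (v k) x * v k i)"
proof -
  have "x i = (\<Sum>k<N. dot N (v k) x * v k i)" by (rule expansion) fact
  also have "\<dots> = (\<Sum>k\<in>{k. k < N \<and> \<not> P k}. dot N (v k) x * v k i)"
    by (rule sum.mono_neutral_right) (use assms in auto)
  finally show ?thesis .
qed

text \<open>
  A vector orthogonal to all eigenvectors whose eigenvalues violate a bound is a combination of the
  others, and the diagonalised form inherits the bound. The next three lemmas are variations.
\<close>

lemma form_le_if_orthogonal:
  assumes "\<And>k. k < N \<Longrightarrow> e k > c \<Longrightarrow> dot N (v k) x = 0"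
  shows "dot N x (apply_kernel N A x) \<le> c * dot N x x"
proof -
  let ?I = "{k. k < N \<and> \<not> e k > c}"
  have I: "?I \<subseteq> {..<N}" by auto
  note f = forms_combination[OF I orthogonal_expansion[of "\<lambda>k. e k > c" x, OF assms]]
  show ?thesis unfolding f(1)[simplified] f(2)[simplified] sum_distrib_left
    by (intro sum_mono mult_right_mono) auto
qed

lemma form_gt_if_orthogonal:
  assumes "\<And>k. k < N \<Longrightarrow> e k \<le> c \<Longrightarrow> dot N (v k) x = 0"
  shows "dot N x (apply_kernel N A x) \<ge> c * dot N x x"
    and "dot N x x \<noteq> 0 \<Longrightarrow> dot N x (apply_kernel N A x) > c * dot N x x"
proof -
  let ?I = "{k. k < N \<and> \<not> e k \<le> c}"
  have I: "?I \<subseteq> {..<N}" by auto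
  note f = forms_combination[OF I orthogonal_expansion[of "\<lambda>k. e k \<le> c" x, OF assms]]
  show "dot N x (apply_kernel N A x) \<ge> c * dot N x x"
    unfolding f(1)[simplified] f(2)[simplified] sum_distrib_left
    by (intro sum_mono mult_right_mono) auto
  assume "dot N x x \<noteq> 0"
  then obtain k where k: "k \<in> ?I" "dot N (v k) x \<noteq> 0"
    unfolding f(1)[simplified] by (auto simp: not_le elim!: sum.not_neutral_contains_not_neutral)
  show "dot N x (apply_kernel N A x) > c * dot N x x"
    unfolding f(1)[simplified] f(2)[simplified] sum_distrib_left
    by (rule sum_strict_mono_ex1) (use k in \<open>auto intro!: mult_right_mono bexI[of _ k] mult_strict_right_mono\<close>)
qed

lemma ball_form_ge_if_orthogonal:
  assumes "\<And>k. k < N \<Longrightarrow> \<bar>e k\<bar> < l \<Longrightarrow> dot N (v k) x = 0" "0 \<le> l"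
  shows "dot N (apply_kernel N A x) (apply_kernel N A x) \<ge> l\<^sup>2 * dot N x x"
proof -
  let ?I = "{k. k < N \<and> \<not> \<bar>e k\<bar> < l}"
  have I: "?I \<subseteq> {..<N}" by auto
  note f = forms_combination[OF I orthogonal_expansion[of "\<lambda>k. \<bar>e k\<bar> < l" x, OF assms(1)]]
  have "l\<^sup>2 \<le> (e k)\<^sup>2" if "k \<in> ?I" for k
    using that assms(2) by (simp add: abs_le_square_iff[symmetric])
  then show ?thesis unfolding f(1)[simplified] f(3)[simplified] sum_distrib_left
    by (intro sum_mono mult_right_mono) auto
qed

lemma ball_form_lt_if_orthogonal:
  assumes "\<And>k. k < N \<Longrightarrow> \<not> \<bar>e k\<bar> < l \<Longrightarrow> dot N (v k) x = 0" "dot N x x \<noteq> 0"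
  shows "dot N (apply_kernel N A x) (apply_kernel N A x) < l\<^sup>2 * dot N x x"
proof -
  let ?I = "{k. k < N \<and> \<not> \<not> \<bar>e k\<bar> < l}"
  have I: "?I \<subseteq> {..<N}" by auto
  note f = forms_combination[OF I orthogonal_expansion[of "\<lambda>k. \<not> \<bar>e k\<bar> < l" x, OF assms(1)]]
  have lt: "(e k)\<^sup>2 < l\<^sup>2" if "k \<in> ?I" for k
    using that by (intro power2_strict_mono) auto
  from assms(2) obtain k where k: "k \<in> ?I" "dot N (v k) x \<noteq> 0"
    unfolding f(1)[simplified] by (auto elim!: sum.not_neutral_contains_not_neutral)
  show ?thesis
    unfolding f(1)[simplified] f(3)[simplified] sum_distrib_left
    by (rule sum_strict_mono_ex1)
       (use k lt in \<open>auto intro!: mult_right_mono bexI[of _ k] mult_strict_right_mono intro: less_imp_le\<close>)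
qed

lemma constrained_vector:
  fixes \<phi> :: "'j \<Rightarrow> nat \<Rightarrow> real"
  assumes J: "finite J" and I: "I \<subseteq> {..<N}" and card: "card J < card I"
  shows "\<exists>x. (\<forall>i\<ge>N. x i = 0) \<and> dot N x x > 0 \<and> (\<forall>j\<in>J. dot N (\<phi> j) x = 0) \<and>
    (\<forall>k<N. k \<notin> I \<longrightarrow> dot N (v k) x = 0)"
proof -
  have fin: "finite I" using I finite_subset by blast
  obtain y where y: "\<exists>k\<in>I. y k \<noteq> 0" "\<forall>j\<in>J. (\<Sum>k\<in>I. dot N (\<phi> j) (v k) * y k) = 0"
    using homogeneous_system_nontrivial[OF J fin card, of "\<lambda>j k. dot N (\<phi> j) (v k)"] by auto
  define x where "x i = (if i < N then \<Sum>k\<in>I. y k * v k i else 0)" for i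
  have ip: "dot N z x = (\<Sum>k\<in>I. dot N z (v k) * y k)" for z
  proof -
    have "dot N z x = dot N z (\<lambda>i. \<Sum>k\<in>I. y k * v k i)"
      by (rule dot_cong) (auto simp: x_def)
    then show ?thesis by (simp add: dot_sum_right mult.commute)
  qed
  have "dot N x x = (\<Sum>k\<in>I. (y k)\<^sup>2)"
    by (rule forms_combination(1)[OF I]) (simp add: x_def)
  also have "\<dots> > 0" using y(1) fin by (auto intro: sum_pos2)
  finally have pos: "dot N x x > 0" .
  have "dot N (v k) x = 0" if "k < N" "k \<notin> I" for k
    unfolding ip using I that by (intro sum.neutral) (auto simp: orthonormal subset_iff)
  with pos y(2) show ?thesis by (intro exI[of _ x]) (auto simp: ip x_def)
qed

text \<open>
  The upper half of the min-max principle: if more eigenvalues satisfied \<open>P\<close> than there are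
  constraints, their eigenspace would contain a nonzero vector that satisfies all constraints.
\<close>

lemma card_less_eq_constraints:
  fixes \<phi> :: "'j \<Rightarrow> nat \<Rightarrow> real"
  assumes J: "finite J"
    and vanish: "\<And>x. (\<forall>i\<ge>N. x i = 0) \<Longrightarrow> (\<forall>j\<in>J. dot N (\<phi> j) x = 0) \<Longrightarrow>
      (\<forall>k<N. \<not> P k \<longrightarrow> dot N (v k) x = 0) \<Longrightarrow> dot N x x > 0 \<Longrightarrow> False"
  shows "card {k. k < N \<and> P k} \<le> card J"
proof (rule ccontr)
  assume "\<not> ?thesis"
  then have "card J < card {k. k < N \<and> P k}" by simp
  from constrained_vector[OF J _ this, of \<phi>] vanish show False by auto
qed

text \<open>
  The lower half of the min-max principle, for the form \<open>\<parallel>A x\<parallel>\<^sup>2\<close>: some nonzero combination of the test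
  vectors would be orthogonal to all small eigenspaces if these were fewer.
\<close>

lemma card_ball_ge:
  assumes R: "finite R" and l: "0 \<le> l"
    and test: "\<And>y. (\<exists>r\<in>R. y r \<noteq> 0) \<Longrightarrow>
      dot N (apply_kernel N A (\<lambda>i. \<Sum>r\<in>R. y r * u r i)) (apply_kernel N A (\<lambda>i. \<Sum>r\<in>R. y r * u r i)) <
      l\<^sup>2 * dot N (\<lambda>i. \<Sum>r\<in>R. y r * u r i) (\<lambda>i. \<Sum>r\<in>R. y r * u r i)"
  shows "card R \<le> card {k. k < N \<and> \<bar>e k\<bar> < l}"
proof (rule ccontr)
  assume "\<not> ?thesis"
  then have lt: "card {k. k < N \<and> \<bar>e k\<bar> < l} < card R" by simp
  obtain y where y: "\<exists>r\<in>R. y r \<noteq> 0" "\<forall>k\<in>{k. k < N \<and> \<bar>e k\<bar> < l}. (\<Sum>r\<in>R. dot N (v k) (u r) * y r) = 0"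
    using homogeneous_system_nontrivial[OF _ R lt, of "\<lambda>k r. dot N (v k) (u r)"] by auto
  let ?x = "\<lambda>i. \<Sum>r\<in>R. y r * u r i"
  have "dot N (apply_kernel N A ?x) (apply_kernel N A ?x) \<ge> l\<^sup>2 * dot N ?x ?x"
    by (rule ball_form_ge_if_orthogonal[OF _ l]) (use y(2) in \<open>auto simp: dot_sum_right mult.commute\<close>)
  with test[OF y(1)] show False by simp
qed

lemma similar_diagonal: "similar_mat (Matrix.mat N N (\<lambda>(i, j). A i j)) (Matrix.mat N N (\<lambda>(i, j). if i = j then e i else 0))"
proof -
  let ?A = "Matrix.mat N N (\<lambda>(i, j). A i j)" and ?D = "Matrix.mat N N (\<lambda>(i, j). if i = j then e i else 0)"
  let ?P = "Matrix.mat N N (\<lambda>(i, k). v k i)" and ?Q = "Matrix.mat N N (\<lambda>(k, i). v k i)"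
  have PQ: "?P * ?Q = 1\<^sub>m N"
    by (rule eq_matI) (use completeness in \<open>auto simp: scalar_prod_def lessThan_atLeast0\<close>)
  have QP: "?Q * ?P = 1\<^sub>m N"
    by (rule eq_matI) (use orthonormal in \<open>auto simp: scalar_prod_def dot_def lessThan_atLeast0\<close>)
  have "?A * ?P = ?P * ?D"
  proof (rule eq_matI)
    fix i k assume "i < dim_row (?P * ?D)" "k < dim_col (?P * ?D)"
    then have ik: "i < N" "k < N" by auto
    have "(?A * ?P) $$ (i, k) = apply_kernel N A (v k) i"
      using ik by (simp add: scalar_prod_def apply_kernel_def lessThan_atLeast0)
    also have "\<dots> = e k * v k i" using ik by (simp add: eigenvector)
    also have "\<dots> = (?P * ?D) $$ (i, k)"
      using ik by (simp add: scalar_prod_def if_distrib cong: if_cong)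
    finally show "(?A * ?P) $$ (i, k) = (?P * ?D) $$ (i, k)" .
  qed auto
  then have "?A * ?P * ?Q = ?P * ?D * ?Q" by simp
  moreover have "?A * ?P * ?Q = ?A"
    by (subst assoc_mult_mat[of _ N N _ N _ N]) (auto simp: PQ)
  ultimately have "?A = ?P * ?D * ?Q" by simp
  then have "similar_mat_wit ?A ?D ?P ?Q"
    by (auto simp: similar_mat_wit_def Let_def PQ QP)
  then show ?thesis by (auto simp: similar_mat_def)
qed

lemma char_poly_eq: "char_poly (Matrix.mat N N (\<lambda>(i, j). A i j)) = (\<Prod>k<N. [:- e k, 1:])"
proof -
  let ?D = "Matrix.mat N N (\<lambda>(i, j). if i = j then e i else 0)"
  have "char_poly (Matrix.mat N N (\<lambda>(i, j). A i j)) = char_poly ?D"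
    by (rule char_poly_similar[OF similar_diagonal])
  also have "\<dots> = (\<Prod>a\<leftarrow>diag_mat ?D. [:- a, 1:])"
    by (rule char_poly_upper_triangular[of _ N]) auto
  also have "\<dots> = (\<Prod>k<N. [:- e k, 1:])"
    by (simp add: diag_mat_def prod.distinct_set_conv_list[symmetric] lessThan_atLeast0 o_def cong: map_cong)
  finally show ?thesis .
qed

end

lemma order_prod_linear:
  fixes e :: "'k \<Rightarrow> real"
  assumes "finite K"
  shows "Polynomial.order x (\<Prod>k\<in>K. [:- e k, 1:]) = card {k\<in>K. e k = x}"
  using assms
proof (induction K rule: finite_induct)
  case (insert k K)
  have nz: "(\<Prod>k\<in>K. [:- e k, 1:]) \<noteq> 0" using insert by simp
  have "Polynomial.order x [:- e k, 1:] = (if e k = x then 1 else 0)"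
    using order_power_n_n[of x 1] by (auto simp: order_0I)
  moreover have "{l \<in> insert k K. e l = x} = (if e k = x then insert k {l\<in>K. e l = x} else {l\<in>K. e l = x})"
    by auto
  ultimately show ?case using insert nz unfolding prod.insert[OF insert.hyps]
    by (subst order_mult) (auto simp del: mult_pCons_left mult_pCons_right)
qed (simp add: order_1_eq_0)

lemma empirical_eigenvalue_distr_eigensystem:
  assumes "eigensystem N A e v" and "B \<in> sets borel"
  shows "emeasure (empirical_eigenvalue_distr (Matrix.mat N N (\<lambda>(i, j). A i j))) B =
    ennreal (real (card {k. k < N \<and> e k \<in> B}) / real N)"
proof -
  interpret eigensystem N A e v by fact
  let ?A = "Matrix.mat N N (\<lambda>(i, j). A i j)"
  have ev: "eigenvalue ?A x \<longleftrightarrow> (\<exists>k<N. e k = x)" for x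
    by (subst eigenvalue_root_char_poly[of _ N]) (auto simp: char_poly_eq poly_prod)
  then have evs: "{x. eigenvalue ?A x} = e ` {..<N}" by auto
  have "emeasure (empirical_eigenvalue_distr ?A) B =
     emeasure (point_measure (e ` {..<N}) (\<lambda>x. ennreal (real (card {k\<in>{..<N}. e k = x}) / real N))) (B \<inter> e ` {..<N})"
    unfolding empirical_eigenvalue_distr_def evs char_poly_eq order_prod_linear[OF finite_lessThan]
    using assms(2) by (subst emeasure_distr) (auto simp: space_point_measure measurable_def sets_point_measure Int_commute vimage_def)
  also have "\<dots> = (\<Sum>x\<in>B \<inter> e ` {..<N}. ennreal (real (card {k\<in>{..<N}. e k = x}) / real N))"
    by (rule emeasure_point_measure_finite) auto
  also have "\<dots> = ennreal (\<Sum>x\<in>B \<inter> e ` {..<N}. real (card {k\<in>{..<N}. e k = x}) / real N)"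
    by (rule sum_ennreal) auto
  also have "(\<Sum>x\<in>B \<inter> e ` {..<N}. real (card {k\<in>{..<N}. e k = x}) / real N)
      = real (\<Sum>x\<in>B \<inter> e ` {..<N}. card {k\<in>{..<N}. e k = x}) / real N"
    by (simp add: sum_divide_distrib)
  also have "(\<Sum>x\<in>B \<inter> e ` {..<N}. card {k\<in>{..<N}. e k = x}) = card (\<Union>x\<in>B \<inter> e ` {..<N}. {k\<in>{..<N}. e k = x})"
    by (rule card_UN_disjoint[symmetric]) auto
  also have "(\<Union>x\<in>B \<inter> e ` {..<N}. {k\<in>{..<N}. e k = x}) = {k. k < N \<and> e k \<in> B}" by auto
  finally show ?thesis .
qed

section \<open>Alternations of a walk\<close>

text \<open>
  The state \<open>(C, D)\<close> at time \<open>t\<close> counts the completed moves of the walk \<open>(-1)\<^sup>t v\<^sub>t\<close> and records the progress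
  of the current one from its most favourable starting point. The starting points of the move
  number \<open>C\<close> have the parity of \<open>C\<close>, its end point has the other parity: this is the only kind of
  displacement that the matrix sees. If \<open>C + t\<close> is even, the next time can only end the move; if it
  is odd, the next time is a candidate for a better starting point. At a completion the end point
  becomes the first starting point of the next move.
\<close>

definition alternation_step :: "real \<Rightarrow> real \<Rightarrow> nat \<Rightarrow> nat \<times> real \<Rightarrow> nat \<times> real" where
  "alternation_step L \<xi> t s = (case s of (C, D) \<Rightarrow>
     if even (C + t) then (if D - \<xi> \<ge> L then (C + 1, 0) else (C, D - \<xi>)) else (C, max 0 (D + \<xi>)))"

fun alternation :: "real \<Rightarrow> (nat \<Rightarrow> real) \<Rightarrow> nat \<Rightarrow> nat \<times> real" where
  "alternation L \<xi> 0 = (0, 0)"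
| "alternation L \<xi> (Suc t) = alternation_step L (\<xi> t) t (alternation L \<xi> t)"

text \<open>
  Here \<open>\<tau>\<close> lists the completion times, \<open>q\<close> the starting points of the completed moves, and \<open>p\<close> is the
  best starting point of the current one. No pair inside a move reaches \<open>L\<close>, since the move would
  have been completed earlier.
\<close>

lemma alternation_invariant:
  fixes v :: "nat \<Rightarrow> real"
  assumes v: "\<And>t. v (Suc t) = - v t - \<xi> t" and L: "L > 0"
    and CD: "alternation L \<xi> t = (C, D)"
  shows "\<exists>\<tau> q p. \<tau> 0 = 0 \<and>
    (\<forall>k<C. \<tau> k \<le> q k \<and> q k < \<tau> (Suc k) \<and> even (q k + k) \<and> L \<le> v (q k) + v (\<tau> (Suc k))) \<and>
    (\<forall>k\<le>C. even (\<tau> k + k)) \<and>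
    (\<forall>k<C. \<forall>i j. \<tau> k \<le> i \<longrightarrow> i < j \<longrightarrow> j < \<tau> (Suc k) \<longrightarrow> even (i + k) \<longrightarrow> odd (j + k) \<longrightarrow> v i + v j < L) \<and>
    (\<forall>i j. \<tau> C \<le> i \<longrightarrow> i < j \<longrightarrow> j \<le> t \<longrightarrow> even (i + C) \<longrightarrow> odd (j + C) \<longrightarrow> v i + v j < L) \<and>
    \<tau> C \<le> p \<and> p \<le> t \<and> even (p + C) \<and> (\<forall>i. \<tau> C \<le> i \<longrightarrow> i \<le> t \<longrightarrow> even (i + C) \<longrightarrow> v i \<le> v p) \<and>
    D = (if even (t + C) then v p - v t else v p + v t)"
  using CD
proof (induction t arbitrary: C D)
  case 0
  then show ?case
    by (intro exI[of _ "\<lambda>_. 0"] exI[of _ "0::nat"]) auto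
next
  case (Suc t)
  obtain C0 D0 where s: "alternation L \<xi> t = (C0, D0)" by fastforce
  from Suc.IH[OF s] obtain \<tau> q p where t0: "\<tau> 0 = 0"
    and q: "\<forall>k<C0. \<tau> k \<le> q k \<and> q k < \<tau> (Suc k) \<and> even (q k + k) \<and> L \<le> v (q k) + v (\<tau> (Suc k))"
    and par: "\<forall>k\<le>C0. even (\<tau> k + k)"
    and nd: "\<forall>k<C0. \<forall>i j. \<tau> k \<le> i \<longrightarrow> i < j \<longrightarrow> j < \<tau> (Suc k) \<longrightarrow> even (i + k) \<longrightarrow> odd (j + k) \<longrightarrow> v i + v j < L"
    and nd': "\<forall>i j. \<tau> C0 \<le> i \<longrightarrow> i < j \<longrightarrow> j \<le> t \<longrightarrow> even (i + C0) \<longrightarrow> odd (j + C0) \<longrightarrow> v i + v j < L"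
    and p: "\<tau> C0 \<le> p" "p \<le> t" "even (p + C0)"
    and mx: "\<forall>i. \<tau> C0 \<le> i \<longrightarrow> i \<le> t \<longrightarrow> even (i + C0) \<longrightarrow> v i \<le> v p"
    and D0: "D0 = (if even (t + C0) then v p - v t else v p + v t)" by blast
  have step: "alternation_step L (\<xi> t) t (C0, D0) = (C, D)" using Suc.prems s by simp
  show ?case
  proof (cases "even (C0 + t)")
    case ev: True
    then have ev': "even (t + C0)" by (simp add: add.commute)
    have D1: "D0 - \<xi> t = v p + v (Suc t)" using D0 ev' by (simp add: v)
    show ?thesis
    proof (cases "D0 - \<xi> t \<ge> L")
      case True
      then have C: "C = Suc C0" "D = 0" using step ev by (auto simp: alternation_step_def)
      let ?\<tau> = "\<tau>(Suc C0 := Suc t)" and ?q = "q(C0 := p)"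
      have o: "even (Suc t + Suc C0)" using ev' by simp
      show ?thesis unfolding C
      proof (rule exI[of _ ?\<tau>], rule exI[of _ ?q], rule exI[of _ "Suc t"], intro conjI)
        show "?\<tau> 0 = 0" using t0 by simp
        show "\<forall>k<Suc C0. ?\<tau> k \<le> ?q k \<and> ?q k < ?\<tau> (Suc k) \<and> even (?q k + k) \<and> L \<le> v (?q k) + v (?\<tau> (Suc k))"
          using q p True D1 by (auto simp: less_Suc_eq)
        show "\<forall>k\<le>Suc C0. even (?\<tau> k + k)" using par o by (auto simp: le_Suc_eq)
        show "\<forall>k<Suc C0. \<forall>i j. ?\<tau> k \<le> i \<longrightarrow> i < j \<longrightarrow> j < ?\<tau> (Suc k) \<longrightarrow> even (i + k) \<longrightarrow> odd (j + k) \<longrightarrow> v i + v j < L"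
          using nd nd' by (auto simp: less_Suc_eq le_simps)
        show "even (Suc t + Suc C0)" by (rule o)
      qed (use o in \<open>auto simp: le_Suc_eq le_antisym\<close>)
    next
      case False
      then have C: "C = C0" "D = D0 - \<xi> t" using step ev by (auto simp: alternation_step_def)
      have o: "odd (Suc t + C0)" using ev' by simp
      have nd2: "v i + v j < L" if "\<tau> C0 \<le> i" "i < j" "j \<le> Suc t" "even (i + C0)" "odd (j + C0)" for i j
      proof (cases "j = Suc t")
        case True
        then have "v i \<le> v p" using mx that by auto
        then show ?thesis using False D1 True by simp
      next
        case False
        then show ?thesis using nd' that by auto
      qed
      have mx2: "v i \<le> v p" if "\<tau> C0 \<le> i" "i \<le> Suc t" "even (i + C0)" for i
        using that mx o by (cases "i = Suc t") auto
      show ?thesis unfolding C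
        by (rule exI[of _ \<tau>], rule exI[of _ q], rule exI[of _ p], intro conjI)
           (use t0 q par nd nd2 p mx2 o D1 in \<open>auto simp: le_Suc_eq\<close>)
    qed
  next
    case od: False
    then have od': "odd (t + C0)" by (simp add: add.commute)
    have C: "C = C0" "D = max 0 (D0 + \<xi> t)" using step od by (auto simp: alternation_step_def)
    have D1: "D0 + \<xi> t = v p - v (Suc t)" using D0 od' by (simp add: v)
    have o: "even (Suc t + C0)" using od' by simp
    have nd2: "v i + v j < L" if "\<tau> C0 \<le> i" "i < j" "j \<le> Suc t" "even (i + C0)" "odd (j + C0)" for i j
    proof -
      have "j \<noteq> Suc t" using that o by auto
      then show ?thesis using nd' that by auto
    qed
    define p' where "p' = (if D0 + \<xi> t \<ge> 0 then p else Suc t)"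
    have mx2: "v i \<le> v p'" if "\<tau> C0 \<le> i" "i \<le> Suc t" "even (i + C0)" for i
      using that mx D1 by (cases "i = Suc t") (auto simp: p'_def intro: order_trans[of _ "v p"])
    have p': "\<tau> C0 \<le> p'" "p' \<le> Suc t" "even (p' + C0)"
      using p o by (auto simp: p'_def)
    have D2: "max 0 (D0 + \<xi> t) = v p' - v (Suc t)" using D1 by (auto simp: p'_def)
    show ?thesis unfolding C
      by (rule exI[of _ \<tau>], rule exI[of _ q], rule exI[of _ p'], intro conjI)
         (use t0 q par nd nd2 p' mx2 o D2 in \<open>auto\<close>)
  qed
qed

text \<open>
  The two halves serve opposite purposes: the reached levels at the points \<open>q k\<close> and \<open>\<tau> (Suc k)\<close> produce
  small eigenvalues, the unreached ones inside each block exclude further ones. The unfinished last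
  move is closed off at \<open>Suc T\<close>.
\<close>

lemma alternation_partition:
  fixes v :: "nat \<Rightarrow> real"
  assumes v: "\<And>t. v (Suc t) = - v t - \<xi> t" and L: "L > 0"
    and C: "fst (alternation L \<xi> T) = C"
  obtains \<tau> q where "\<tau> 0 = 0" "\<tau> (Suc C) = Suc T" "\<And>k. k \<le> C \<Longrightarrow> even (\<tau> k + k)" "\<And>k. k \<le> C \<Longrightarrow> \<tau> k < \<tau> (Suc k)"
    "\<And>k. k < C \<Longrightarrow> \<tau> k \<le> q k \<and> q k < \<tau> (Suc k) \<and> even (q k + k) \<and> L \<le> v (q k) + v (\<tau> (Suc k))"
    "\<And>k i j. k \<le> C \<Longrightarrow> \<tau> k \<le> i \<Longrightarrow> i < j \<Longrightarrow> j < \<tau> (Suc k) \<Longrightarrow> even (i + k) \<Longrightarrow> odd (j + k) \<Longrightarrow> v i + v j < L"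
proof -
  obtain D where CD: "alternation L \<xi> T = (C, D)" using C by (cases "alternation L \<xi> T") auto
  obtain \<tau> q p where *: "\<tau> 0 = 0"
    "\<forall>k<C. \<tau> k \<le> q k \<and> q k < \<tau> (Suc k) \<and> even (q k + k) \<and> L \<le> v (q k) + v (\<tau> (Suc k))"
    "\<forall>k\<le>C. even (\<tau> k + k)"
    "\<forall>k<C. \<forall>i j. \<tau> k \<le> i \<longrightarrow> i < j \<longrightarrow> j < \<tau> (Suc k) \<longrightarrow> even (i + k) \<longrightarrow> odd (j + k) \<longrightarrow> v i + v j < L"
    "\<forall>i j. \<tau> C \<le> i \<longrightarrow> i < j \<longrightarrow> j \<le> T \<longrightarrow> even (i + C) \<longrightarrow> odd (j + C) \<longrightarrow> v i + v j < L"
    "\<tau> C \<le> p" "p \<le> T" using alternation_invariant[OF v L CD] by (elim exE conjE) (rule that)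
  let ?\<tau> = "\<tau>(Suc C := Suc T)"
  show ?thesis
  proof (rule that[of ?\<tau> q])
    show "?\<tau> k < ?\<tau> (Suc k)" if "k \<le> C" for k
    proof (cases "k = C")
      case True
      then show ?thesis using * by simp
    next
      case False
      then have "\<tau> k \<le> q k" "q k < \<tau> (Suc k)" using *(2) that by auto
      then show ?thesis using False that by simp
    qed
    show "v i + v j < L" if "k \<le> C" "?\<tau> k \<le> i" "i < j" "j < ?\<tau> (Suc k)" "even (i + k)" "odd (j + k)" for k i j
    proof (cases "k = C")
      case True
      then show ?thesis using *(5)[rule_format, of i j] that by simp
    next
      case False
      then show ?thesis using *(4)[rule_format, of k i j] that by simp
    qed
  qed (use * in auto)
qed

section \<open>Eigenvalue counts of Jacobi matrices\<close>

definition jacobi :: "(nat \<Rightarrow> real) \<Rightarrow> nat \<Rightarrow> nat \<Rightarrow> real" where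
  "jacobi \<beta> i j = (if j = Suc i then \<beta> i else if i = Suc j then \<beta> j else 0)"

lemma jacobi_symmetric: "jacobi \<beta> i j = jacobi \<beta> j i"
  by (simp add: jacobi_def)

lemma restrict_schroedinger_op_jacobi:
  "restrict_op (schroedinger_op b) n = Matrix.mat (n + 1) (n + 1) (\<lambda>(i, j). jacobi (\<lambda>i. b (int i + 1)) i j)"
  unfolding restrict_schroedinger_op by (intro eq_matI) (auto simp: jacobi_def)

text \<open>
  The row of the infinite matrix. It agrees with the row of the finite one for vectors that vanish
  from index \<open>N\<close> on.
\<close>

definition jacobi_row :: "(nat \<Rightarrow> real) \<Rightarrow> (nat \<Rightarrow> real) \<Rightarrow> nat \<Rightarrow> real" where
  "jacobi_row \<beta> x i = (case i of 0 \<Rightarrow> 0 | Suc j \<Rightarrow> \<beta> j * x j) + \<beta> i * x (Suc i)"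

lemma apply_kernel_jacobi:
  assumes "i < N" "\<And>i. i \<ge> N \<Longrightarrow> x i = 0"
  shows "apply_kernel N (jacobi \<beta>) x i = jacobi_row \<beta> x i"
proof -
  have "apply_kernel N (jacobi \<beta>) x i =
      (\<Sum>j<N. (if j = Suc i then \<beta> i * x (Suc i) else 0) + (if i = Suc j then \<beta> j * x j else 0))"
    unfolding apply_kernel_def by (intro sum.cong refl) (auto simp: jacobi_def)
  also have "\<dots> = (\<Sum>j<N. (if j = Suc i then \<beta> i * x (Suc i) else 0)) + (\<Sum>j<N. (if i = Suc j then \<beta> j * x j else 0))"
    by (rule sum.distrib)
  also have "(\<Sum>j<N. (if j = Suc i then \<beta> i * x (Suc i) else 0)) = \<beta> i * x (Suc i)"
    using assms(2)[of "Suc i"] by (cases "Suc i < N") auto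
  also have "(\<Sum>j<N. (if i = Suc j then \<beta> j * x j else 0)) = (case i of 0 \<Rightarrow> 0 | Suc j \<Rightarrow> \<beta> j * x j)"
    using assms(1) by (cases i) auto
  finally show ?thesis by (simp add: jacobi_row_def)
qed

lemma jacobi_form:
  "dot N x (apply_kernel N (jacobi \<beta>) x) = 2 * (\<Sum>i<N - 1. \<beta> i * x i * x (Suc i))"
proof (induction N)
  case (Suc N)
  have eq: "dot M x (apply_kernel M (jacobi \<beta>) x) = (\<Sum>i<M. \<Sum>j<M. jacobi \<beta> i j * x i * x j)" for M
    by (simp add: dot_def apply_kernel_def sum_distrib_left mult_ac)
  have side: "(\<Sum>i<N. jacobi \<beta> i N * x i * x N) = (if N = 0 then 0 else \<beta> (N - 1) * x (N - 1) * x N)"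
  proof (cases N)
    case (Suc M)
    have "(\<Sum>i<N. jacobi \<beta> i N * x i * x N) = (\<Sum>i<N. if i = M then \<beta> M * x M * x N else 0)"
      by (intro sum.cong refl) (auto simp: jacobi_def Suc)
    then show ?thesis by (simp add: Suc)
  qed simp
  have side': "(\<Sum>j<N. jacobi \<beta> N j * x N * x j) = (\<Sum>i<N. jacobi \<beta> i N * x i * x N)"
    by (intro sum.cong refl) (simp add: jacobi_symmetric[of \<beta> N] mult_ac)
  have "dot (Suc N) x (apply_kernel (Suc N) (jacobi \<beta>) x) =
      dot N x (apply_kernel N (jacobi \<beta>) x) + 2 * (\<Sum>i<N. jacobi \<beta> i N * x i * x N)"
    unfolding eq by (simp add: sum.distrib side') (simp add: jacobi_def)
  also have "\<dots> = 2 * (\<Sum>i<N - 1. \<beta> i * x i * x (Suc i)) + 2 * (if N = 0 then 0 else \<beta> (N - 1) * x (N - 1) * x N)"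
    unfolding Suc.IH side ..
  also have "\<dots> = 2 * (\<Sum>i<Suc N - 1. \<beta> i * x i * x (Suc i))"
    by (cases N) auto
  finally show ?case .
qed (simp add: dot_def)

definition jacobi_eigenvalue :: "(nat \<Rightarrow> real) \<Rightarrow> nat \<Rightarrow> nat \<Rightarrow> real" where
  "jacobi_eigenvalue \<beta> N = (SOME e. \<exists>v. eigensystem N (jacobi \<beta>) e v)"

lemma jacobi_eigensystem: "\<exists>v. eigensystem N (jacobi \<beta>) (jacobi_eigenvalue \<beta> N) v"
  unfolding jacobi_eigenvalue_def
  using someI_ex[OF eigensystem_exists[of N "jacobi \<beta>"]] by (simp add: jacobi_symmetric)

text \<open>
  Eigenvalues are counted with multiplicity, through the indices of a chosen eigensystem; the
  characteristic polynomial shows that the number is independent of the choice.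
\<close>

definition eigenvalue_count :: "nat \<Rightarrow> (nat \<Rightarrow> real) \<Rightarrow> real set \<Rightarrow> nat" where
  "eigenvalue_count N \<beta> B = card {k. k < N \<and> jacobi_eigenvalue \<beta> N k \<in> B}"

lemma eigenvalue_count_le: "eigenvalue_count N \<beta> B \<le> N"
  unfolding eigenvalue_count_def using card_mono[of "{..<N}" "{k. k < N \<and> jacobi_eigenvalue \<beta> N k \<in> B}"] by auto

lemma eigenvalue_count_mono: "B \<subseteq> B' \<Longrightarrow> eigenvalue_count N \<beta> B \<le> eigenvalue_count N \<beta> B'"
  unfolding eigenvalue_count_def by (intro card_mono) auto

lemma eigenvalue_count_Un:
  assumes "B \<inter> B' = {}"
  shows "eigenvalue_count N \<beta> (B \<union> B') = eigenvalue_count N \<beta> B + eigenvalue_count N \<beta> B'"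
  unfolding eigenvalue_count_def
  by (subst card_Un_disjoint[symmetric]) (use assms in \<open>auto intro!: arg_cong[where f = card]\<close>)

lemma eigenvalue_count_complement: "eigenvalue_count N \<beta> {..c} + eigenvalue_count N \<beta> {c<..} = N"
proof -
  have "{..c} \<union> {c<..} = (UNIV :: real set)" by auto
  then have "eigenvalue_count N \<beta> ({..c} \<union> {c<..}) = N" by (simp add: eigenvalue_count_def)
  then show ?thesis by (subst eigenvalue_count_Un[symmetric]) auto
qed

lemma empirical_eigenvalue_distr_schroedinger_op:
  assumes "B \<in> sets borel"
  shows "emeasure (empirical_eigenvalue_distr (restrict_op (schroedinger_op b) n)) B =
    ennreal (real (eigenvalue_count (n + 1) (\<lambda>i. b (int i + 1)) B) / real (n + 1))"
  using empirical_eigenvalue_distr_eigensystem[OF _ assms, of "n + 1" "jacobi (\<lambda>i. b (int i + 1))"] jacobi_eigensystem[of "n + 1" "\<lambda>i. b (int i + 1)"]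
  unfolding restrict_schroedinger_op_jacobi eigenvalue_count_def by blast

lemma jacobi_form_cut:
  assumes "x (N - 1) = 0" "0 < N"
  shows "dot (N + M) x (apply_kernel (N + M) (jacobi \<beta>) x) =
    dot N x (apply_kernel N (jacobi \<beta>) x) +
    dot M (\<lambda>i. x (N + i)) (apply_kernel M (jacobi (\<lambda>i. \<beta> (N + i))) (\<lambda>i. x (N + i)))"
proof (cases M)
  case 0
  then show ?thesis by (simp add: dot_def)
next
  case (Suc M')
  have split: "(\<Sum>i<N + M'. f i) = (\<Sum>i<N - 1. f i) + f (N - 1) + (\<Sum>i<M'. f (N + i))" for f :: "nat \<Rightarrow> real"
  proof -
    have "(\<Sum>i<N + M'. f i) = (\<Sum>i<N. f i) + (\<Sum>i<M'. f (N + i))"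
      by (induction M') auto
    moreover have "(\<Sum>i<N. f i) = (\<Sum>i<N - 1. f i) + f (N - 1)"
      using assms(2) by (cases N) auto
    ultimately show ?thesis by simp
  qed
  show ?thesis unfolding jacobi_form Suc using assms by (simp add: split distrib_left)
qed

lemma dot_cut: "dot (N + M) x y = dot N x y + dot M (\<lambda>i. x (N + i)) (\<lambda>i. y (N + i))"
  unfolding dot_def by (induction M) auto

text \<open>
  If \<open>x\<close> vanishes at the last site of the first block, the forms of the two blocks add up. This single
  constraint, on top of orthogonality to eigenvectors of the blocks, is what the cut costs.
\<close>

lemma card_cut:
  fixes \<beta> :: "nat \<Rightarrow> real"
  assumes N: "0 < N"
    and S: "eigensystem (N + M) (jacobi \<beta>) e v"
    and impossible: "\<And>x. (\<And>k. k < N \<Longrightarrow> P (e1 k) \<Longrightarrow> dot N (v1 k) x = 0) \<Longrightarrow>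
      (\<And>k. k < M \<Longrightarrow> P (e2 k) \<Longrightarrow> dot M (v2 k) (\<lambda>i. x (N + i)) = 0) \<Longrightarrow>
      (\<And>k. k < N + M \<Longrightarrow> \<not> P (e k) \<Longrightarrow> dot (N + M) (v k) x = 0) \<Longrightarrow>
      x (N - 1) = 0 \<Longrightarrow> dot (N + M) x x > 0 \<Longrightarrow> False"
  shows "card {k. k < N + M \<and> P (e k)} \<le> card {k. k < N \<and> P (e1 k)} + card {k. k < M \<and> P (e2 k)} + 1"
proof -
  interpret eigensystem "N + M" "jacobi \<beta>" e v by fact
  let ?I1 = "{k. k < N \<and> P (e1 k)}" and ?I2 = "{k. k < M \<and> P (e2 k)}"
  \<comment> \<open>the constraints of both blocks, extended by zero, and the vanishing at the cut\<close>
  define \<delta> :: "nat \<Rightarrow> real" where "\<delta> i = (if i = N - 1 then 1 else 0)" for i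
  define \<phi>1 where "\<phi>1 k i = (if i < N then v1 k i else 0)" for k i
  define \<phi>2 where "\<phi>2 k i = (if i < N then 0 else v2 k (i - N))" for k i
  define J where "J = insert \<delta> (\<phi>1 ` ?I1 \<union> \<phi>2 ` ?I2)"
  have finJ: "finite J" by (simp add: J_def)
  have d: "dot (N + M) \<delta> x = x (N - 1)" for x
  proof -
    have "dot (N + M) \<delta> x = (\<Sum>i<N + M. if i = N - 1 then x (N - 1) else 0)"
      unfolding dot_def by (intro sum.cong) (auto simp: \<delta>_def)
    then show ?thesis using N by simp
  qed
  have p1: "dot (N + M) (\<phi>1 k) x = dot N (v1 k) x" for k x
    unfolding dot_cut by (simp add: \<phi>1_def dot_def)
  have p2: "dot (N + M) (\<phi>2 k) x = dot M (v2 k) (\<lambda>i. x (N + i))" for k x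
    unfolding dot_cut by (simp add: \<phi>2_def dot_def)
  have "card {k. k < N + M \<and> P (e k)} \<le> card J"
  proof (rule card_less_eq_constraints[OF finJ, of "\<lambda>\<phi>. \<phi>"])
    fix x assume "\<forall>i\<ge>N + M. x i = 0" and J: "\<forall>j\<in>J. dot (N + M) j x = 0"
      and orth: "\<forall>k<N + M. \<not> P (e k) \<longrightarrow> dot (N + M) (v k) x = 0" and pos: "0 < dot (N + M) x x"
    show False
    proof (rule impossible[OF _ _ _ _ pos])
      show "x (N - 1) = 0" using J d[of x] by (simp add: J_def)
      show "dot N (v1 k) x = 0" if "k < N" "P (e1 k)" for k
        using J p1[of k x] that by (auto simp: J_def)
      show "dot M (v2 k) (\<lambda>i. x (N + i)) = 0" if "k < M" "P (e2 k)" for k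
        using J p2[of k x] that by (auto simp: J_def)
    qed (use orth in auto)
  qed
  also have "card J \<le> Suc (card (\<phi>1 ` ?I1 \<union> \<phi>2 ` ?I2))"
    unfolding J_def by (rule card_insert_le_m1) auto
  also have "card (\<phi>1 ` ?I1 \<union> \<phi>2 ` ?I2) \<le> card (\<phi>1 ` ?I1) + card (\<phi>2 ` ?I2)"
    by (rule card_Un_le)
  also have "\<dots> \<le> card ?I1 + card ?I2" by (intro add_mono card_image_le) auto
  finally show ?thesis by simp
qed

text \<open>
  Both the eigenvalues at most \<open>c\<close> and those above \<open>c\<close> are bounded from above by counting constraints; as the
  two numbers add up to the dimension, each upper bound is a lower bound for the other count.
\<close>

lemma eigenvalue_count_cut:
  assumes N: "0 < N"
  shows "\<bar>real (eigenvalue_count (N + M) \<beta> {..c}) -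
    (real (eigenvalue_count N \<beta> {..c}) + real (eigenvalue_count M (\<lambda>i. \<beta> (N + i)) {..c}))\<bar> \<le> 1"
proof -
  let ?\<beta> = "\<lambda>i. \<beta> (N + i)"
  obtain v where S: "eigensystem (N + M) (jacobi \<beta>) (jacobi_eigenvalue \<beta> (N + M)) v"
    using jacobi_eigensystem by blast
  obtain v1 where S1: "eigensystem N (jacobi \<beta>) (jacobi_eigenvalue \<beta> N) v1"
    using jacobi_eigensystem by blast
  obtain v2 where S2: "eigensystem M (jacobi ?\<beta>) (jacobi_eigenvalue ?\<beta> M) v2"
    using jacobi_eigensystem by blast
  have "eigenvalue_count (N + M) \<beta> {..c} \<le> eigenvalue_count N \<beta> {..c} + eigenvalue_count M ?\<beta> {..c} + 1"
    unfolding eigenvalue_count_def atMost_iff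
  proof (rule card_cut[OF N S])
    fix x
    assume *: "\<And>k. k < N \<Longrightarrow> jacobi_eigenvalue \<beta> N k \<le> c \<Longrightarrow> dot N (v1 k) x = 0"
      "\<And>k. k < M \<Longrightarrow> jacobi_eigenvalue ?\<beta> M k \<le> c \<Longrightarrow> dot M (v2 k) (\<lambda>i. x (N + i)) = 0"
      "\<And>k. k < N + M \<Longrightarrow> \<not> jacobi_eigenvalue \<beta> (N + M) k \<le> c \<Longrightarrow> dot (N + M) (v k) x = 0"
      "x (N - 1) = 0" "dot (N + M) x x > 0"
    note ge = eigensystem.form_gt_if_orthogonal(1)[OF S1 *(1)] eigensystem.form_gt_if_orthogonal(1)[OF S2 *(2)]
    note gt = eigensystem.form_gt_if_orthogonal(2)[OF S1 *(1)] eigensystem.form_gt_if_orthogonal(2)[OF S2 *(2)]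
    have "dot (N + M) x (apply_kernel (N + M) (jacobi \<beta>) x) \<le> c * dot (N + M) x x"
      by (rule eigensystem.form_le_if_orthogonal[OF S]) (use *(3) in \<open>auto simp: not_le\<close>)
    moreover have "dot N x x \<noteq> 0 \<or> dot M (\<lambda>i. x (N + i)) (\<lambda>i. x (N + i)) \<noteq> 0"
      using *(5) unfolding dot_cut by auto
    ultimately show False
      unfolding jacobi_form_cut[of x N, OF *(4) N] unfolding dot_cut distrib_left
      using ge gt by (elim disjE) force+
  qed
  moreover have "eigenvalue_count (N + M) \<beta> {c<..} \<le> eigenvalue_count N \<beta> {c<..} + eigenvalue_count M ?\<beta> {c<..} + 1"
    unfolding eigenvalue_count_def greaterThan_iff
  proof (rule card_cut[OF N S])
    fix x
    assume *: "\<And>k. k < N \<Longrightarrow> c < jacobi_eigenvalue \<beta> N k \<Longrightarrow> dot N (v1 k) x = 0"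
      "\<And>k. k < M \<Longrightarrow> c < jacobi_eigenvalue ?\<beta> M k \<Longrightarrow> dot M (v2 k) (\<lambda>i. x (N + i)) = 0"
      "\<And>k. k < N + M \<Longrightarrow> \<not> c < jacobi_eigenvalue \<beta> (N + M) k \<Longrightarrow> dot (N + M) (v k) x = 0"
      "x (N - 1) = 0" "dot (N + M) x x > 0"
    note le = eigensystem.form_le_if_orthogonal[OF S1 *(1)] eigensystem.form_le_if_orthogonal[OF S2 *(2)]
    have "dot (N + M) x (apply_kernel (N + M) (jacobi \<beta>) x) > c * dot (N + M) x x"
      by (rule eigensystem.form_gt_if_orthogonal(2)[OF S]) (use *(3,5) in \<open>auto simp: not_le\<close>)
    then show False
      unfolding jacobi_form_cut[of x N, OF *(4) N] unfolding dot_cut distrib_left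
      using le by force
  qed
  ultimately show ?thesis
    using eigenvalue_count_complement[of "N + M" \<beta> c] eigenvalue_count_complement[of N \<beta> c] eigenvalue_count_complement[of M ?\<beta> c]
    by linarith
qed

lemma prod_adjacent_le_inner:
  assumes "Suc i < N"
  shows "\<bar>x i * x (Suc i)\<bar> \<le> dot N x x"
proof -
  have "0 \<le> (\<bar>x i\<bar> - \<bar>x (Suc i)\<bar>)\<^sup>2" by simp
  then have "\<bar>x i * x (Suc i)\<bar> \<le> ((x i)\<^sup>2 + (x (Suc i))\<^sup>2) / 2"
    by (simp add: power2_diff abs_mult)
  also have "\<dots> \<le> x i * x i + x (Suc i) * x (Suc i)" by (simp add: power2_eq_square)
  also have "\<dots> = (\<Sum>j\<in>{i, Suc i}. x j * x j)" by simp
  also have "\<dots> \<le> dot N x x" unfolding dot_def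
    by (rule sum_mono2) (use assms in auto)
  finally show ?thesis .
qed

text \<open>
  Eigenvalue counts above a level are lower semicontinuous in the weights. Together with the next
  lemma this makes the counts measurable, including at weights that vanish somewhere.
\<close>

lemma eigenvalue_count_perturb:
  assumes gap: "\<And>k. k < N \<Longrightarrow> c < jacobi_eigenvalue \<beta> N k \<Longrightarrow> c' < jacobi_eigenvalue \<beta> N k"
    and close: "2 * (\<Sum>i<N. \<bar>\<beta>' i - \<beta> i\<bar>) < c' - c"
  shows "eigenvalue_count N \<beta> {c<..} \<le> eigenvalue_count N \<beta>' {c<..}"
proof -
  obtain v where S: "eigensystem N (jacobi \<beta>) (jacobi_eigenvalue \<beta> N) v"
    using jacobi_eigensystem by blast
  obtain v' where S': "eigensystem N (jacobi \<beta>') (jacobi_eigenvalue \<beta>' N) v'"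
    using jacobi_eigensystem by blast
  show ?thesis unfolding eigenvalue_count_def greaterThan_iff
  proof (rule eigensystem.card_less_eq_constraints[OF S, of _ v'])
    fix x assume J: "\<forall>j\<in>{k. k < N \<and> c < jacobi_eigenvalue \<beta>' N k}. dot N (v' j) x = 0"
      and orth: "\<forall>k<N. \<not> c < jacobi_eigenvalue \<beta> N k \<longrightarrow> dot N (v k) x = 0"
      and pos: "0 < dot N x x"
    have "dot N x (apply_kernel N (jacobi \<beta>') x) \<le> c * dot N x x"
      by (rule eigensystem.form_le_if_orthogonal[OF S']) (use J in auto)
    moreover have "dot N x (apply_kernel N (jacobi \<beta>) x) \<ge> c' * dot N x x"
      by (rule eigensystem.form_gt_if_orthogonal(1)[OF S]) (use orth gap in \<open>force simp: not_less[symmetric]\<close>)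
    moreover have "dot N x (apply_kernel N (jacobi \<beta>) x) - dot N x (apply_kernel N (jacobi \<beta>') x)
        = 2 * (\<Sum>i<N - 1. (\<beta> i - \<beta>' i) * (x i * x (Suc i)))"
      unfolding jacobi_form by (simp add: sum_subtractf left_diff_distrib mult.assoc)
    moreover have "(\<Sum>i<N - 1. (\<beta> i - \<beta>' i) * (x i * x (Suc i))) \<le> (\<Sum>i<N - 1. \<bar>\<beta>' i - \<beta> i\<bar> * dot N x x)"
    proof (rule sum_mono)
      fix i assume "i \<in> {..<N - 1}"
      then have "Suc i < N" by auto
      from prod_adjacent_le_inner[OF this, of x]
      have "\<bar>\<beta> i - \<beta>' i\<bar> * \<bar>x i * x (Suc i)\<bar> \<le> \<bar>\<beta>' i - \<beta> i\<bar> * dot N x x"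
        by (intro mult_mono) auto
      then show "(\<beta> i - \<beta>' i) * (x i * x (Suc i)) \<le> \<bar>\<beta>' i - \<beta> i\<bar> * dot N x x"
        by (metis abs_ge_self abs_mult order_trans)
    qed
    moreover have "(\<Sum>i<N - 1. \<bar>\<beta>' i - \<beta> i\<bar> * dot N x x) \<le> (\<Sum>i<N. \<bar>\<beta>' i - \<beta> i\<bar>) * dot N x x"
      unfolding sum_distrib_right[symmetric] using pos by (intro mult_right_mono sum_mono2) auto
    moreover have "2 * (\<Sum>i<N. \<bar>\<beta>' i - \<beta> i\<bar>) * dot N x x < (c' - c) * dot N x x"
      using close pos by (rule mult_strict_right_mono)
    ultimately show False by (simp add: left_diff_distrib)
  qed auto
qed

lemma open_eigenvalue_count_ge:
  "open {b :: int \<Rightarrow> real. r \<le> eigenvalue_count N (\<lambda>i. b (int i + 1)) {c<..}}"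
proof (subst open_subopen, rule ballI)
  fix b :: "int \<Rightarrow> real" assume "b \<in> {b. r \<le> eigenvalue_count N (\<lambda>i. b (int i + 1)) {c<..}}"
  then have r: "r \<le> eigenvalue_count N (\<lambda>i. b (int i + 1)) {c<..}" by simp
  let ?e = "jacobi_eigenvalue (\<lambda>i. b (int i + 1)) N"
  let ?E = "?e ` {k. k < N \<and> c < ?e k}"
  obtain c' where c': "c < c'" "\<And>k. k < N \<Longrightarrow> c < ?e k \<Longrightarrow> c' < ?e k"
  proof (cases "?E = {}")
    case True
    then show ?thesis by (intro that[of "c + 1"]) auto
  next
    case False
    have "c < Min ?E" using False by (subst Min_gr_iff) auto
    then obtain c' where "c < c'" "c' < Min ?E" using dense by blast
    then show ?thesis using False by (intro that[of c']) (auto simp: Min_gr_iff)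
  qed
  let ?T = "{b' :: int \<Rightarrow> real. 2 * (\<Sum>i<N. \<bar>b' (int i + 1) - b (int i + 1)\<bar>) < c' - c}"
  have "open ?T"
    by (intro open_Collect_less continuous_intros continuous_on_product_coordinates)
  moreover have "b \<in> ?T" using c' by simp
  moreover have "?T \<subseteq> {b. r \<le> eigenvalue_count N (\<lambda>i. b (int i + 1)) {c<..}}"
    using eigenvalue_count_perturb[OF c'(2)] r by (auto intro: order_trans)
  ultimately show "\<exists>T. open T \<and> b \<in> T \<and> T \<subseteq> {b. r \<le> eigenvalue_count N (\<lambda>i. b (int i + 1)) {c<..}}"
    by blast
qed

section \<open>Small eigenvalues and alternations\<close>

text \<open>
  The hypothesis says that \<open>exp (v i)\<close> is the modulus of a zero-energy solution, in both sublattices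
  and with the relative normalisation that makes \<open>exp (m - v i)\<close> the size of one term of row \<open>i\<close>.
\<close>

locale zero_energy_weights =
  fixes \<beta> v :: "nat \<Rightarrow> real" and m :: real
  assumes weight_mult: "\<And>i. \<bar>\<beta> i\<bar> * (exp (v i) * exp (v (Suc i))) = exp m"
begin

text \<open>
  Variation of constants: the rows express \<open>x\<close> at every second site through its image, starting from
  a zero at \<open>s - 1\<close> or from the left end of the matrix.
\<close>

lemma solve_left:
  assumes s: "s = 0 \<or> x (s - 1) = 0"
  shows "exp m * \<bar>x (s + 2 * d + 1)\<bar> \<le>
    exp (v (s + 2 * d + 1)) * (\<Sum>d'\<le>d. exp (v (s + 2 * d')) * \<bar>jacobi_row \<beta> x (s + 2 * d')\<bar>)"
proof (induction d)
  case 0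
  have "jacobi_row \<beta> x s = \<beta> s * x (Suc s)"
    using s by (cases s) (auto simp: jacobi_row_def)
  then show ?case using weight_mult[of s] by (simp add: abs_mult mult_ac flip: weight_mult[of s])
next
  case (Suc d)
  let ?i = "s + 2 * d + 2"
  have row: "jacobi_row \<beta> x ?i = \<beta> (s + 2 * d + 1) * x (s + 2 * d + 1) + \<beta> ?i * x (Suc ?i)"
    by (simp add: jacobi_row_def)
  have w: "\<bar>\<beta> (s + 2 * d + 1)\<bar> * (exp (v (s + 2 * d + 1)) * exp (v ?i)) = exp m"
    using weight_mult[of "s + 2 * d + 1"] by simp
  have "exp m * \<bar>x (Suc ?i)\<bar> = exp (v ?i) * exp (v (Suc ?i)) * \<bar>\<beta> ?i * x (Suc ?i)\<bar>"
    unfolding weight_mult[of ?i, symmetric] by (simp add: abs_mult mult_ac)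
  also have "\<bar>\<beta> ?i * x (Suc ?i)\<bar> \<le> \<bar>jacobi_row \<beta> x ?i\<bar> + \<bar>\<beta> (s + 2 * d + 1)\<bar> * \<bar>x (s + 2 * d + 1)\<bar>"
    unfolding row abs_mult[symmetric] by simp
  also have "exp (v ?i) * exp (v (Suc ?i)) * (\<bar>jacobi_row \<beta> x ?i\<bar> + \<bar>\<beta> (s + 2 * d + 1)\<bar> * \<bar>x (s + 2 * d + 1)\<bar>) =
      exp (v (Suc ?i)) * (exp (v ?i) * \<bar>jacobi_row \<beta> x ?i\<bar>
       + (\<bar>\<beta> (s + 2 * d + 1)\<bar> * (exp (v (s + 2 * d + 1)) * exp (v ?i))) * \<bar>x (s + 2 * d + 1)\<bar> / exp (v (s + 2 * d + 1)))"
    by (simp add: field_simps)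
  also have "\<dots> = exp (v (Suc ?i)) * (exp (v ?i) * \<bar>jacobi_row \<beta> x ?i\<bar>
       + exp m * \<bar>x (s + 2 * d + 1)\<bar> / exp (v (s + 2 * d + 1)))"
    unfolding w ..
  also have "\<dots> \<le> exp (v (Suc ?i)) * (exp (v ?i) * \<bar>jacobi_row \<beta> x ?i\<bar>
       + (\<Sum>d'\<le>d. exp (v (s + 2 * d')) * \<bar>jacobi_row \<beta> x (s + 2 * d')\<bar>))"
    using Suc.IH by (intro mult_left_mono add_left_mono) (auto simp: divide_le_eq mult.commute)
  finally show ?case by (simp add: add.commute mult_left_mono)
qed

text \<open>
  The same recursion run from a zero to the right.
\<close>

lemma solve_right:
  assumes "x (j + 2 * d) = 0"
  shows "exp m * \<bar>x j\<bar> \<le>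
    exp (v j) * (\<Sum>d'<d. exp (v (j + 2 * d' + 1)) * \<bar>jacobi_row \<beta> x (j + 2 * d' + 1)\<bar>)"
  using assms
proof (induction d arbitrary: j)
  case (Suc d)
  have IH: "exp m * \<bar>x (j + 2)\<bar> \<le>
    exp (v (j + 2)) * (\<Sum>d'<d. exp (v (j + 2 * Suc d' + 1)) * \<bar>jacobi_row \<beta> x (j + 2 * Suc d' + 1)\<bar>)"
    using Suc.IH[of "j + 2"] Suc.prems by simp
  have row: "jacobi_row \<beta> x (Suc j) = \<beta> j * x j + \<beta> (Suc j) * x (j + 2)"
    by (simp add: jacobi_row_def)
  have w: "\<bar>\<beta> (Suc j)\<bar> * (exp (v (Suc j)) * exp (v (j + 2))) = exp m"
    using weight_mult[of "Suc j"] by simp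
  have "exp m * \<bar>x j\<bar> = exp (v j) * exp (v (Suc j)) * \<bar>\<beta> j * x j\<bar>"
    unfolding weight_mult[of j, symmetric] by (simp add: abs_mult mult_ac)
  also have "\<bar>\<beta> j * x j\<bar> \<le> \<bar>jacobi_row \<beta> x (Suc j)\<bar> + \<bar>\<beta> (Suc j)\<bar> * \<bar>x (j + 2)\<bar>"
    unfolding row abs_mult[symmetric] by simp
  also have "exp (v j) * exp (v (Suc j)) * (\<bar>jacobi_row \<beta> x (Suc j)\<bar> + \<bar>\<beta> (Suc j)\<bar> * \<bar>x (j + 2)\<bar>) =
      exp (v j) * (exp (v (Suc j)) * \<bar>jacobi_row \<beta> x (Suc j)\<bar>
       + (\<bar>\<beta> (Suc j)\<bar> * (exp (v (Suc j)) * exp (v (j + 2)))) * \<bar>x (j + 2)\<bar> / exp (v (j + 2)))"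
    by (simp add: field_simps)
  also have "\<dots> = exp (v j) * (exp (v (Suc j)) * \<bar>jacobi_row \<beta> x (Suc j)\<bar> + exp m * \<bar>x (j + 2)\<bar> / exp (v (j + 2)))"
    unfolding w ..
  also have "\<dots> \<le> exp (v j) * (exp (v (Suc j)) * \<bar>jacobi_row \<beta> x (Suc j)\<bar>
       + (\<Sum>d'<d. exp (v (j + 2 * Suc d' + 1)) * \<bar>jacobi_row \<beta> x (j + 2 * Suc d' + 1)\<bar>))"
    using IH by (intro mult_left_mono add_left_mono) (auto simp: divide_le_eq mult.commute)
  finally show ?case unfolding sum.lessThan_Suc_shift by simp
qed simp

lemma pointwise_bound_left:
  assumes s: "s = 0 \<or> x (s - 1) = 0" and j: "s < j" "odd (j - s)" "j < N"
    and L: "\<And>i. s \<le> i \<Longrightarrow> i < j \<Longrightarrow> even (i - s) \<Longrightarrow> v i + v j \<le> L"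
  shows "exp m * \<bar>x j\<bar> \<le> exp L * (\<Sum>i<N. \<bar>jacobi_row \<beta> x i\<bar>)"
proof -
  obtain d where d: "j - s = 2 * d + 1" using j(2) oddE by blast
  then have jd: "j = s + 2 * d + 1" using j by simp
  have "exp m * \<bar>x j\<bar> \<le> (\<Sum>d'\<le>d. exp (v j) * exp (v (s + 2 * d')) * \<bar>jacobi_row \<beta> x (s + 2 * d')\<bar>)"
    using solve_left[of s x d, OF s] by (simp add: jd sum_distrib_left mult.assoc)
  also have "\<dots> \<le> (\<Sum>d'\<le>d. exp L * \<bar>jacobi_row \<beta> x (s + 2 * d')\<bar>)"
  proof (intro sum_mono mult_right_mono)
    fix d' assume "d' \<in> {..d}"
    then have "v (s + 2 * d') + v j \<le> L" by (intro L) (auto simp: jd)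
    then show "exp (v j) * exp (v (s + 2 * d')) \<le> exp L" by (simp add: exp_add[symmetric] add.commute)
  qed simp
  also have "\<dots> = exp L * (\<Sum>i\<in>(\<lambda>d'. s + 2 * d') ` {..d}. \<bar>jacobi_row \<beta> x i\<bar>)"
    by (subst sum.reindex) (auto simp: inj_on_def sum_distrib_left)
  also have "\<dots> \<le> exp L * (\<Sum>i<N. \<bar>jacobi_row \<beta> x i\<bar>)"
    by (intro mult_left_mono sum_mono2) (use j jd in auto)
  finally show ?thesis .
qed

lemma pointwise_bound_right:
  assumes c: "x c = 0" and j: "j \<le> c" "even (c - j)" "c \<le> N"
    and L: "\<And>i. j < i \<Longrightarrow> i < c \<Longrightarrow> odd (i - j) \<Longrightarrow> v j + v i \<le> L"
  shows "exp m * \<bar>x j\<bar> \<le> exp L * (\<Sum>i<N. \<bar>jacobi_row \<beta> x i\<bar>)"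
proof -
  obtain d where d: "c - j = 2 * d" using j(2) evenE by blast
  then have cd: "c = j + 2 * d" using j by simp
  have "exp m * \<bar>x j\<bar> \<le> (\<Sum>d'<d. exp (v j) * exp (v (j + 2 * d' + 1)) * \<bar>jacobi_row \<beta> x (j + 2 * d' + 1)\<bar>)"
    using solve_right[of x j d] c cd by (simp add: sum_distrib_left mult.assoc)
  also have "\<dots> \<le> (\<Sum>d'<d. exp L * \<bar>jacobi_row \<beta> x (j + 2 * d' + 1)\<bar>)"
  proof (intro sum_mono mult_right_mono)
    fix d' assume "d' \<in> {..<d}"
    then have "v j + v (j + 2 * d' + 1) \<le> L" by (intro L) (auto simp: cd)
    then show "exp (v j) * exp (v (j + 2 * d' + 1)) \<le> exp L" by (simp add: exp_add[symmetric])
  qed simp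
  also have "\<dots> = exp L * (\<Sum>i\<in>(\<lambda>d'. j + 2 * d' + 1) ` {..<d}. \<bar>jacobi_row \<beta> x i\<bar>)"
    by (subst sum.reindex) (auto simp: inj_on_def sum_distrib_left)
  also have "\<dots> \<le> exp L * (\<Sum>i<N. \<bar>jacobi_row \<beta> x i\<bar>)"
    by (intro mult_left_mono sum_mono2) (use j cd in auto)
  finally show ?thesis .
qed

end

lemma sum_abs_squared_le: "(\<Sum>i<N. \<bar>y i\<bar>)\<^sup>2 \<le> real N * dot N y y"
proof -
  have "(\<Sum>i<N. \<bar>y i\<bar>)\<^sup>2 = (\<Sum>i<N. 1 * \<bar>y i\<bar>)\<^sup>2" by simp
  also have "\<dots> \<le> (\<Sum>i<N. 1\<^sup>2) * (\<Sum>i<N. \<bar>y i\<bar>\<^sup>2)" by (rule Cauchy_Schwarz_ineq_sum)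
  finally show ?thesis by (simp add: dot_def power2_eq_square)
qed

lemma kernel_lower_bound:
  assumes "zero_energy_weights \<beta> v m" and x: "\<And>i. i \<ge> N \<Longrightarrow> x i = 0"
    and bound: "\<And>j. j < N \<Longrightarrow> exp m * \<bar>x j\<bar> \<le> exp L * (\<Sum>i<N. \<bar>jacobi_row \<beta> x i\<bar>)"
  shows "dot N x x \<le> (real N * exp (L - m))\<^sup>2 * dot N (apply_kernel N (jacobi \<beta>) x) (apply_kernel N (jacobi \<beta>) x)"
proof -
  let ?y = "apply_kernel N (jacobi \<beta>) x"
  have y: "(\<Sum>i<N. \<bar>jacobi_row \<beta> x i\<bar>) = (\<Sum>i<N. \<bar>?y i\<bar>)"
    using x by (intro sum.cong refl) (simp add: apply_kernel_jacobi)
  have "(x j)\<^sup>2 \<le> (exp (L - m))\<^sup>2 * (real N * dot N ?y ?y)" if "j < N" for j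
  proof -
    have "\<bar>x j\<bar> \<le> exp (L - m) * (\<Sum>i<N. \<bar>?y i\<bar>)"
      using bound[OF that] unfolding y by (simp add: exp_diff field_simps)
    then have "(x j)\<^sup>2 \<le> (exp (L - m) * (\<Sum>i<N. \<bar>?y i\<bar>))\<^sup>2"
      by (subst power2_abs[symmetric]) (intro power_mono, auto)
    also have "\<dots> = (exp (L - m))\<^sup>2 * (\<Sum>i<N. \<bar>?y i\<bar>)\<^sup>2" by (rule power_mult_distrib)
    also have "\<dots> \<le> (exp (L - m))\<^sup>2 * (real N * dot N ?y ?y)"
      by (intro mult_left_mono sum_abs_squared_le) auto
    finally show ?thesis .
  qed
  then have "(\<Sum>j<N. (x j)\<^sup>2) \<le> (\<Sum>j<N. (exp (L - m))\<^sup>2 * (real N * dot N ?y ?y))"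
    by (intro sum_mono) auto
  then show ?thesis by (simp add: dot_def[of N x x] power2_eq_square mult_ac)
qed

lemma strict_chain_less:
  fixes \<tau> :: "nat \<Rightarrow> nat"
  assumes "\<And>k. k \<le> C \<Longrightarrow> \<tau> k < \<tau> (Suc k)" "k < l" "l \<le> Suc C"
  shows "\<tau> k < \<tau> l"
  using assms(2,3)
proof (induction l)
  case (Suc l)
  then show ?case using assms(1)[of l] by (cases "k = l") (auto intro: less_trans)
qed simp

lemma chain_cover:
  fixes \<tau> :: "nat \<Rightarrow> nat"
  assumes "\<tau> 0 \<le> j" "j < \<tau> n"
  shows "\<exists>k<n. \<tau> k \<le> j \<and> j < \<tau> (Suc k)"
  using assms
proof (induction n)
  case (Suc n)
  then show ?case by (cases "j < \<tau> n") (auto simp: less_Suc_eq)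
qed simp

text \<open>
  Let \<open>x\<close> vanish just before each completion time and at the last site. In a block between two
  completions, a site with the parity of end points is reached from the zero on its left, any other
  site from the zero on its right; either way only displacements below \<open>L\<close> occur. Hence no such \<open>x\<close>
  is contracted by more than \<open>exp (m - L) / N\<close>.
\<close>

lemma count_small_eigenvalues_le:
  assumes v: "\<And>t. v (Suc t) = - v t - \<xi> t" and W: "zero_energy_weights \<beta> v m" and L: "L > 0" and N: "0 < N"
  shows "eigenvalue_count N \<beta> {- (exp (m - L) / real N) <..< exp (m - L) / real N} \<le> fst (alternation L \<xi> (N - 1)) + 1"
proof -
  let ?l = "exp (m - L) / real N"
  define C where "C = fst (alternation L \<xi> (N - 1))"
  obtain \<tau> q where t0: "\<tau> 0 = 0" and tN: "\<tau> (Suc C) = Suc (N - 1)"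
    and par: "\<And>k. k \<le> C \<Longrightarrow> even (\<tau> k + k)" and less: "\<And>k. k \<le> C \<Longrightarrow> \<tau> k < \<tau> (Suc k)"
    and "\<And>k. k < C \<Longrightarrow> \<tau> k \<le> q k \<and> q k < \<tau> (Suc k) \<and> even (q k + k) \<and> L \<le> v (q k) + v (\<tau> (Suc k))"
    and nd: "\<And>k i j. k \<le> C \<Longrightarrow> \<tau> k \<le> i \<Longrightarrow> i < j \<Longrightarrow> j < \<tau> (Suc k) \<Longrightarrow> even (i + k) \<Longrightarrow> odd (j + k) \<Longrightarrow> v i + v j < L"
    by (rule alternation_partition[of v \<xi> L "N - 1" C, OF v L C_def[symmetric]]) (rule that)
  have tN: "\<tau> (Suc C) = N" using tN N by simp
  obtain u where S: "eigensystem N (jacobi \<beta>) (jacobi_eigenvalue \<beta> N) u"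
    using jacobi_eigensystem by blast
  \<comment> \<open>one zero for each completion, and one to close the last block\<close>
  let ?J = "insert (N - 1) ((\<lambda>k. \<tau> (Suc k) - 1) ` {..<C})"
  have "card {k. k < N \<and> \<bar>jacobi_eigenvalue \<beta> N k\<bar> < ?l} \<le> card ?J"
  proof (rule eigensystem.card_less_eq_constraints[OF S, of _ "\<lambda>j i. if i = j then 1 else 0"])
    fix x assume x: "\<forall>i\<ge>N. x i = 0" and J: "\<forall>j\<in>?J. dot N (\<lambda>i. if i = j then 1 else 0) x = 0"
      and orth: "\<forall>k<N. \<not> \<bar>jacobi_eigenvalue \<beta> N k\<bar> < ?l \<longrightarrow> dot N (u k) x = 0"
      and pos: "0 < dot N x x"
    let ?y = "apply_kernel N (jacobi \<beta>) x"
    have z: "x j = 0" if "j \<in> ?J" "j < N" for j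
    proof -
      have "dot N (\<lambda>i. if i = j then 1 else 0) x = x j"
        using that unfolding dot_def by (simp add: if_distrib[of "\<lambda>a. a * _"] cong: if_cong)
      then show ?thesis using J that by auto
    qed
    have tau_le: "\<tau> k \<le> N" if "k \<le> Suc C" for k
      using strict_chain_less[of C \<tau> k "Suc C", OF less] that tN by (cases "k = Suc C") auto
    have anchor: "\<tau> k = 0 \<or> x (\<tau> k - 1) = 0" if "k \<le> C" for k
    proof (cases k)
      case (Suc k')
      have "\<tau> k < N" using less[OF that] tau_le[of "Suc k"] that by simp
      then show ?thesis using Suc that by (intro disjI2 z) auto
    qed (simp add: t0)
    have bound: "exp m * \<bar>x j\<bar> \<le> exp L * (\<Sum>i<N. \<bar>jacobi_row \<beta> x i\<bar>)" if j: "j < N" for j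
    proof -
      obtain k where k: "k < Suc C" "\<tau> k \<le> j" "j < \<tau> (Suc k)"
        using chain_cover[of \<tau> j "Suc C"] t0 tN j by auto
      then have kC: "k \<le> C" by simp
      note p = par[OF kC]
      show ?thesis
      proof (cases "odd (j + k)")
        case True
        then have "odd (j - \<tau> k)" "\<tau> k < j" using p k(2) by (auto simp: le_less)
        then show ?thesis
        proof (intro zero_energy_weights.pointwise_bound_left[OF W, where s = "\<tau> k"] anchor[OF kC] j)
          fix i assume i: "\<tau> k \<le> i" "i < j" "even (i - \<tau> k)"
          then have "even (i + k)" using p by auto
          then show "v i + v j \<le> L" using nd[OF kC i(1,2) k(3) _ True] by simp
        qed
      next
        case False
        \<comment> \<open>in the last block the zero must have the parity of \<open>j\<close>: it is either the last site or the first one outside\<close>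
        define c where "c = (if k < C then \<tau> (Suc k) - 1 else if even (N - 1 + k) then N - 1 else N)"
        have c0: "x c = 0"
        proof (cases "k < C")
          case True
          have "\<tau> (Suc k) \<le> N" using True by (intro tau_le) auto
          then show ?thesis using True less[OF kC] by (auto simp: c_def intro!: z)
        next
          case False
          have "x (N - 1) = 0" by (intro z) (use N in auto)
          then show ?thesis using False x by (auto simp: c_def)
        qed
        have kt: "k = C \<Longrightarrow> \<tau> (Suc k) = N" using tN by simp
        have c: "j \<le> c" "c \<le> N" "c \<le> \<tau> (Suc k)"
          using k kt[OF antisym[OF kC]] j tau_le[of "Suc k"] by (auto simp: c_def)
        have "even (c + k)"
        proof (cases "k < C")
          case True
          then have "even (\<tau> (Suc k) + Suc k)" by (intro par) auto
          then show ?thesis using True less[OF kC] by (auto simp: c_def)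
        next
          case False
          then show ?thesis using N by (auto simp: c_def)
        qed
        then have ev: "even (c - j)" using False c by auto
        show ?thesis
        proof (intro zero_energy_weights.pointwise_bound_right[OF W, where c = c] c0 c(1,2) ev)
          fix i assume i: "j < i" "i < c" "odd (i - j)"
          then have "odd (i + k)" using False by auto
          then show "v j + v i \<le> L" using nd[OF kC k(2) i(1)] i(2) c(3) False by fastforce
        qed
      qed
    qed
    have "dot N x x \<le> (real N * exp (L - m))\<^sup>2 * dot N ?y ?y"
      by (rule kernel_lower_bound[OF W _ bound]) (use x in auto)
    moreover have "dot N ?y ?y < ?l\<^sup>2 * dot N x x"
      by (rule eigensystem.ball_form_lt_if_orthogonal[OF S]) (use orth pos in auto)
    then have "(real N * exp (L - m))\<^sup>2 * dot N ?y ?y < (real N * exp (L - m))\<^sup>2 * (?l\<^sup>2 * dot N x x)"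
      using N by (intro mult_strict_left_mono) auto
    moreover have "(real N * exp (L - m))\<^sup>2 * (?l\<^sup>2 * dot N x x) = dot N x x"
      using N by (simp add: power_mult_distrib[symmetric] mult.assoc[symmetric] exp_diff)
    ultimately show False by linarith
  qed auto
  also have "card ?J \<le> Suc (card ((\<lambda>k. \<tau> (Suc k) - 1) ` {..<C}))" by (rule card_insert_le_m1) auto
  also have "card ((\<lambda>k. \<tau> (Suc k) - 1) ` {..<C}) \<le> C" using card_image_le[of "{..<C}"] by fastforce
  finally show ?thesis unfolding eigenvalue_count_def C_def
    by (auto simp: abs_less_iff conj_commute minus_less_iff intro: order_trans[rotated])
qed

text \<open>
  A solution on both sublattices; the free value \<open>w\<close> fixes their relative normalisation.
\<close>

fun null_solution :: "(nat \<Rightarrow> real) \<Rightarrow> real \<Rightarrow> nat \<Rightarrow> real" where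
  "null_solution \<beta> w 0 = 1"
| "null_solution \<beta> w (Suc 0) = w"
| "null_solution \<beta> w (Suc (Suc i)) = - \<beta> i * null_solution \<beta> w i / \<beta> (Suc i)"

lemma (in zero_energy_weights) weight_nonzero: "\<beta> i \<noteq> 0"
  using weight_mult[of i] by auto

lemma (in zero_energy_weights) abs_null_solution:
  assumes "v 0 = 0" "w = exp (v 1)"
  shows "\<bar>null_solution \<beta> w i\<bar> = exp (v i)"
proof (induction i rule: induct_nat_012)
  case (ge2 i)
  have "\<bar>\<beta> i\<bar> * exp (v i) * exp (v (Suc i)) = \<bar>\<beta> (Suc i)\<bar> * exp (v (Suc i)) * exp (v (Suc (Suc i)))"
    using weight_mult[of i] weight_mult[of "Suc i"] by (simp add: mult.assoc)
  then have "\<bar>\<beta> i\<bar> * exp (v i) = \<bar>\<beta> (Suc i)\<bar> * exp (v (Suc (Suc i)))" by simp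
  then show ?case using ge2 weight_nonzero[of "Suc i"] by (simp add: abs_mult field_simps)
qed (use assms in auto)

definition bump :: "(nat \<Rightarrow> real) \<Rightarrow> nat \<Rightarrow> nat \<Rightarrow> nat \<Rightarrow> real" where
  "bump g p z i = (if p < i \<and> i < z \<and> odd (i + p) then g i else 0)"

text \<open>
  Inside \<open>{p<..<z}\<close> the two terms of each row cancel, so only the rows at the two ends survive.
\<close>

lemma (in zero_energy_weights) jacobi_row_bump:
  assumes g: "\<And>i. \<beta> i * g i + \<beta> (Suc i) * g (Suc (Suc i)) = 0" "\<And>i. \<bar>g i\<bar> = exp (v i)"
    and p: "p < z" "even (p + z)"
  shows "\<bar>jacobi_row \<beta> (bump g p z) i\<bar> = (if i = p \<or> i = z then exp (m - v i) else 0)"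
proof -
  have w1: "\<bar>\<beta> i\<bar> * \<bar>g (Suc i)\<bar> = exp (m - v i)" for i
    using weight_mult[of i] by (simp add: g(2) exp_diff field_simps)
  have w2: "\<bar>\<beta> i\<bar> * \<bar>g i\<bar> = exp (m - v (Suc i))" for i
    using weight_mult[of i] by (simp add: g(2) exp_diff field_simps)
  consider "odd (i + p)" | "even (i + p)" "i < p" | "i = p" | "even (i + p)" "p < i" "i < z" | "i = z" | "even (i + p)" "z < i"
    by linarith
  then show ?thesis
  proof cases
    case 1
    then have "jacobi_row \<beta> (bump g p z) i = 0" by (cases i) (auto simp: jacobi_row_def bump_def)
    moreover have "i \<noteq> p" "i \<noteq> z" using 1 p by auto
    ultimately show ?thesis by simp
  next
    case 2
    then have "jacobi_row \<beta> (bump g p z) i = 0" by (cases i) (auto simp: jacobi_row_def bump_def less_Suc_eq)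
    then show ?thesis using 2 p by simp
  next
    case 3
    have "Suc p < z" using p by (cases "Suc p = z") auto
    then have "jacobi_row \<beta> (bump g p z) i = \<beta> p * g (Suc p)"
      using 3 by (cases i) (auto simp: jacobi_row_def bump_def)
    then show ?thesis using 3 w1 by (simp add: abs_mult)
  next
    case 4
    then obtain j where j: "i = Suc j" by (cases i) auto
    have "Suc i < z" using 4 p by (cases "Suc i = z") auto
    moreover have "p < j" using 4 j by (cases "p = j") auto
    ultimately have "jacobi_row \<beta> (bump g p z) i = \<beta> j * g j + \<beta> (Suc j) * g (Suc (Suc j))"
      using 4 j by (simp add: jacobi_row_def bump_def)
    then show ?thesis using 4 g(1) by simp
  next
    case 5
    then obtain j where j: "i = Suc j" using p by (cases i) auto
    then have "p < j" using 5 p by (cases "p = j") auto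
    then have "jacobi_row \<beta> (bump g p z) i = \<beta> j * g j"
      using 5 j p by (auto simp: jacobi_row_def bump_def)
    then show ?thesis using 5 w2[of j] j by (simp add: abs_mult)
  next
    case 6
    then have "jacobi_row \<beta> (bump g p z) i = 0" by (cases i) (auto simp: jacobi_row_def bump_def less_Suc_eq)
    then show ?thesis using 6 p by simp
  qed
qed

lemma dot_disjoint_sum:
  assumes R: "finite R" and disj: "\<And>k l i. k \<in> R \<Longrightarrow> l \<in> R \<Longrightarrow> k \<noteq> l \<Longrightarrow> u k i = 0 \<or> u l i = 0"
  shows "dot N (\<lambda>i. \<Sum>k\<in>R. c k * u k i) (\<lambda>i. \<Sum>k\<in>R. c k * u k i) = (\<Sum>k\<in>R. (c k)\<^sup>2 * dot N (u k) (u k))"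
proof -
  have "(\<Sum>l\<in>R. c l * dot N (u k) (u l)) = (\<Sum>l\<in>R. if k = l then c k * dot N (u k) (u k) else 0)"
    if "k \<in> R" for k
  proof (rule sum.cong[OF refl])
    fix l assume "l \<in> R"
    then have "k \<noteq> l \<Longrightarrow> dot N (u k) (u l) = 0"
      unfolding dot_def using disj[OF that, of l] by (intro sum.neutral) auto
    then show "c l * dot N (u k) (u l) = (if k = l then c k * dot N (u k) (u k) else 0)" by auto
  qed
  then show ?thesis unfolding dot_sum_left dot_sum_right
    using R by (auto intro!: sum.cong simp: power2_eq_square)
qed

lemma dot_sum_le:
  assumes R: "finite R"
  shows "dot N (\<lambda>i. \<Sum>k\<in>R. c k * y k i) (\<lambda>i. \<Sum>k\<in>R. c k * y k i) \<le> real (card R) * (\<Sum>k\<in>R. (c k)\<^sup>2 * dot N (y k) (y k))"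
proof -
  have "(\<Sum>k\<in>R. c k * y k i)\<^sup>2 \<le> real (card R) * (\<Sum>k\<in>R. (c k)\<^sup>2 * (y k i * y k i))" for i
  proof -
    have "(\<Sum>k\<in>R. 1 * (c k * y k i))\<^sup>2 \<le> (\<Sum>k\<in>R. 1\<^sup>2) * (\<Sum>k\<in>R. (c k * y k i)\<^sup>2)" by (rule Cauchy_Schwarz_ineq_sum)
    then show ?thesis by (simp add: power2_eq_square mult_ac)
  qed
  then have "(\<Sum>i<N. (\<Sum>k\<in>R. c k * y k i)\<^sup>2) \<le> (\<Sum>i<N. real (card R) * (\<Sum>k\<in>R. (c k)\<^sup>2 * (y k i * y k i)))"
    by (intro sum_mono)
  also have "\<dots> = real (card R) * (\<Sum>k\<in>R. (c k)\<^sup>2 * dot N (y k) (y k))"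
    unfolding dot_def sum_distrib_left by (rule sum.swap)
  finally show ?thesis by (simp add: dot_def[of N "\<lambda>i. \<Sum>k\<in>R. c k * y k i"] power2_eq_square)
qed

text \<open>
  Each end of the bump is dominated by one of the interior sites \<open>r\<close> and \<open>r'\<close>, where the solution is
  larger by at least \<open>exp L\<close> than the inverse size at that end.
\<close>

lemma (in zero_energy_weights) bump_almost_null:
  assumes g: "\<And>i. \<beta> i * g i + \<beta> (Suc i) * g (Suc (Suc i)) = 0" "\<And>i. \<bar>g i\<bar> = exp (v i)"
    and p: "p < r" "r < z" "p < r'" "r' < z" "z < N" "even (p + z)" "odd (r + p)" "odd (r' + p)"
    and L: "L \<le> v p + v r" "L \<le> v r' + v z"
  shows "dot N (bump g p z) (bump g p z) > 0"
    and "dot N (apply_kernel N (jacobi \<beta>) (bump g p z)) (apply_kernel N (jacobi \<beta>) (bump g p z))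
      \<le> 2 * (exp (m - L))\<^sup>2 * dot N (bump g p z) (bump g p z)"
proof -
  let ?u = "bump g p z" and ?A = "apply_kernel N (jacobi \<beta>) (bump g p z)"
  have pz: "p < z" using p by simp
  have ge: "(exp (v i))\<^sup>2 \<le> dot N ?u ?u" if "p < i" "i < z" "odd (i + p)" for i
  proof -
    have "(exp (v i))\<^sup>2 = ?u i * ?u i" using that g(2)[of i] by (simp add: bump_def power2_eq_square[symmetric]) (metis power2_abs)
    also have "\<dots> \<le> dot N ?u ?u" unfolding dot_def
      by (rule member_le_sum) (use that p in auto)
    finally show ?thesis .
  qed
  show "dot N ?u ?u > 0" using ge[OF p(1,2,7)] by (rule less_le_trans[rotated]) simp
  have A: "?A i * ?A i = (if i = p then (exp (m - v p))\<^sup>2 else 0) + (if i = z then (exp (m - v z))\<^sup>2 else 0)" if "i < N" for i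
  proof -
    have "?A i = jacobi_row \<beta> ?u i" using that p by (intro apply_kernel_jacobi) (auto simp: bump_def)
    then have "\<bar>?A i\<bar> = (if i = p \<or> i = z then exp (m - v i) else 0)"
      using jacobi_row_bump[OF g pz p(6)] by simp
    then have "\<bar>?A i\<bar>\<^sup>2 = (if i = p \<or> i = z then exp (m - v i) else 0)\<^sup>2" by simp
    then show ?thesis using pz by (auto simp: power2_eq_square[symmetric] split: if_splits)
  qed
  have "dot N ?A ?A = (\<Sum>i<N. (if i = p then (exp (m - v p))\<^sup>2 else 0) + (if i = z then (exp (m - v z))\<^sup>2 else 0))"
    unfolding dot_def by (intro sum.cong refl A) auto
  also have "\<dots> = (exp (m - v p))\<^sup>2 + (exp (m - v z))\<^sup>2"
    using p by (simp add: sum.distrib)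
  finally have AA: "dot N ?A ?A = (exp (m - v p))\<^sup>2 + (exp (m - v z))\<^sup>2" .
  have "(exp (m - v p))\<^sup>2 \<le> (exp (m - L) * exp (v r))\<^sup>2"
    using L(1) by (intro power_mono) (auto simp: exp_add[symmetric])
  also have "\<dots> \<le> (exp (m - L))\<^sup>2 * dot N ?u ?u"
    unfolding power_mult_distrib by (intro mult_left_mono ge p) auto
  finally have 1: "(exp (m - v p))\<^sup>2 \<le> (exp (m - L))\<^sup>2 * dot N ?u ?u" .
  have "(exp (m - v z))\<^sup>2 \<le> (exp (m - L) * exp (v r'))\<^sup>2"
    using L(2) by (intro power_mono) (auto simp: exp_add[symmetric])
  also have "\<dots> \<le> (exp (m - L))\<^sup>2 * dot N ?u ?u"
    unfolding power_mult_distrib by (intro mult_left_mono ge p) auto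
  finally have 2: "(exp (m - v z))\<^sup>2 \<le> (exp (m - L))\<^sup>2 * dot N ?u ?u" .
  show "dot N ?A ?A \<le> 2 * (exp (m - L))\<^sup>2 * dot N ?u ?u"
    unfolding AA using 1 2 by linarith
qed

text \<open>
  The move number \<open>k\<close> and the next one enclose a bump on the sublattice of the time \<open>\<tau> (Suc k)\<close>. Consecutive bumps live
  on different sublattices and others on disjoint intervals, so their norms add up. Their images
  may overlap, which the Cauchy-Schwarz inequality absorbs at the price of a factor \<open>N\<close>.
\<close>

lemma count_small_eigenvalues_ge:
  assumes v: "\<And>t. v (Suc t) = - v t - \<xi> t" and v0: "v 0 = 0" and W: "zero_energy_weights \<beta> v m" and L: "L > 0" and N: "0 < N"
  shows "fst (alternation L \<xi> (N - 1)) \<le> eigenvalue_count N \<beta> {- (2 * real N * exp (m - L)) <..< 2 * real N * exp (m - L)} + 1"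
proof -
  interpret zero_energy_weights \<beta> v m by fact
  let ?l = "2 * real N * exp (m - L)"
  define C where "C = fst (alternation L \<xi> (N - 1))"
  obtain \<tau> q where t0: "\<tau> 0 = 0" and tN: "\<tau> (Suc C) = Suc (N - 1)"
    and par: "\<And>k. k \<le> C \<Longrightarrow> even (\<tau> k + k)" and less: "\<And>k. k \<le> C \<Longrightarrow> \<tau> k < \<tau> (Suc k)"
    and q: "\<And>k. k < C \<Longrightarrow> \<tau> k \<le> q k \<and> q k < \<tau> (Suc k) \<and> even (q k + k) \<and> L \<le> v (q k) + v (\<tau> (Suc k))"
    and "\<And>k i j. k \<le> C \<Longrightarrow> \<tau> k \<le> i \<Longrightarrow> i < j \<Longrightarrow> j < \<tau> (Suc k) \<Longrightarrow> even (i + k) \<Longrightarrow> odd (j + k) \<Longrightarrow> v i + v j < L"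
    by (rule alternation_partition[of v \<xi> L "N - 1" C, OF v L C_def[symmetric]]) (rule that)
  have tN: "\<tau> (Suc C) = N" using tN N by simp
  have chain: "\<tau> k < \<tau> l" if "k < l" "l \<le> Suc C" for k l
    by (rule strict_chain_less[of C \<tau> k l]) (use less that in auto)
  obtain e where S: "eigensystem N (jacobi \<beta>) (jacobi_eigenvalue \<beta> N) e"
    using jacobi_eigensystem by blast
  define g where "g = null_solution \<beta> (exp (v 1))"
  have g2: "\<bar>g i\<bar> = exp (v i)" for i unfolding g_def by (rule abs_null_solution[OF v0 refl])
  have g1: "\<beta> i * g i + \<beta> (Suc i) * g (Suc (Suc i)) = 0" for i
    using weight_nonzero[of "Suc i"] by (simp add: g_def)
  define R where "R = {..<C - 1}"
  define u where "u k = bump g (q k) (\<tau> (Suc (Suc k)))" for k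
  let ?Au = "\<lambda>k. apply_kernel N (jacobi \<beta>) (u k)"
  have C_le: "C \<le> N"
  proof -
    have "k \<le> \<tau> k" if "k \<le> Suc C" for k
      using that by (induction k) (auto dest: less intro: less_le_trans Suc_leI le_less_trans)
    from this[of "Suc C"] show ?thesis using tN by simp
  qed
  have almost: "dot N (u k) (u k) > 0" "dot N (?Au k) (?Au k) \<le> 2 * (exp (m - L))\<^sup>2 * dot N (u k) (u k)"
    if "k \<in> R" for k
  proof -
    have k: "Suc k < C" using that by (auto simp: R_def)
    have q1: "\<tau> k \<le> q k" "q k < \<tau> (Suc k)" "even (q k + k)" "L \<le> v (q k) + v (\<tau> (Suc k))"
      using q[of k] k by auto
    have q2: "\<tau> (Suc k) \<le> q (Suc k)" "q (Suc k) < \<tau> (Suc (Suc k))" "even (q (Suc k) + Suc k)"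
      "L \<le> v (q (Suc k)) + v (\<tau> (Suc (Suc k)))"
      using q[of "Suc k"] k by auto
    have z: "\<tau> (Suc (Suc k)) < N" using chain[of "Suc (Suc k)" "Suc C"] k tN by auto
    have p1: "even (\<tau> (Suc k) + Suc k)" and p2: "even (\<tau> (Suc (Suc k)) + Suc (Suc k))"
      using par[of "Suc k"] par[of "Suc (Suc k)"] k by auto
    have e: "even (q k + \<tau> (Suc (Suc k)))" "odd (\<tau> (Suc k) + q k)" "odd (q (Suc k) + q k)"
      using p1 p2 q1(3) q2(3) by auto
    have o: "\<tau> (Suc k) < \<tau> (Suc (Suc k))" "q k < q (Suc k)" using q1 q2 by auto
    show "dot N (u k) (u k) > 0" "dot N (?Au k) (?Au k) \<le> 2 * (exp (m - L))\<^sup>2 * dot N (u k) (u k)"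
      unfolding u_def
      using bump_almost_null[OF g1 g2 q1(2) o(1) o(2) q2(2) z e q1(4) q2(4)] by auto
  qed
  have disj: "u k i = 0 \<or> u l i = 0" if "k < l" "l \<in> R" for k l i
  proof (cases "l = Suc k")
    case True
    have "odd (q k + q l)" using q[of k] q[of l] True that by (auto simp: R_def)
    then have "\<not> (odd (i + q k) \<and> odd (i + q l))" by auto
    then show ?thesis by (auto simp: u_def bump_def)
  next
    case False
    have "l \<le> Suc C" "l = Suc (Suc k) \<or> Suc (Suc k) < l" using that False by (auto simp: R_def)
    then have "\<tau> (Suc (Suc k)) \<le> \<tau> l"
      using chain[of "Suc (Suc k)" l] by (auto intro: less_imp_le)
    also have "\<tau> l \<le> q l" using q[of l] that by (auto simp: R_def)
    finally show ?thesis by (auto simp: u_def bump_def)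
  qed
  have "card R \<le> card {k. k < N \<and> \<bar>jacobi_eigenvalue \<beta> N k\<bar> < ?l}"
  proof (rule eigensystem.card_ball_ge[OF S, where u = u])
    fix y :: "nat \<Rightarrow> real" assume y: "\<exists>r\<in>R. y r \<noteq> 0"
    let ?x = "\<lambda>i. \<Sum>r\<in>R. y r * u r i"
    have xx: "dot N ?x ?x = (\<Sum>k\<in>R. (y k)\<^sup>2 * dot N (u k) (u k))"
      by (rule dot_disjoint_sum) (use disj in \<open>auto simp: R_def elim!: linorder_neqE_nat\<close>)
    also have "\<dots> > 0"
    proof -
      obtain r where "r \<in> R" "y r \<noteq> 0" using y by blast
      then show ?thesis using almost by (intro sum_pos2[of _ r]) (auto simp: R_def)
    qed
    finally have pos: "dot N ?x ?x > 0" .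
    have Ax: "apply_kernel N (jacobi \<beta>) ?x = (\<lambda>i. \<Sum>r\<in>R. y r * ?Au r i)"
      by (rule ext) (rule apply_kernel_sum)
    have "dot N (apply_kernel N (jacobi \<beta>) ?x) (apply_kernel N (jacobi \<beta>) ?x)
        \<le> real (card R) * (\<Sum>k\<in>R. (y k)\<^sup>2 * dot N (?Au k) (?Au k))"
      unfolding Ax by (rule dot_sum_le) (simp add: R_def)
    also have "\<dots> \<le> real N * (\<Sum>k\<in>R. (y k)\<^sup>2 * (2 * (exp (m - L))\<^sup>2 * dot N (u k) (u k)))"
      using C_le by (intro mult_mono sum_mono mult_left_mono almost sum_nonneg) (auto simp: R_def)
    also have "\<dots> = 2 * real N * (exp (m - L))\<^sup>2 * dot N ?x ?x"
      unfolding xx by (simp add: sum_distrib_left mult_ac)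
    also have "\<dots> < ?l\<^sup>2 * dot N ?x ?x"
    proof (intro mult_strict_right_mono pos)
      have "2 * real N < (2 * real N)\<^sup>2" using N by (simp add: power2_eq_square)
      then show "2 * real N * (exp (m - L))\<^sup>2 < ?l\<^sup>2" unfolding power_mult_distrib
        by (intro mult_strict_right_mono) (auto simp: power_mult_distrib)
    qed
    finally show "dot N (apply_kernel N (jacobi \<beta>) ?x) (apply_kernel N (jacobi \<beta>) ?x) < ?l\<^sup>2 * dot N ?x ?x" .
  qed (auto simp: R_def)
  moreover have "{k. k < N \<and> \<bar>jacobi_eigenvalue \<beta> N k\<bar> < ?l} = {k. k < N \<and> jacobi_eigenvalue \<beta> N k \<in> {- ?l<..<?l}}"
    by auto
  ultimately show ?thesis unfolding eigenvalue_count_def C_def[symmetric] by (simp add: R_def)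
qed

section \<open>The expected number of alternations\<close>

abbreviation completions :: "real \<Rightarrow> (nat \<Rightarrow> real) \<Rightarrow> nat \<Rightarrow> nat" where
  "completions L \<xi> t \<equiv> fst (alternation L \<xi> t)"

abbreviation elevation :: "real \<Rightarrow> (nat \<Rightarrow> real) \<Rightarrow> nat \<Rightarrow> real" where
  "elevation L \<xi> t \<equiv> snd (alternation L \<xi> t)"

definition direction :: "real \<Rightarrow> (nat \<Rightarrow> real) \<Rightarrow> nat \<Rightarrow> real" where
  "direction L \<xi> t = (if even (completions L \<xi> t + t) then - 1 else 1)"

definition overshoot :: "real \<Rightarrow> (nat \<Rightarrow> real) \<Rightarrow> nat \<Rightarrow> real" where
  "overshoot L \<xi> t = (if even (completions L \<xi> t + t) \<and> elevation L \<xi> t - \<xi> t \<ge> L then elevation L \<xi> t - \<xi> t else 0)"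

definition reflection :: "real \<Rightarrow> (nat \<Rightarrow> real) \<Rightarrow> nat \<Rightarrow> real" where
  "reflection L \<xi> t = (if even (completions L \<xi> t + t) then 0 else max 0 (- (elevation L \<xi> t + \<xi> t)))"

lemma completions_Suc:
  "completions L \<xi> (Suc t) = (if even (completions L \<xi> t + t) \<and> elevation L \<xi> t - \<xi> t \<ge> L then completions L \<xi> t + 1 else completions L \<xi> t)"
  by (auto simp: alternation_step_def split: prod.splits)

lemma elevation_Suc:
  "elevation L \<xi> (Suc t) = (if even (completions L \<xi> t + t) then (if elevation L \<xi> t - \<xi> t \<ge> L then 0 else elevation L \<xi> t - \<xi> t) else max 0 (elevation L \<xi> t + \<xi> t))"
  by (auto simp: alternation_step_def split: prod.splits)

lemma elevation_Suc_eq: "elevation L \<xi> (Suc t) = elevation L \<xi> t + direction L \<xi> t * \<xi> t - overshoot L \<xi> t + reflection L \<xi> t"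
  unfolding elevation_Suc direction_def overshoot_def reflection_def by auto

text \<open>
  Away from completions and reflections the square is that of a walk; these events remove the squares
  of the overshooting and of the reflected value.
\<close>

lemma elevation_Suc_squared:
  "(elevation L \<xi> (Suc t))\<^sup>2 = (elevation L \<xi> t)\<^sup>2 + 2 * (direction L \<xi> t * elevation L \<xi> t * \<xi> t) + (\<xi> t)\<^sup>2
     - (overshoot L \<xi> t)\<^sup>2 - (reflection L \<xi> t)\<^sup>2"
  unfolding elevation_Suc direction_def overshoot_def reflection_def
  by (auto simp: power2_eq_square algebra_simps max_def)

declare alternation.simps(2) [simp del]

definition previous_size :: "(nat \<Rightarrow> real) \<Rightarrow> nat \<Rightarrow> real" where
  "previous_size \<xi> t = (case t of 0 \<Rightarrow> 0 | Suc u \<Rightarrow> \<bar>\<xi> u\<bar>)"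

lemma previous_size_nonneg [simp]: "0 \<le> previous_size \<xi> t"
  by (simp add: previous_size_def split: nat.splits)

text \<open>
  The bounds \<open>0\<close> and \<open>L\<close> are enforced at alternate times, and between two enforcements of the same bound the
  walk can violate it by a single step only.
\<close>

lemma elevation_bounds:
  assumes L: "L > 0"
  shows "(if even (completions L \<xi> t + t) then 0 \<le> elevation L \<xi> t \<and> elevation L \<xi> t \<le> L + previous_size \<xi> t
     else - previous_size \<xi> t \<le> elevation L \<xi> t \<and> elevation L \<xi> t < L)"
proof (induction t)
  case (Suc t)
  then show ?case using L unfolding elevation_Suc completions_Suc
    by (auto simp: previous_size_def[of _ "Suc t"] split: if_splits)
qed (use L in \<open>simp add: previous_size_def\<close>)

lemma abs_elevation_le:
  assumes L: "L > 0"
  shows "\<bar>elevation L \<xi> t\<bar> \<le> L + previous_size \<xi> t"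
proof -
  have "- previous_size \<xi> t \<le> elevation L \<xi> t" "elevation L \<xi> t \<le> L + previous_size \<xi> t"
    using elevation_bounds[OF L, of \<xi> t] previous_size_nonneg[of \<xi> t]
    by (simp_all split: if_splits, linarith+)
  then show ?thesis using L unfolding abs_le_iff by linarith
qed

lemma elevation_squared_le: "L > 0 \<Longrightarrow> (elevation L \<xi> t)\<^sup>2 \<le> 2 * L\<^sup>2 + 2 * (previous_size \<xi> t)\<^sup>2"
proof -
  assume L: "L > 0"
  have "(elevation L \<xi> t)\<^sup>2 \<le> (L + previous_size \<xi> t)\<^sup>2"
    using abs_elevation_le[OF L, of \<xi> t] by (subst power2_abs[symmetric]) (intro power_mono, auto)
  also have "\<dots> \<le> 2 * L\<^sup>2 + 2 * (previous_size \<xi> t)\<^sup>2"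
    using sum_squares_bound[of L "previous_size \<xi> t"] by (simp add: power2_sum)
  finally show ?thesis .
qed

lemma completions_le: "completions L \<xi> t \<le> t"
  by (induction t) (auto simp: completions_Suc)

lemma overshoot_bounds:
  assumes L: "L > 0"
  shows "0 \<le> overshoot L \<xi> t" "overshoot L \<xi> t \<le> L + (previous_size \<xi> t + \<bar>\<xi> t\<bar>)"
    "L\<^sup>2 * (real (completions L \<xi> (Suc t)) - real (completions L \<xi> t)) \<le> (overshoot L \<xi> t)\<^sup>2"
    "overshoot L \<xi> t \<le> (overshoot L \<xi> t)\<^sup>2 / L"
    "completions L \<xi> (Suc t) = completions L \<xi> t \<Longrightarrow> overshoot L \<xi> t = 0"
proof -
  define e where "e = elevation L \<xi> t - \<xi> t"
  have *: "L\<^sup>2 \<le> e\<^sup>2" "e \<le> e\<^sup>2 / L" if "L \<le> e"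
    using that L by (auto simp: power2_eq_square field_simps intro: mult_mono)
  have "e \<le> L + (previous_size \<xi> t + \<bar>\<xi> t\<bar>)"
    using abs_elevation_le[OF L, of \<xi> t] unfolding e_def by linarith
  then show "0 \<le> overshoot L \<xi> t" "overshoot L \<xi> t \<le> L + (previous_size \<xi> t + \<bar>\<xi> t\<bar>)"
    using L previous_size_nonneg[of \<xi> t] by (simp_all add: overshoot_def e_def[symmetric])
  show "L\<^sup>2 * (real (completions L \<xi> (Suc t)) - real (completions L \<xi> t)) \<le> (overshoot L \<xi> t)\<^sup>2"
    "overshoot L \<xi> t \<le> (overshoot L \<xi> t)\<^sup>2 / L"
    using * by (simp_all add: overshoot_def completions_Suc e_def[symmetric])
  show "completions L \<xi> (Suc t) = completions L \<xi> t \<Longrightarrow> overshoot L \<xi> t = 0"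
    unfolding overshoot_def completions_Suc by (metis add_eq_self_zero zero_neq_one)
qed

lemma reflection_bounds:
  assumes L: "L > 0"
  shows "0 \<le> reflection L \<xi> t" "reflection L \<xi> t \<le> previous_size \<xi> t + \<bar>\<xi> t\<bar>"
  using elevation_bounds[OF L, of \<xi> t] by (auto simp: reflection_def split: if_splits)

definition tail_square :: "real \<Rightarrow> real \<Rightarrow> real" where
  "tail_square r x = (if \<bar>x\<bar> > r then x\<^sup>2 else 0)"

lemma tail_square_nonneg [simp]: "0 \<le> tail_square r x"
  by (simp add: tail_square_def)

lemma tail_square_add:
  assumes "0 \<le> x" "0 \<le> y" "x + y > r"
  shows "(x + y)\<^sup>2 \<le> 4 * tail_square (r / 2) x + 4 * tail_square (r / 2) y"
proof -
  have *: "(a + b)\<^sup>2 \<le> 4 * tail_square (r / 2) b" if "0 \<le> a" "a \<le> b" "r < a + b" for a b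
  proof -
    have "(a + b)\<^sup>2 \<le> (2 * b)\<^sup>2" using that by (intro power_mono) auto
    then show ?thesis using that by (simp add: tail_square_def power_mult_distrib)
  qed
  show ?thesis using *[of x y] *[of y x] assms tail_square_nonneg[of "r / 2" x] tail_square_nonneg[of "r / 2" y]
    unfolding add.commute[of y x] by linarith
qed

text \<open>
  Unless the last two steps add up to more than \<open>\<delta> * L\<close>, a completed move overshoots \<open>L\<close> only by a
  factor \<open>1 + \<delta>\<close>.
\<close>

lemma overshoot_squared_le:
  assumes L: "L > 0" and d: "\<delta> > 0"
  shows "(overshoot L \<xi> t)\<^sup>2 \<le> (1 + \<delta>)\<^sup>2 * L\<^sup>2 * (real (completions L \<xi> (Suc t)) - real (completions L \<xi> t))
     + (1 + 1 / \<delta>)\<^sup>2 * (4 * tail_square (\<delta> * L / 2) (previous_size \<xi> t) + 4 * tail_square (\<delta> * L / 2) (\<xi> t))"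
proof (cases "completions L \<xi> (Suc t) = completions L \<xi> t")
  case True
  then show ?thesis using overshoot_bounds(5)[OF L True] by simp
next
  case False
  then have inc: "real (completions L \<xi> (Suc t)) - real (completions L \<xi> t) = 1"
    by (auto simp: completions_Suc split: if_splits)
  let ?Z = "previous_size \<xi> t + \<bar>\<xi> t\<bar>"
  note b = overshoot_bounds(1,2)[OF L, of \<xi> t]
  have abs: "tail_square r \<bar>x\<bar> = tail_square r x" for r x by (simp add: tail_square_def)
  show ?thesis
  proof (cases "?Z \<le> \<delta> * L")
    case True
    then have "overshoot L \<xi> t \<le> (1 + \<delta>) * L" using b by (simp add: algebra_simps)
    then have "(overshoot L \<xi> t)\<^sup>2 \<le> ((1 + \<delta>) * L)\<^sup>2" using b by (intro power_mono)
    then show ?thesis unfolding inc by (simp add: power_mult_distrib add_increasing2)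
  next
    case False
    then have Z: "\<delta> * L < ?Z" by simp
    then have "L \<le> 1 / \<delta> * ?Z" using d by (simp add: field_simps)
    then have "overshoot L \<xi> t \<le> (1 + 1 / \<delta>) * ?Z" using b by (simp add: algebra_simps)
    then have "(overshoot L \<xi> t)\<^sup>2 \<le> (1 + 1 / \<delta>)\<^sup>2 * ?Z\<^sup>2"
      unfolding power_mult_distrib[symmetric] using b by (intro power_mono)
    also have "\<dots> \<le> (1 + 1 / \<delta>)\<^sup>2 * (4 * tail_square (\<delta> * L / 2) (previous_size \<xi> t) + 4 * tail_square (\<delta> * L / 2) (\<xi> t))"
      using tail_square_add[of "previous_size \<xi> t" "\<bar>\<xi> t\<bar>" "\<delta> * L"] Z by (intro mult_left_mono) (auto simp: abs)
    finally show ?thesis unfolding inc by (simp add: add_increasing)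
  qed
qed

lemma reflection_squared_le:
  assumes L: "L > 0" and R: "R \<ge> 0"
  shows "(reflection L \<xi> t)\<^sup>2 \<le> R * reflection L \<xi> t + (4 * tail_square (R / 2) (previous_size \<xi> t) + 4 * tail_square (R / 2) (\<xi> t))"
proof (cases "previous_size \<xi> t + \<bar>\<xi> t\<bar> \<le> R")
  case True
  then have "(reflection L \<xi> t)\<^sup>2 \<le> R * reflection L \<xi> t"
    using reflection_bounds[OF L, of \<xi> t] unfolding power2_eq_square by (intro mult_right_mono) auto
  then show ?thesis by (simp add: add_increasing2)
next
  case False
  have abs: "tail_square r \<bar>x\<bar> = tail_square r x" for r x by (simp add: tail_square_def)
  have "(reflection L \<xi> t)\<^sup>2 \<le> (previous_size \<xi> t + \<bar>\<xi> t\<bar>)\<^sup>2"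
    using reflection_bounds[OF L, of \<xi> t] by (intro power_mono) auto
  also have "\<dots> \<le> 4 * tail_square (R / 2) (previous_size \<xi> t) + 4 * tail_square (R / 2) (\<xi> t)"
    using tail_square_add[of "previous_size \<xi> t" "\<bar>\<xi> t\<bar>" R] False by (simp add: abs)
  finally show ?thesis using R reflection_bounds(1)[OF L, of \<xi> t] by (simp add: add_increasing)
qed

lemma alternation_restrict:
  assumes "t \<le> n"
  shows "alternation L (restrict y {..<n}) t = alternation L y t"
  using assms by (induction t) (auto simp: alternation.simps)

lemma measurable_alternation:
  assumes "t \<le> n"
  shows "(\<lambda>y. completions L y t) \<in> measurable (PiM {..<n} (\<lambda>_. borel)) (count_space UNIV)"
    and "(\<lambda>y. elevation L y t) \<in> borel_measurable (PiM {..<n} (\<lambda>_. borel))"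
  using assms
proof (induction t)
  case 0
  { case 1 show ?case by simp }
  { case 2 show ?case by simp }
next
  case (Suc t)
  have [measurable]: "(\<lambda>y. y t) \<in> borel_measurable (PiM {..<n} (\<lambda>_. borel :: real measure))"
    if "Suc t \<le> n" using that by (intro measurable_component_singleton) auto
  { case 1
    note [measurable] = Suc.IH(1)[OF Suc_leD[OF 1]] Suc.IH(2)[OF Suc_leD[OF 1]]
    show ?case unfolding completions_Suc using 1 by measurable }
  { case 2
    note [measurable] = Suc.IH(1)[OF Suc_leD[OF 2]] Suc.IH(2)[OF Suc_leD[OF 2]]
    show ?case unfolding elevation_Suc using 2 by measurable }
qed

locale centred_increments = prob_space M for M :: "'s measure" +
  fixes \<xi> :: "nat \<Rightarrow> 's \<Rightarrow> real" and V :: real and g :: "real \<Rightarrow> real"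
  assumes indep: "indep_vars (\<lambda>_. borel) \<xi> UNIV"
    and square_integrable: "\<And>t. integrable M (\<lambda>\<omega>. (\<xi> t \<omega>)\<^sup>2)"
    and mean: "\<And>t. expectation (\<xi> t) = 0"
    and second_moment: "\<And>t. expectation (\<lambda>\<omega>. (\<xi> t \<omega>)\<^sup>2) = V"
    and tail: "\<And>t r. expectation (\<lambda>\<omega>. tail_square r (\<xi> t \<omega>)) = g r"
begin

abbreviation "walk \<omega> \<equiv> (\<lambda>t. \<xi> t \<omega>)"

lemma rv [measurable]: "\<xi> t \<in> borel_measurable M"
  using indep by (auto simp: indep_vars_def)

lemma integrable_increment: "integrable M (\<xi> t)"
  by (rule square_integrable_imp_integrable[OF rv square_integrable])

lemma measurable_path:
  "(\<lambda>\<omega>. completions L (walk \<omega>) t) \<in> measurable M (count_space UNIV)"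
  "(\<lambda>\<omega>. elevation L (walk \<omega>) t) \<in> borel_measurable M"
proof -
  have m: "(\<lambda>\<omega>. restrict (walk \<omega>) {..<t}) \<in> measurable M (PiM {..<t} (\<lambda>_. borel))"
    by (intro measurable_restrict) measurable
  show "(\<lambda>\<omega>. completions L (walk \<omega>) t) \<in> measurable M (count_space UNIV)"
    using measurable_compose[OF m measurable_alternation(1)[of t t L]] by (simp add: alternation_restrict)
  show "(\<lambda>\<omega>. elevation L (walk \<omega>) t) \<in> borel_measurable M"
    using measurable_compose[OF m measurable_alternation(2)[of t t L]] by (simp add: alternation_restrict)
qed

lemmas [measurable] = measurable_path

text \<open>
  The state at time \<open>t\<close> depends on the steps before \<open>t\<close> only. This is the one place where the
  independence of the steps enters the count of completions.
\<close>

lemma uncorrelated: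
  assumes h: "(\<lambda>y. h (alternation L y t)) \<in> borel_measurable (PiM {..<t} (\<lambda>_. borel))"
    and int: "integrable M (\<lambda>\<omega>. h (alternation L (walk \<omega>) t))"
  shows "integrable M (\<lambda>\<omega>. h (alternation L (walk \<omega>) t) * \<xi> t \<omega>)"
    and "expectation (\<lambda>\<omega>. h (alternation L (walk \<omega>) t) * \<xi> t \<omega>) = 0"
proof -
  have "indep_var borel ((\<lambda>y. h (alternation L y t)) \<circ> (\<lambda>\<omega>. restrict (walk \<omega>) {..<t}))
      borel ((\<lambda>y. y t) \<circ> (\<lambda>\<omega>. restrict (walk \<omega>) {t}))"
    by (rule indep_var_compose[OF indep_var_restrict[OF indep] h]) auto
  then have i: "indep_var borel (\<lambda>\<omega>. h (alternation L (walk \<omega>) t)) borel (\<xi> t)"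
    by (simp add: o_def alternation_restrict)
  show "integrable M (\<lambda>\<omega>. h (alternation L (walk \<omega>) t) * \<xi> t \<omega>)"
    by (rule indep_var_integrable[OF i int integrable_increment])
  show "expectation (\<lambda>\<omega>. h (alternation L (walk \<omega>) t) * \<xi> t \<omega>) = 0"
    using indep_var_lebesgue_integral[OF i int integrable_increment] mean by simp
qed

lemma integrable_previous: "integrable M (\<lambda>\<omega>. (previous_size (walk \<omega>) t)\<^sup>2)"
  using square_integrable by (cases t) (auto simp: previous_size_def)

lemma expectation_previous: "expectation (\<lambda>\<omega>. (previous_size (walk \<omega>) t)\<^sup>2) \<le> V"
proof -
  have "0 \<le> V" unfolding second_moment[of 0, symmetric] by (intro integral_nonneg_AE) auto
  then show ?thesis by (cases t) (auto simp: previous_size_def second_moment)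
qed

lemma tail_integrable: "integrable M (\<lambda>\<omega>. tail_square r (\<xi> t \<omega>))"
  by (rule Bochner_Integration.integrable_bound[OF square_integrable[of t]]) (auto simp: tail_square_def)

lemma tail_nonneg: "0 \<le> g r"
  unfolding tail[of r 0, symmetric] by (intro integral_nonneg_AE) auto

lemma previous_tail:
  shows "integrable M (\<lambda>\<omega>. tail_square r (previous_size (walk \<omega>) t))"
    and "r \<ge> 0 \<Longrightarrow> expectation (\<lambda>\<omega>. tail_square r (previous_size (walk \<omega>) t)) \<le> g r"
proof -
  have abs: "tail_square r \<bar>x\<bar> = tail_square r x" for r x by (simp add: tail_square_def)
  show "integrable M (\<lambda>\<omega>. tail_square r (previous_size (walk \<omega>) t))"
    by (cases t) (auto simp: previous_size_def abs tail_integrable)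
  show "r \<ge> 0 \<Longrightarrow> expectation (\<lambda>\<omega>. tail_square r (previous_size (walk \<omega>) t)) \<le> g r"
    using tail_nonneg by (cases t) (auto simp: previous_size_def abs tail tail_square_def[of _ 0])
qed

context
  fixes L :: real
  assumes L: "L > 0"
begin

lemma integrable_elevation_squared: "integrable M (\<lambda>\<omega>. (elevation L (walk \<omega>) t)\<^sup>2)"
proof (rule Bochner_Integration.integrable_bound)
  show "integrable M (\<lambda>\<omega>. 2 * L\<^sup>2 + 2 * (previous_size (walk \<omega>) t)\<^sup>2)"
    using integrable_previous by simp
qed (use elevation_squared_le[OF L] in \<open>auto intro!: AE_I2 simp: abs_of_nonneg\<close>)

lemma integrable_elevation: "integrable M (\<lambda>\<omega>. elevation L (walk \<omega>) t)"
  by (rule square_integrable_imp_integrable[OF _ integrable_elevation_squared]) measurable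

lemma measurable_overshoot [measurable]: "(\<lambda>\<omega>. overshoot L (walk \<omega>) t) \<in> borel_measurable M"
  unfolding overshoot_def by measurable

lemma measurable_reflection [measurable]: "(\<lambda>\<omega>. reflection L (walk \<omega>) t) \<in> borel_measurable M"
  unfolding reflection_def by measurable

lemma integrable_step_size: "integrable M (\<lambda>\<omega>. (L + (previous_size (walk \<omega>) t + \<bar>\<xi> t \<omega>\<bar>))\<^sup>2)"
proof (rule Bochner_Integration.integrable_bound)
  show "integrable M (\<lambda>\<omega>. 3 * (L\<^sup>2 + (previous_size (walk \<omega>) t)\<^sup>2 + (\<xi> t \<omega>)\<^sup>2))"
    using integrable_previous square_integrable by simp
  have [measurable]: "(\<lambda>\<omega>. previous_size (walk \<omega>) t) \<in> borel_measurable M"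
    by (cases t) (auto simp: previous_size_def)
  show "(\<lambda>\<omega>. (L + (previous_size (walk \<omega>) t + \<bar>\<xi> t \<omega>\<bar>))\<^sup>2) \<in> borel_measurable M" by measurable
  have "(x + (y + \<bar>z\<bar>))\<^sup>2 \<le> 3 * (x\<^sup>2 + y\<^sup>2 + z\<^sup>2)" for x y z :: real
  proof -
    have "0 \<le> (x - y)\<^sup>2 + (x - \<bar>z\<bar>)\<^sup>2 + (y - \<bar>z\<bar>)\<^sup>2" by simp
    then show ?thesis by (simp add: power2_eq_square algebra_simps)
  qed
  then show "AE \<omega> in M. norm ((L + (previous_size (walk \<omega>) t + \<bar>\<xi> t \<omega>\<bar>))\<^sup>2) \<le> norm (3 * (L\<^sup>2 + (previous_size (walk \<omega>) t)\<^sup>2 + (\<xi> t \<omega>)\<^sup>2))"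
    by (intro AE_I2) (simp add: abs_of_nonneg add_nonneg_nonneg)
qed

lemma integrable_overshoot_squared: "integrable M (\<lambda>\<omega>. (overshoot L (walk \<omega>) t)\<^sup>2)"
proof (rule Bochner_Integration.integrable_bound[OF integrable_step_size])
  show "AE \<omega> in M. norm ((overshoot L (walk \<omega>) t)\<^sup>2) \<le> norm ((L + (previous_size (walk \<omega>) t + \<bar>\<xi> t \<omega>\<bar>))\<^sup>2)"
    using overshoot_bounds(1,2)[OF L] by (intro AE_I2) (auto intro!: power_mono)
qed measurable

lemma integrable_reflection_squared: "integrable M (\<lambda>\<omega>. (reflection L (walk \<omega>) t)\<^sup>2)"
proof (rule Bochner_Integration.integrable_bound[OF integrable_step_size])
  show "AE \<omega> in M. norm ((reflection L (walk \<omega>) t)\<^sup>2) \<le> norm ((L + (previous_size (walk \<omega>) t + \<bar>\<xi> t \<omega>\<bar>))\<^sup>2)"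
  proof (intro AE_I2)
    fix \<omega>
    have "reflection L (walk \<omega>) t \<le> L + (previous_size (walk \<omega>) t + \<bar>\<xi> t \<omega>\<bar>)"
      using reflection_bounds(2)[OF L, of "walk \<omega>" t] L by linarith
    then have "(reflection L (walk \<omega>) t)\<^sup>2 \<le> (L + (previous_size (walk \<omega>) t + \<bar>\<xi> t \<omega>\<bar>))\<^sup>2"
      using reflection_bounds(1)[OF L] by (intro power_mono)
    then show "norm ((reflection L (walk \<omega>) t)\<^sup>2) \<le> norm ((L + (previous_size (walk \<omega>) t + \<bar>\<xi> t \<omega>\<bar>))\<^sup>2)"
      by simp
  qed
qed measurable

lemma integrable_overshoot: "integrable M (\<lambda>\<omega>. overshoot L (walk \<omega>) t)"
  by (rule square_integrable_imp_integrable[OF _ integrable_overshoot_squared]) measurable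

lemma integrable_reflection: "integrable M (\<lambda>\<omega>. reflection L (walk \<omega>) t)"
  by (rule square_integrable_imp_integrable[OF _ integrable_reflection_squared]) measurable

lemma integrable_completions: "integrable M (\<lambda>\<omega>. real (completions L (walk \<omega>) t))"
  by (rule integrable_const_bound[of _ "real t"]) (auto simp: completions_le)

lemma drift_free:
  shows "integrable M (\<lambda>\<omega>. direction L (walk \<omega>) t * \<xi> t \<omega>)"
    and "expectation (\<lambda>\<omega>. direction L (walk \<omega>) t * \<xi> t \<omega>) = 0"
    and "integrable M (\<lambda>\<omega>. direction L (walk \<omega>) t * elevation L (walk \<omega>) t * \<xi> t \<omega>)"
    and "expectation (\<lambda>\<omega>. direction L (walk \<omega>) t * elevation L (walk \<omega>) t * \<xi> t \<omega>) = 0"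
proof -
  note [measurable] = measurable_alternation[of t t L]
  have d: "(\<lambda>y. direction L y t) \<in> borel_measurable (PiM {..<t} (\<lambda>_. borel))"
    unfolding direction_def by measurable
  have dh: "(\<lambda>y. direction L y t * elevation L y t) \<in> borel_measurable (PiM {..<t} (\<lambda>_. borel))"
    unfolding direction_def by measurable
  have dM [measurable]: "(\<lambda>\<omega>. direction L (walk \<omega>) t) \<in> borel_measurable M"
    unfolding direction_def by measurable
  have di: "integrable M (\<lambda>\<omega>. direction L (walk \<omega>) t)"
    by (rule integrable_const_bound[of _ 1]) (auto simp: direction_def)
  have dhi: "integrable M (\<lambda>\<omega>. direction L (walk \<omega>) t * elevation L (walk \<omega>) t)"
    by (rule Bochner_Integration.integrable_bound[OF integrable_elevation[of t]]) (auto simp: direction_def)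
  let ?d = "\<lambda>s. if even (fst s + t) then - 1 else 1 :: real"
  note 1 = uncorrelated[of ?d L t] and 2 = uncorrelated[of "\<lambda>s. ?d s * snd s" L t]
  show "integrable M (\<lambda>\<omega>. direction L (walk \<omega>) t * \<xi> t \<omega>)"
    "expectation (\<lambda>\<omega>. direction L (walk \<omega>) t * \<xi> t \<omega>) = 0"
    using 1 d di by (auto simp: direction_def)
  show "integrable M (\<lambda>\<omega>. direction L (walk \<omega>) t * elevation L (walk \<omega>) t * \<xi> t \<omega>)"
    "expectation (\<lambda>\<omega>. direction L (walk \<omega>) t * elevation L (walk \<omega>) t * \<xi> t \<omega>) = 0"
    using 2 dh dhi by (auto simp: direction_def)
qed

lemma expectation_elevation:
  "expectation (\<lambda>\<omega>. elevation L (walk \<omega>) T) =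
     (\<Sum>t<T. expectation (\<lambda>\<omega>. reflection L (walk \<omega>) t)) - (\<Sum>t<T. expectation (\<lambda>\<omega>. overshoot L (walk \<omega>) t))"
proof (induction T)
  case (Suc T)
  have "expectation (\<lambda>\<omega>. elevation L (walk \<omega>) (Suc T)) =
      expectation (\<lambda>\<omega>. elevation L (walk \<omega>) T) - expectation (\<lambda>\<omega>. overshoot L (walk \<omega>) T) + expectation (\<lambda>\<omega>. reflection L (walk \<omega>) T)"
    unfolding elevation_Suc_eq by (simp add: integrable_elevation drift_free integrable_overshoot integrable_reflection)
  with Suc show ?case by simp
qed simp

lemma expectation_elevation_squared:
  "expectation (\<lambda>\<omega>. (elevation L (walk \<omega>) T)\<^sup>2) =
     real T * V - (\<Sum>t<T. expectation (\<lambda>\<omega>. (overshoot L (walk \<omega>) t)\<^sup>2)) - (\<Sum>t<T. expectation (\<lambda>\<omega>. (reflection L (walk \<omega>) t)\<^sup>2))"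
proof (induction T)
  case (Suc T)
  have "expectation (\<lambda>\<omega>. (elevation L (walk \<omega>) (Suc T))\<^sup>2) =
      expectation (\<lambda>\<omega>. (elevation L (walk \<omega>) T)\<^sup>2) + V - expectation (\<lambda>\<omega>. (overshoot L (walk \<omega>) T)\<^sup>2) - expectation (\<lambda>\<omega>. (reflection L (walk \<omega>) T)\<^sup>2)"
    unfolding elevation_Suc_squared
    by (simp add: integrable_elevation_squared drift_free integrable_overshoot_squared integrable_reflection_squared square_integrable second_moment)
  with Suc show ?case by (simp add: algebra_simps)
qed simp

lemma completions_telescope:
  "expectation (\<lambda>\<omega>. real (completions L (walk \<omega>) T)) =
    (\<Sum>t<T. expectation (\<lambda>\<omega>. real (completions L (walk \<omega>) (Suc t)) - real (completions L (walk \<omega>) t)))"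
proof -
  have "(\<Sum>t<T. expectation (\<lambda>\<omega>. real (completions L (walk \<omega>) (Suc t)) - real (completions L (walk \<omega>) t))) =
     (\<Sum>t<T. expectation (\<lambda>\<omega>. real (completions L (walk \<omega>) (Suc t))) - expectation (\<lambda>\<omega>. real (completions L (walk \<omega>) t)))"
    by (simp add: integrable_completions)
  also have "\<dots> = expectation (\<lambda>\<omega>. real (completions L (walk \<omega>) T)) - expectation (\<lambda>\<omega>. real (completions L (walk \<omega>) 0))"
    by (rule sum_lessThan_telescope)
  finally show ?thesis by simp
qed

lemma sum_overshoot_squared_le: "(\<Sum>t<T. expectation (\<lambda>\<omega>. (overshoot L (walk \<omega>) t)\<^sup>2)) \<le> real T * V"
proof -
  have "0 \<le> expectation (\<lambda>\<omega>. (elevation L (walk \<omega>) T)\<^sup>2)" by (rule integral_nonneg_AE) auto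
  moreover have "0 \<le> (\<Sum>t<T. expectation (\<lambda>\<omega>. (reflection L (walk \<omega>) t)\<^sup>2))"
    by (intro sum_nonneg integral_nonneg_AE) auto
  ultimately show ?thesis using expectation_elevation_squared[of T] by linarith
qed

text \<open>
  Every completion removes at least \<open>L\<^sup>2\<close> from the square of the progress, which gains \<open>V\<close> per step.
\<close>

theorem expected_completions_le:
  "L\<^sup>2 * expectation (\<lambda>\<omega>. real (completions L (walk \<omega>) T)) \<le> real T * V"
proof -
  have "L\<^sup>2 * expectation (\<lambda>\<omega>. real (completions L (walk \<omega>) T)) =
     (\<Sum>t<T. expectation (\<lambda>\<omega>. L\<^sup>2 * (real (completions L (walk \<omega>) (Suc t)) - real (completions L (walk \<omega>) t))))"
    unfolding completions_telescope by (simp add: sum_distrib_left)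
  also have "\<dots> \<le> (\<Sum>t<T. expectation (\<lambda>\<omega>. (overshoot L (walk \<omega>) t)\<^sup>2))"
    by (intro sum_mono integral_mono) (auto simp: integrable_overshoot_squared integrable_completions overshoot_bounds(3)[OF L])
  also have "\<dots> \<le> real T * V" by (rule sum_overshoot_squared_le)
  finally show ?thesis .
qed

text \<open>
  In first moment the reflections are balanced by what the completions remove. As each of them removes
  at least \<open>L\<close>, this is at most \<open>1 / L\<close> times their second-moment loss, hence of order \<open>T / L\<close>.
\<close>

lemma sum_reflection_le:
  "(\<Sum>t<T. expectation (\<lambda>\<omega>. reflection L (walk \<omega>) t)) \<le> L + 2 * real T * V / L"
proof -
  have "(\<Sum>t<T. expectation (\<lambda>\<omega>. overshoot L (walk \<omega>) t)) \<le> (\<Sum>t<T. expectation (\<lambda>\<omega>. (overshoot L (walk \<omega>) t)\<^sup>2 / L))"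
    by (intro sum_mono integral_mono)
       (auto simp: integrable_overshoot_squared integrable_overshoot overshoot_bounds(4)[OF L])
  also have "\<dots> = (\<Sum>t<T. expectation (\<lambda>\<omega>. (overshoot L (walk \<omega>) t)\<^sup>2)) / L"
    by (simp add: sum_divide_distrib)
  also have "\<dots> \<le> real T * V / L" using L sum_overshoot_squared_le by (intro divide_right_mono) auto
  finally have 1: "(\<Sum>t<T. expectation (\<lambda>\<omega>. overshoot L (walk \<omega>) t)) \<le> real T * V / L" .
  have le: "x \<le> L + x\<^sup>2 / L" for x
  proof (cases "x \<le> L")
    case False
    then have "x * L \<le> x * x" using L by (intro mult_left_mono) auto
    then have "x \<le> x\<^sup>2 / L" using L by (simp add: field_simps power2_eq_square)
    then show ?thesis using L by simp
  qed (use L in \<open>simp add: add_increasing2\<close>)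
  have "expectation (\<lambda>\<omega>. elevation L (walk \<omega>) T) \<le> expectation (\<lambda>\<omega>. L + (elevation L (walk \<omega>) T)\<^sup>2 / L)"
    by (intro integral_mono le) (auto simp: integrable_elevation integrable_elevation_squared)
  also have "\<dots> = L + expectation (\<lambda>\<omega>. (elevation L (walk \<omega>) T)\<^sup>2) / L"
    by (simp add: integrable_elevation_squared prob_space)
  also have "expectation (\<lambda>\<omega>. (elevation L (walk \<omega>) T)\<^sup>2) \<le> real T * V"
  proof -
    have "0 \<le> (\<Sum>t<T. expectation (\<lambda>\<omega>. (reflection L (walk \<omega>) t)\<^sup>2))"
      "0 \<le> (\<Sum>t<T. expectation (\<lambda>\<omega>. (overshoot L (walk \<omega>) t)\<^sup>2))"
      by (intro sum_nonneg integral_nonneg_AE; simp)+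
    then show ?thesis using expectation_elevation_squared[of T] by linarith
  qed
  finally have "expectation (\<lambda>\<omega>. elevation L (walk \<omega>) T) \<le> L + real T * V / L"
    using L by (simp add: divide_right_mono)
  then have "(\<Sum>t<T. expectation (\<lambda>\<omega>. reflection L (walk \<omega>) t)) \<le> L + real T * V / L + real T * V / L"
    using expectation_elevation[of T] 1 by linarith
  then show ?thesis by (simp add: field_simps)
qed

text \<open>
  The square of the progress ends at order at most \<open>L\<^sup>2\<close>, so what the steps contribute must have been
  removed. Reflections smaller than \<open>R\<close> are handled by their first moment, larger ones and large
  overshoots by the truncated second moment \<open>g\<close> of the steps.
\<close>

theorem expected_completions_ge:
  assumes \<delta>: "\<delta> > 0" and R: "R \<ge> 0"
  shows "real T * V \<le> (1 + \<delta>)\<^sup>2 * L\<^sup>2 * expectation (\<lambda>\<omega>. real (completions L (walk \<omega>) T))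
    + (2 * L\<^sup>2 + 2 * V + R * (L + 2 * real T * V / L) + real T * (8 * g (R / 2)) + real T * ((1 + 1 / \<delta>)\<^sup>2 * (8 * g (\<delta> * L / 2))))"
proof -
  let ?E = expectation
  have tails: "?E (\<lambda>\<omega>. 4 * tail_square (r / 2) (previous_size (walk \<omega>) t) + 4 * tail_square (r / 2) (\<xi> t \<omega>)) \<le> 8 * g (r / 2)"
    if "r \<ge> 0" for r t
    using previous_tail[of "r / 2" t] that by (simp add: tail_integrable tail)
  have tails_int: "integrable M (\<lambda>\<omega>. 4 * tail_square (r / 2) (previous_size (walk \<omega>) t) + 4 * tail_square (r / 2) (\<xi> t \<omega>))" for r t
    using previous_tail(1) tail_integrable by simp
  have "?E (\<lambda>\<omega>. (elevation L (walk \<omega>) T)\<^sup>2) \<le> ?E (\<lambda>\<omega>. 2 * L\<^sup>2 + 2 * (previous_size (walk \<omega>) T)\<^sup>2)"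
    by (intro integral_mono elevation_squared_le L) (auto simp: integrable_elevation_squared integrable_previous)
  also have "\<dots> \<le> 2 * L\<^sup>2 + 2 * V"
    using expectation_previous[of T] by (simp add: integrable_previous prob_space)
  finally have H: "?E (\<lambda>\<omega>. (elevation L (walk \<omega>) T)\<^sup>2) \<le> 2 * L\<^sup>2 + 2 * V" .
  have "(\<Sum>t<T. ?E (\<lambda>\<omega>. (reflection L (walk \<omega>) t)\<^sup>2)) \<le> (\<Sum>t<T. R * ?E (\<lambda>\<omega>. reflection L (walk \<omega>) t) + 8 * g (R / 2))"
  proof (rule sum_mono)
    fix t
    have "?E (\<lambda>\<omega>. (reflection L (walk \<omega>) t)\<^sup>2) \<le> ?E (\<lambda>\<omega>. R * reflection L (walk \<omega>) t +
        (4 * tail_square (R / 2) (previous_size (walk \<omega>) t) + 4 * tail_square (R / 2) (\<xi> t \<omega>)))"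
      by (intro integral_mono reflection_squared_le[OF L R])
         (auto simp: integrable_reflection_squared integrable_reflection previous_tail(1) tail_integrable)
    also have "\<dots> = R * ?E (\<lambda>\<omega>. reflection L (walk \<omega>) t) +
        ?E (\<lambda>\<omega>. 4 * tail_square (R / 2) (previous_size (walk \<omega>) t) + 4 * tail_square (R / 2) (\<xi> t \<omega>))"
      by (subst Bochner_Integration.integral_add) (auto simp: integrable_reflection previous_tail(1) tail_integrable)
    finally show "?E (\<lambda>\<omega>. (reflection L (walk \<omega>) t)\<^sup>2) \<le> R * ?E (\<lambda>\<omega>. reflection L (walk \<omega>) t) + 8 * g (R / 2)"
      using tails[OF R, of t] by linarith
  qed
  also have "\<dots> = R * (\<Sum>t<T. ?E (\<lambda>\<omega>. reflection L (walk \<omega>) t)) + real T * (8 * g (R / 2))"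
    by (simp add: sum.distrib sum_distrib_left)
  also have "\<dots> \<le> R * (L + 2 * real T * V / L) + real T * (8 * g (R / 2))"
    using sum_reflection_le[of T] R by (intro add_right_mono mult_left_mono)
  finally have Rf: "(\<Sum>t<T. ?E (\<lambda>\<omega>. (reflection L (walk \<omega>) t)\<^sup>2)) \<le> R * (L + 2 * real T * V / L) + real T * (8 * g (R / 2))" .
  have "(\<Sum>t<T. ?E (\<lambda>\<omega>. (overshoot L (walk \<omega>) t)\<^sup>2)) \<le>
      (\<Sum>t<T. (1 + \<delta>)\<^sup>2 * L\<^sup>2 * ?E (\<lambda>\<omega>. real (completions L (walk \<omega>) (Suc t)) - real (completions L (walk \<omega>) t))
         + (1 + 1 / \<delta>)\<^sup>2 * (8 * g (\<delta> * L / 2)))"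
  proof (rule sum_mono)
    fix t
    have "?E (\<lambda>\<omega>. (overshoot L (walk \<omega>) t)\<^sup>2) \<le> ?E (\<lambda>\<omega>. (1 + \<delta>)\<^sup>2 * L\<^sup>2 * (real (completions L (walk \<omega>) (Suc t)) - real (completions L (walk \<omega>) t))
      + (1 + 1 / \<delta>)\<^sup>2 * (4 * tail_square (\<delta> * L / 2) (previous_size (walk \<omega>) t) + 4 * tail_square (\<delta> * L / 2) (\<xi> t \<omega>)))"
      by (intro integral_mono overshoot_squared_le[OF L \<delta>])
         (auto simp: integrable_overshoot_squared integrable_completions previous_tail(1) tail_integrable)
    also have "\<dots> = (1 + \<delta>)\<^sup>2 * L\<^sup>2 * ?E (\<lambda>\<omega>. real (completions L (walk \<omega>) (Suc t)) - real (completions L (walk \<omega>) t))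
      + (1 + 1 / \<delta>)\<^sup>2 * ?E (\<lambda>\<omega>. 4 * tail_square (\<delta> * L / 2) (previous_size (walk \<omega>) t) + 4 * tail_square (\<delta> * L / 2) (\<xi> t \<omega>))"
      by (subst Bochner_Integration.integral_add)
         (auto simp: integrable_completions previous_tail(1) tail_integrable simp del: Bochner_Integration.integral_diff Bochner_Integration.integral_add)
    also have "\<dots> \<le> (1 + \<delta>)\<^sup>2 * L\<^sup>2 * ?E (\<lambda>\<omega>. real (completions L (walk \<omega>) (Suc t)) - real (completions L (walk \<omega>) t))
      + (1 + 1 / \<delta>)\<^sup>2 * (8 * g (\<delta> * L / 2))"
      using \<delta> L by (intro add_left_mono mult_left_mono tails) auto
    finally show "?E (\<lambda>\<omega>. (overshoot L (walk \<omega>) t)\<^sup>2) \<le> \<dots>" .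
  qed
  also have "\<dots> = (1 + \<delta>)\<^sup>2 * L\<^sup>2 * ?E (\<lambda>\<omega>. real (completions L (walk \<omega>) T)) + real T * ((1 + 1 / \<delta>)\<^sup>2 * (8 * g (\<delta> * L / 2)))"
    unfolding completions_telescope by (simp add: sum.distrib sum_distrib_left)
  finally show ?thesis using expectation_elevation_squared[of T] H Rf by linarith
qed

end

end

section \<open>The expected spectral measure as a uniform limit\<close>

lemma (in prob_space) indep_vars_reindex:
  assumes "indep_vars M' X I" and f: "inj_on f J" "f ` J \<subseteq> I"
  shows "indep_vars (\<lambda>j. M' (f j)) (\<lambda>j. X (f j)) J"
proof -
  have "indep_vars (\<lambda>j. PiM {f j} M') (\<lambda>j \<omega>. restrict (\<lambda>i. X i \<omega>) {f j}) J"
    by (rule indep_vars_restrict[OF assms(1)]) (use f in \<open>auto simp: disjoint_family_on_def inj_on_def\<close>)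
  then have "indep_vars (\<lambda>j. M' (f j)) (\<lambda>j \<omega>. (restrict (\<lambda>i. X i \<omega>) {f j}) (f j)) J"
    by (rule indep_vars_compose2) (auto intro: measurable_component_singleton)
  then show ?thesis by simp
qed

lemma half_power_Cauchy:
  fixes f :: "nat \<Rightarrow> real"
  assumes step: "\<And>k. \<bar>f (Suc k) - f k\<bar> \<le> (1/2) ^ Suc k"
  shows "\<exists>l. f \<longlonglongrightarrow> l \<and> (\<forall>k. \<bar>f k - l\<bar> \<le> (1/2) ^ k)"
proof -
  have "(\<lambda>k. (1/2) ^ k) \<longlonglongrightarrow> (0::real)" by (rule LIMSEQ_power_zero) simp
  have inc: "incseq (\<lambda>k. f k - (1/2) ^ k)"
  proof (rule incseq_SucI)
    show "f k - (1/2) ^ k \<le> f (Suc k) - (1/2) ^ Suc k" for k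
      using step[of k] unfolding abs_le_iff by simp
  qed
  have dec: "decseq (\<lambda>k. f k + (1/2) ^ k)"
  proof (rule decseq_SucI)
    show "f (Suc k) + (1/2) ^ Suc k \<le> f k + (1/2) ^ k" for k
      using step[of k] unfolding abs_le_iff by simp
  qed
  have bdd: "f k - (1/2) ^ k \<le> f 0 + 1" for k
  proof -
    have "f k - (1/2) ^ k \<le> f k + (1/2) ^ k" by simp
    also have "\<dots> \<le> f 0 + (1/2) ^ 0" using decseqD[OF dec, of 0 k] by simp
    finally show ?thesis by simp
  qed
  obtain l where l: "(\<lambda>k. f k - (1/2) ^ k) \<longlonglongrightarrow> l" "\<forall>k. f k - (1/2) ^ k \<le> l"
    using incseq_convergent[OF inc, of "f 0 + 1"] bdd by blast
  have fl: "f \<longlonglongrightarrow> l" using tendsto_add[OF l(1) \<open>(\<lambda>k. (1/2) ^ k) \<longlonglongrightarrow> 0\<close>] by simp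
  have l2: "(\<lambda>k. f k + (1/2) ^ k) \<longlonglongrightarrow> l" using tendsto_add[OF fl \<open>(\<lambda>k. (1/2) ^ k) \<longlonglongrightarrow> 0\<close>] by simp
  have "\<bar>f k - l\<bar> \<le> (1/2) ^ k" for k
    using l(2) decseq_ge[OF dec l2, of k] by (auto simp: abs_le_iff algebra_simps)
  with fl show ?thesis by blast
qed

lemma tendsto_uniform_approx:
  fixes f :: "nat \<Rightarrow> 'a \<Rightarrow> real"
  assumes "\<And>k. (f k \<longlongrightarrow> c k) G" "\<And>k x. \<bar>f k x - h x\<bar> \<le> (1/2) ^ k" "\<And>k. \<bar>c k - d\<bar> \<le> (1/2) ^ k"
  shows "(h \<longlongrightarrow> d) G"
proof (rule tendstoI)
  fix e :: real assume "e > 0"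
  then obtain k where k: "(1/2) ^ k < e / 3" using real_arch_pow_inv[of "e / 3" "1/2"] by auto
  have "eventually (\<lambda>x. dist (f k x) (c k) < e / 3) G"
    using assms(1)[of k] \<open>e > 0\<close> by (intro tendstoD) auto
  then show "eventually (\<lambda>x. dist (h x) d < e) G"
  proof eventually_elim
    case (elim x)
    then show ?case using assms(2)[of k x] assms(3)[of k] k unfolding dist_real_def by linarith
  qed
qed

text \<open>
  Two right-continuous functions that agree at all continuity points of one of them agree everywhere,
  as these points are dense.
\<close>

lemma weak_limit_cdf_unique:
  assumes F: "real_distribution \<mu>" and \<nu>: "real_distribution \<nu>"
    and conv: "\<And>x. (\<lambda>k. cdf (\<rho> k) x) \<longlonglongrightarrow> cdf \<mu> x" and weak: "weak_conv_m \<rho> \<nu>"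
  shows "\<nu> = \<mu>"
proof (rule cdf_unique[OF \<nu> F], rule ext)
  interpret m: real_distribution \<mu> by fact
  interpret n: real_distribution \<nu> by fact
  fix x
  have "mono (cdf \<nu>)" by (auto intro: monoI n.cdf_nondecreasing)
  then have ctble: "countable {y. \<not> isCont (cdf \<nu>) y}" by (rule mono_ctble_discont)
  have eq: "cdf \<nu> y = cdf \<mu> y" if "isCont (cdf \<nu>) y" for y
    using weak that conv LIMSEQ_unique unfolding weak_conv_m_def weak_conv_def by blast
  have "((\<lambda>y. cdf \<nu> y - cdf \<mu> y) \<longlongrightarrow> cdf \<nu> x - cdf \<mu> x) (at_right x)"
    using n.cdf_is_right_cont[of x] m.cdf_is_right_cont[of x] unfolding continuous_within by (intro tendsto_diff)
  moreover have "frequently (\<lambda>y. cdf \<nu> y - cdf \<mu> y = 0) (at_right x)"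
    unfolding frequently_def
  proof
    assume "eventually (\<lambda>y. \<not> cdf \<nu> y - cdf \<mu> y = 0) (at_right x)"
    then obtain b where b: "b > x" "\<And>y. x < y \<Longrightarrow> y < b \<Longrightarrow> cdf \<nu> y - cdf \<mu> y \<noteq> 0"
      by (auto simp: eventually_at_right_field)
    have "{x<..<b} \<subseteq> {y. \<not> isCont (cdf \<nu>) y}"
    proof
      fix y assume "y \<in> {x<..<b}"
      then have "cdf \<nu> y \<noteq> cdf \<mu> y" using b(2)[of y] by auto
      then show "y \<in> {y. \<not> isCont (cdf \<nu>) y}" using eq by auto
    qed
    then have "countable {x<..<b}" using ctble countable_subset by blast
    then show False using b(1) uncountable_open_interval by blast
  qed
  ultimately have "cdf \<nu> x - cdf \<mu> x = 0"
    using tendsto_imp_eventually_ne[of "\<lambda>y. cdf \<nu> y - cdf \<mu> y" "cdf \<nu> x - cdf \<mu> x" "at_right x" 0]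
    unfolding frequently_def by blast
  then show "cdf \<nu> x = cdf \<mu> x" by simp
qed

lemma measurable_eigenvalue_count_upper:
  "(\<lambda>b :: int \<Rightarrow> real. eigenvalue_count N (\<lambda>i. b (int i + 1)) {c<..}) \<in> measurable borel (count_space UNIV)"
proof (subst measurable_count_space_eq2_countable, intro conjI ballI)
  fix r :: nat
  let ?f = "\<lambda>b :: int \<Rightarrow> real. eigenvalue_count N (\<lambda>i. b (int i + 1)) {c<..}"
  have "?f -` {r} \<inter> space borel = {b. r \<le> ?f b} - {b. Suc r \<le> ?f b}" by auto
  also have "\<dots> \<in> sets borel" using open_eigenvalue_count_ge by (intro sets.Diff borel_open)
  finally show "?f -` {r} \<inter> space borel \<in> sets borel" .
qed auto

lemma measurable_eigenvalue_count:
  "(\<lambda>b :: int \<Rightarrow> real. real (eigenvalue_count N (\<lambda>i. b (int i + 1)) {..c})) \<in> borel_measurable borel"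
proof -
  have "real (eigenvalue_count N (\<lambda>i. b (int i + 1)) {..c}) = real N - real (eigenvalue_count N (\<lambda>i. b (int i + 1)) {c<..})"
    for b :: "int \<Rightarrow> real"
    using eigenvalue_count_complement[of N "\<lambda>i. b (int i + 1)" c] by linarith
  moreover have "(\<lambda>b :: int \<Rightarrow> real. real N - real (eigenvalue_count N (\<lambda>i. b (int i + 1)) {c<..})) \<in> borel_measurable borel"
    using measurable_eigenvalue_count_upper[of N c] by measurable
  ultimately show ?thesis by simp
qed

lemma eigenvalue_count_UNIV: "eigenvalue_count N \<beta> UNIV = N"
  by (simp add: eigenvalue_count_def)

locale iid_weights = prob_space M for M :: "'s measure" +
  fixes a :: "int \<Rightarrow> 's \<Rightarrow> real"
  assumes indep: "indep_vars (\<lambda>_. borel) a UNIV"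
    and ident: "\<And>i. distr M borel (a i) = distr M borel (a 0)"
begin

lemma rv [measurable]: "a i \<in> borel_measurable M"
  using indep by (auto simp: indep_vars_def)

lemma measurable_weights: "(\<lambda>\<omega> i. a i \<omega>) \<in> borel_measurable M"
  by (rule measurable_coordinatewise_then_product) measurable

lemma expectation_ident:
  assumes [measurable]: "f \<in> borel_measurable borel"
  shows "expectation (\<lambda>\<omega>. f (a i \<omega>)) = expectation (\<lambda>\<omega>. f (a 0 \<omega>) :: real)"
proof -
  have "expectation (\<lambda>\<omega>. f (a i \<omega>)) = (\<integral>x. f x \<partial>distr M borel (a i))" by (simp add: integral_distr)
  also have "\<dots> = expectation (\<lambda>\<omega>. f (a 0 \<omega>))" unfolding ident[of i] by (simp add: integral_distr)
  finally show ?thesis .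
qed

lemma integrable_ident:
  assumes [measurable]: "f \<in> borel_measurable borel" and "integrable M (\<lambda>\<omega>. f (a 0 \<omega>) :: real)"
  shows "integrable M (\<lambda>\<omega>. f (a i \<omega>))"
proof -
  have "integrable (distr M borel (a 0)) f" using assms(2) by (simp add: integrable_distr_eq)
  then have "integrable (distr M borel (a i)) f" unfolding ident[of i] .
  then show ?thesis by (simp add: integrable_distr_eq)
qed

lemma expectation_shift:
  fixes f :: "(int \<Rightarrow> real) \<Rightarrow> real"
  assumes f: "f \<in> borel_measurable borel"
  shows "expectation (\<lambda>\<omega>. f (\<lambda>i. a (i + s) \<omega>)) = expectation (\<lambda>\<omega>. f (\<lambda>i. a i \<omega>))"
proof -
  let ?P = "\<Pi>\<^sub>M i\<in>(UNIV::int set). (borel :: real measure)"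
  have marginal: "(\<lambda>i. distr M borel (a (f i))) = (\<lambda>i. distr M borel (a 0))" for f :: "int \<Rightarrow> int"
    using ident by auto
  have law: "distr M ?P (\<lambda>\<omega> i. a i \<omega>) = (\<Pi>\<^sub>M i\<in>(UNIV::int set). distr M borel (a 0))"
    using indep_vars_iff_distr_eq_PiM[of UNIV a "\<lambda>_. borel"] indep marginal[of "\<lambda>i. i"] by (simp add: restrict_def)
  have "indep_vars (\<lambda>_. borel) (\<lambda>i. a (i + s)) UNIV"
    using indep_vars_reindex[OF indep, of "\<lambda>i. i + s" UNIV] by simp
  then have law': "distr M ?P (\<lambda>\<omega> i. a (i + s) \<omega>) = (\<Pi>\<^sub>M i\<in>(UNIV::int set). distr M borel (a 0))"
    using indep_vars_iff_distr_eq_PiM[of UNIV "\<lambda>i. a (i + s)" "\<lambda>_. borel"] marginal[of "\<lambda>i. i + s"]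
    by (simp add: restrict_def)
  have fP: "f \<in> borel_measurable ?P" using f by (subst measurable_cong_sets[OF sets_PiM_equal_borel refl])
  have m: "(\<lambda>\<omega> i. a (i + s) \<omega>) \<in> measurable M ?P" "(\<lambda>\<omega> i. a i \<omega>) \<in> measurable M ?P"
    using measurable_restrict[of UNIV "\<lambda>i. a (i + s)" M "\<lambda>_. borel"] measurable_restrict[of UNIV a M "\<lambda>_. borel"]
    by (simp_all add: restrict_def)
  have "expectation (\<lambda>\<omega>. f (\<lambda>i. a (i + s) \<omega>)) = (\<integral>b. f b \<partial>distr M ?P (\<lambda>\<omega> i. a (i + s) \<omega>))"
    by (rule integral_distr[OF m(1) fP, symmetric])
  also have "\<dots> = (\<integral>b. f b \<partial>distr M ?P (\<lambda>\<omega> i. a i \<omega>))" unfolding law law' ..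
  also have "\<dots> = expectation (\<lambda>\<omega>. f (\<lambda>i. a i \<omega>))" by (rule integral_distr[OF m(2) fP])
  finally show ?thesis .
qed

abbreviation weights :: "'s \<Rightarrow> nat \<Rightarrow> real" where
  "weights \<omega> \<equiv> (\<lambda>i. a (int i + 1) \<omega>)"

abbreviation random_op :: "'s \<Rightarrow> (int \<Rightarrow> real) \<Rightarrow> int \<Rightarrow> real" where
  "random_op \<omega> \<equiv> schroedinger_op (\<lambda>i. a i \<omega>)"

lemma measurable_count [measurable]: "(\<lambda>\<omega>. real (eigenvalue_count N (weights \<omega>) {..c})) \<in> borel_measurable M"
  using measurable_compose[OF measurable_weights measurable_eigenvalue_count[of N c]] by simp

lemma integrable_count: "integrable M (\<lambda>\<omega>. real (eigenvalue_count N (weights \<omega>) {..c}))"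
  by (rule integrable_const_bound[of _ "real N"]) (auto simp: eigenvalue_count_le)

lemma measurable_empirical:
  "(\<lambda>\<omega>. empirical_eigenvalue_distr (restrict_op (random_op \<omega>) n)) \<in> measurable M (subprob_algebra borel)"
proof (rule measurable_subprob_algebra_generated)
  show "sets (borel :: real measure) = sigma_sets UNIV (range atMost)"
    by (subst borel_eq_atMost) simp
  show "Int_stable (range atMost :: real set set)" by (auto simp: Int_stable_def)
  show "(\<lambda>\<omega>. emeasure (empirical_eigenvalue_distr (restrict_op (random_op \<omega>) n)) A) \<in> borel_measurable M"
    if "A \<in> range atMost" for A
    using that measurable_count[of "n + 1"] by (auto simp: empirical_eigenvalue_distr_schroedinger_op)
  show "(\<lambda>\<omega>. emeasure (empirical_eigenvalue_distr (restrict_op (random_op \<omega>) n)) UNIV) \<in> borel_measurable M"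
    by (simp add: empirical_eigenvalue_distr_schroedinger_op eigenvalue_count_UNIV)
  show "subprob_space (empirical_eigenvalue_distr (restrict_op (random_op \<omega>) n))" for \<omega>
  proof (rule subprob_spaceI)
    have "space (empirical_eigenvalue_distr (restrict_op (random_op \<omega>) n)) = UNIV"
      by (simp add: empirical_eigenvalue_distr_def)
    then show "emeasure (empirical_eigenvalue_distr (restrict_op (random_op \<omega>) n))
        (space (empirical_eigenvalue_distr (restrict_op (random_op \<omega>) n))) \<le> 1"
      by (simp add: empirical_eigenvalue_distr_schroedinger_op eigenvalue_count_UNIV)
    show "space (empirical_eigenvalue_distr (restrict_op (random_op \<omega>) n)) \<noteq> {}"
      by (simp add: empirical_eigenvalue_distr_def)
  qed
qed (auto simp: empirical_eigenvalue_distr_def)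

definition counting :: "nat \<Rightarrow> real \<Rightarrow> real" where
  "counting N x = expectation (\<lambda>\<omega>. real (eigenvalue_count N (weights \<omega>) {..x})) / real N"

lemma expected_empirical_distr_facts:
  shows "real_distribution (expected_empirical_distr M random_op n)"
    and "cdf (expected_empirical_distr M random_op n) = counting (n + 1)"
proof -
  let ?\<mu> = "expected_empirical_distr M random_op n"
  have em: "emeasure ?\<mu> B = (\<integral>\<^sup>+\<omega>. ennreal (real (eigenvalue_count (n + 1) (weights \<omega>) B) / real (n + 1)) \<partial>M)"
    if "B \<in> sets borel" for B
    unfolding expected_empirical_distr_def
    by (subst emeasure_bind[OF not_empty measurable_empirical that])
       (simp add: empirical_eigenvalue_distr_schroedinger_op[OF that])
  have sets: "sets ?\<mu> = sets borel"
    unfolding expected_empirical_distr_def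
    by (rule sets_bind) (auto simp: empirical_eigenvalue_distr_def not_empty)
  then have sp: "space ?\<mu> = UNIV" using sets_eq_imp_space_eq[OF sets] by simp
  have "emeasure ?\<mu> (space ?\<mu>) = 1"
    unfolding sp using em[of UNIV] by (simp add: eigenvalue_count_UNIV emeasure_space_1)
  then have "prob_space ?\<mu>" by (rule prob_spaceI)
  with sets show rd: "real_distribution ?\<mu>"
    by (simp add: real_distribution_def real_distribution_axioms_def)
  show "cdf ?\<mu> = counting (n + 1)"
  proof
    fix x
    have "emeasure ?\<mu> {..x} = ennreal (expectation (\<lambda>\<omega>. real (eigenvalue_count (n + 1) (weights \<omega>) {..x}) / real (n + 1)))"
      using integrable_count[of "n + 1" x]
      by (subst em, simp, intro nn_integral_eq_integral) (auto intro!: Bochner_Integration.integrable_divide)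
    also have "expectation (\<lambda>\<omega>. real (eigenvalue_count (n + 1) (weights \<omega>) {..x}) / real (n + 1)) = counting (n + 1) x"
      by (simp add: counting_def)
    finally have "measure ?\<mu> {..x} = counting (n + 1) x"
      unfolding measure_def by (simp add: counting_def integral_nonneg_AE)
    then show "cdf ?\<mu> x = counting (n + 1) x" by (simp add: cdf_def)
  qed
qed

text \<open>
  The two halves of a matrix have the same law, and cutting between them changes the count by at
  most \<open>1\<close> out of \<open>2 * N\<close>.
\<close>

lemma counting_double:
  assumes N: "0 < N"
  shows "\<bar>counting (2 * N) x - counting N x\<bar> \<le> 1 / (2 * real N)"
proof -
  let ?c = "\<lambda>\<omega>. real (eigenvalue_count N (weights \<omega>) {..x})"
  let ?c' = "\<lambda>\<omega>. real (eigenvalue_count N (\<lambda>i. a (int i + 1 + int N) \<omega>) {..x})"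
  let ?d = "\<lambda>\<omega>. real (eigenvalue_count (2 * N) (weights \<omega>) {..x})"
  have shift: "expectation ?c' = expectation ?c"
    by (rule expectation_shift[OF measurable_eigenvalue_count])
  have [measurable]: "(\<lambda>\<omega> i. a (i + int N) \<omega>) \<in> borel_measurable M"
    by (rule measurable_coordinatewise_then_product) measurable
  have "?c' \<in> borel_measurable M"
    using measurable_compose[OF \<open>(\<lambda>\<omega> i. a (i + int N) \<omega>) \<in> borel_measurable M\<close> measurable_eigenvalue_count[of N x]] by simp
  then have int: "integrable M ?c'"
    by (intro integrable_const_bound[of _ "real N"]) (auto simp: eigenvalue_count_le)
  have cut: "\<bar>?d \<omega> - (?c \<omega> + ?c' \<omega>)\<bar> \<le> 1" for \<omega>
    using eigenvalue_count_cut[OF N, of N "weights \<omega>" x] by (simp add: mult_2 add_ac)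
  have "\<bar>expectation (\<lambda>\<omega>. ?d \<omega> - (?c \<omega> + ?c' \<omega>))\<bar> \<le> expectation (\<lambda>\<omega>. \<bar>?d \<omega> - (?c \<omega> + ?c' \<omega>)\<bar>)"
    by (rule integral_abs_bound)
  also have "\<dots> \<le> expectation (\<lambda>\<omega>. 1)"
    by (intro integral_mono cut) (auto intro!: integrable_count int Bochner_Integration.integrable_diff Bochner_Integration.integrable_add)
  finally have "\<bar>expectation ?d - 2 * expectation ?c\<bar> \<le> 1"
    using integrable_count[of "2 * N" x] integrable_count[of N x] int by (simp add: shift prob_space)
  moreover have "counting (2 * N) x - counting N x = (expectation ?d - 2 * expectation ?c) / (2 * real N)"
    using N by (simp add: counting_def field_simps)
  ultimately show ?thesis using N by (simp add: divide_right_mono)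
qed

text \<open>
  The distribution functions along powers of two form a uniform Cauchy sequence, and a uniform limit of
  distribution functions is again one. This yields both the existence of the weak limit and the
  rate of approximation.
\<close>

lemma expected_spectral_measure_approx:
  defines "\<mu> \<equiv> expected_spectral_measure M random_op"
  shows "real_distribution \<mu>" and "\<bar>counting (2 ^ k) x - cdf \<mu> x\<bar> \<le> (1/2) ^ k"
proof -
  let ?\<rho> = "\<lambda>k. expected_empirical_distr M random_op (2 ^ k - 1)"
  have rd: "real_distribution (?\<rho> k)" and cdf: "cdf (?\<rho> k) = counting (2 ^ k)" for k
    using expected_empirical_distr_facts[of "2 ^ k - 1"] by simp_all
  have "\<bar>counting (2 ^ Suc k) x - counting (2 ^ k) x\<bar> \<le> (1/2) ^ Suc k" for k x
    using counting_double[of "2 ^ k" x] by (simp add: power_one_over)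
  then have "\<forall>x. \<exists>l. (\<lambda>k. counting (2 ^ k) x) \<longlonglongrightarrow> l \<and> (\<forall>k. \<bar>counting (2 ^ k) x - l\<bar> \<le> (1/2) ^ k)"
    by (intro allI half_power_Cauchy)
  then obtain F where F: "\<And>x. (\<lambda>k. counting (2 ^ k) x) \<longlonglongrightarrow> F x" "\<And>x k. \<bar>counting (2 ^ k) x - F x\<bar> \<le> (1/2) ^ k"
    by metis
  have mono: "F x \<le> F y" if "x \<le> y" for x y
  proof (rule LIMSEQ_le[OF F(1) F(1)])
    interpret r: real_distribution "?\<rho> k" for k by (rule rd)
    show "\<exists>N. \<forall>n\<ge>N. counting (2 ^ n) x \<le> counting (2 ^ n) y"
      using r.cdf_nondecreasing[OF that] unfolding cdf by blast
  qed
  have rc: "continuous (at_right x) F" for x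
    unfolding continuous_within
  proof (rule tendsto_uniform_approx[of "\<lambda>k. counting (2 ^ k)" "\<lambda>k. counting (2 ^ k) x"])
    interpret r: real_distribution "?\<rho> k" for k by (rule rd)
    show "(counting (2 ^ k) \<longlongrightarrow> counting (2 ^ k) x) (at_right x)" for k
      using r.cdf_is_right_cont unfolding cdf continuous_within by blast
  qed (use F in auto)
  have bot: "(F \<longlongrightarrow> 0) at_bot"
  proof (rule tendsto_uniform_approx[of "\<lambda>k. counting (2 ^ k)" "\<lambda>k. 0"])
    interpret r: real_distribution "?\<rho> k" for k by (rule rd)
    show "(counting (2 ^ k) \<longlongrightarrow> 0) at_bot" for k
      using r.cdf_lim_at_bot unfolding cdf .
  qed (use F in auto)
  have top: "(F \<longlongrightarrow> 1) at_top"
  proof (rule tendsto_uniform_approx[of "\<lambda>k. counting (2 ^ k)" "\<lambda>k. 1"])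
    interpret r: real_distribution "?\<rho> k" for k by (rule rd)
    show "(counting (2 ^ k) \<longlongrightarrow> 1) at_top" for k
      using r.cdf_lim_at_top_prob unfolding cdf .
  qed (use F in auto)
  let ?m = "interval_measure F"
  have rdm: "real_distribution ?m" by (rule real_distribution_interval_measure[OF mono rc bot top])
  have cm: "cdf ?m = F" by (rule cdf_interval_measure[OF mono rc bot])
  have "\<mu> = ?m"
    unfolding \<mu>_def expected_spectral_measure_def
  proof (rule the_equality)
    show "real_distribution ?m \<and> weak_conv_m ?\<rho> ?m"
      using rdm F(1) unfolding weak_conv_m_def weak_conv_def cm cdf by blast
    show "\<nu> = ?m" if "real_distribution \<nu> \<and> weak_conv_m ?\<rho> \<nu>" for \<nu>
      using weak_limit_cdf_unique[OF rdm, of \<nu> ?\<rho>] that F(1) unfolding cm cdf by blast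
  qed
  then show "real_distribution \<mu>" "\<bar>counting (2 ^ k) x - cdf \<mu> x\<bar> \<le> (1/2) ^ k"
    using rdm F(2) by (simp_all add: cm)
qed

lemma counting_diff:
  assumes "x \<le> y"
  shows "counting N y - counting N x = expectation (\<lambda>\<omega>. real (eigenvalue_count N (weights \<omega>) {x<..y})) / real N"
proof -
  have "{..y} = {..x} \<union> {x<..y}" "{..x} \<inter> {x<..y} = {}" using assms by auto
  then have *: "real (eigenvalue_count N (weights \<omega>) {x<..y}) = real (eigenvalue_count N (weights \<omega>) {..y}) - real (eigenvalue_count N (weights \<omega>) {..x})" for \<omega>
    using eigenvalue_count_Un by simp
  show ?thesis unfolding * counting_def by (simp add: integrable_count diff_divide_distrib)
qed

text \<open>
  Doubling \<open>\<epsilon>\<close> turns the half-open interval of the distribution functions into an open one; on the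
  logarithmic scale this is invisible.
\<close>

lemma spectral_measure_le:
  fixes \<epsilon> :: real and h :: "'s \<Rightarrow> real"
  assumes "\<epsilon> > 0" and h: "integrable M h" "AE \<omega> in M. real (eigenvalue_count (2 ^ k) (weights \<omega>) {- (2 * \<epsilon>)<..<2 * \<epsilon>}) \<le> h \<omega>"
  shows "measure (expected_spectral_measure M random_op) {- \<epsilon><..<\<epsilon>} \<le> (expectation h + 2) / 2 ^ k"
proof -
  let ?\<mu> = "expected_spectral_measure M random_op"
  interpret m: real_distribution ?\<mu> by (rule expected_spectral_measure_approx)
  have "measure ?\<mu> {- \<epsilon><..<\<epsilon>} \<le> measure ?\<mu> {- \<epsilon><..\<epsilon>}"
    by (rule m.finite_measure_mono) auto
  also have "\<dots> = cdf ?\<mu> \<epsilon> - cdf ?\<mu> (- \<epsilon>)"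
    using assms(1) m.cdf_diff_eq[of "- \<epsilon>" \<epsilon>] by simp
  also have "\<dots> \<le> counting (2 ^ k) \<epsilon> - counting (2 ^ k) (- \<epsilon>) + 2 * (1/2) ^ k"
    using expected_spectral_measure_approx(2)[of k \<epsilon>] expected_spectral_measure_approx(2)[of k "- \<epsilon>"] by linarith
  also have "counting (2 ^ k) \<epsilon> - counting (2 ^ k) (- \<epsilon>) = expectation (\<lambda>\<omega>. real (eigenvalue_count (2 ^ k) (weights \<omega>) {- \<epsilon><..\<epsilon>})) / real (2 ^ k)"
    using assms(1) by (intro counting_diff) auto
  also have "expectation (\<lambda>\<omega>. real (eigenvalue_count (2 ^ k) (weights \<omega>) {- \<epsilon><..\<epsilon>})) \<le> expectation h"
  proof (rule integral_mono_AE'[OF h(1)])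
    have le: "eigenvalue_count (2 ^ k) (weights \<omega>) {- \<epsilon><..\<epsilon>} \<le> eigenvalue_count (2 ^ k) (weights \<omega>) {- (2 * \<epsilon>)<..<2 * \<epsilon>}" for \<omega>
      by (rule eigenvalue_count_mono) (use assms(1) in auto)
    from h(2) show "AE \<omega> in M. real (eigenvalue_count (2 ^ k) (weights \<omega>) {- \<epsilon><..\<epsilon>}) \<le> h \<omega>"
      by eventually_elim (rule order_trans[OF of_nat_mono[OF le]])
    from h(2) show "AE \<omega> in M. 0 \<le> h \<omega>"
      by eventually_elim (rule order_trans[OF of_nat_0_le_iff])
  qed
  finally show ?thesis by (simp add: divide_right_mono power_one_over add_divide_distrib)
qed

lemma spectral_measure_ge:
  fixes \<epsilon> :: real and h :: "'s \<Rightarrow> real"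
  assumes "\<epsilon> > 0" and h: "integrable M h" "AE \<omega> in M. h \<omega> \<le> real (eigenvalue_count (2 ^ k) (weights \<omega>) {- (\<epsilon> / 2)<..<\<epsilon> / 2})"
  shows "measure (expected_spectral_measure M random_op) {- \<epsilon><..<\<epsilon>} \<ge> (expectation h - 2) / 2 ^ k"
proof -
  let ?\<mu> = "expected_spectral_measure M random_op"
  interpret m: real_distribution ?\<mu> by (rule expected_spectral_measure_approx)
  have diff: "real (eigenvalue_count (2 ^ k) (weights \<omega>) {- \<epsilon><..\<epsilon> / 2}) =
    real (eigenvalue_count (2 ^ k) (weights \<omega>) {..\<epsilon> / 2}) - real (eigenvalue_count (2 ^ k) (weights \<omega>) {..- \<epsilon>})" for \<omega>
  proof -
    have "{..\<epsilon> / 2} = {..- \<epsilon>} \<union> {- \<epsilon><..\<epsilon> / 2}" using assms(1) by auto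
    moreover have "{..- \<epsilon>} \<inter> {- \<epsilon><..\<epsilon> / 2} = {}" by auto
    ultimately show ?thesis using eigenvalue_count_Un by simp
  qed
  have int: "integrable M (\<lambda>\<omega>. real (eigenvalue_count (2 ^ k) (weights \<omega>) {- \<epsilon><..\<epsilon> / 2}))"
    unfolding diff by (intro Bochner_Integration.integrable_diff integrable_count)
  have "expectation h \<le> expectation (\<lambda>\<omega>. real (eigenvalue_count (2 ^ k) (weights \<omega>) {- \<epsilon><..\<epsilon> / 2}))"
  proof (rule integral_mono_AE[OF h(1) int])
    have le: "eigenvalue_count (2 ^ k) (weights \<omega>) {- (\<epsilon> / 2)<..<\<epsilon> / 2} \<le> eigenvalue_count (2 ^ k) (weights \<omega>) {- \<epsilon><..\<epsilon> / 2}" for \<omega>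
      by (rule eigenvalue_count_mono) (use assms(1) in auto)
    from h(2) show "AE \<omega> in M. h \<omega> \<le> real (eigenvalue_count (2 ^ k) (weights \<omega>) {- \<epsilon><..\<epsilon> / 2})"
      by eventually_elim (erule order_trans, rule of_nat_mono[OF le])
  qed
  then have "expectation h / 2 ^ k \<le> counting (2 ^ k) (\<epsilon> / 2) - counting (2 ^ k) (- \<epsilon>)"
    using assms(1) by (subst counting_diff) (auto intro: divide_right_mono)
  also have "\<dots> \<le> cdf ?\<mu> (\<epsilon> / 2) - cdf ?\<mu> (- \<epsilon>) + 2 * (1/2) ^ k"
    using expected_spectral_measure_approx(2)[of k "\<epsilon> / 2"] expected_spectral_measure_approx(2)[of k "- \<epsilon>"] by linarith
  also have "cdf ?\<mu> (\<epsilon> / 2) - cdf ?\<mu> (- \<epsilon>) = measure ?\<mu> {- \<epsilon><..\<epsilon> / 2}"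
    using assms(1) m.cdf_diff_eq[of "- \<epsilon>" "\<epsilon> / 2"] by simp
  also have "\<dots> \<le> measure ?\<mu> {- \<epsilon><..<\<epsilon>}"
    by (rule m.finite_measure_mono) (use assms(1) in auto)
  finally show ?thesis by (simp add: power_one_over diff_divide_distrib)
qed

end

section \<open>Asymptotics near zero\<close>

text \<open>
  With \<open>l = - ln \<epsilon>\<close> and \<open>2\<^sup>k\<close> between \<open>l\<^sup>3\<close> and \<open>2 l\<^sup>3\<close> the terms with \<open>2\<^sup>k\<close> in the denominator are
  negligible against \<open>1 / l\<^sup>2\<close>, while \<open>L1 l\<close> and \<open>L2 l\<close>, the levels \<open>L\<close> permitted by the two
  hypotheses, differ from \<open>l\<close> by \<open>O(ln l)\<close> only.
\<close>

lemma inverse_square_log_squeeze: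
  fixes u g :: "real \<Rightarrow> real" and V m :: real
  assumes V: "V \<ge> 0" and g: "(g \<longlongrightarrow> 0) at_top" "\<And>r. g r \<ge> 0"
    and le: "\<And>\<epsilon> L k. 0 < \<epsilon> \<Longrightarrow> 0 < L \<Longrightarrow> 2 * \<epsilon> \<le> exp (m - L) / 2 ^ k \<Longrightarrow> u \<epsilon> \<le> V / L\<^sup>2 + 3 / 2 ^ k"
    and ge: "\<And>\<epsilon> L k \<delta>. 0 < \<epsilon> \<Longrightarrow> 0 < L \<Longrightarrow> 0 < \<delta> \<Longrightarrow> 2 * 2 ^ k * exp (m - L) \<le> \<epsilon> / 2 \<Longrightarrow>
      V \<le> (1 + \<delta>)\<^sup>2 * L\<^sup>2 * (u \<epsilon> + 3 / 2 ^ k) + ((3 * V + 2 * L\<^sup>2) / 2 ^ k + sqrt L * (L / 2 ^ k + 2 * V / L)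
        + 8 * g (sqrt L / 2) + (1 + 1 / \<delta>)\<^sup>2 * (8 * g (\<delta> * L / 2)))"
  shows "((\<lambda>\<epsilon>. u \<epsilon> * (ln \<epsilon>)\<^sup>2) \<longlongrightarrow> V) (at_right 0)"
proof -
  define k where "k l = nat \<lceil>log 2 (l ^ 3)\<rceil>" for l :: real
  have k: "l ^ 3 \<le> 2 ^ k l" "2 ^ k l \<le> 2 * l ^ 3" if "l \<ge> 1" for l
  proof -
    have l3: "l ^ 3 \<ge> 1" using that by simp
    have l3': "l ^ 3 > 0" using that by simp
    have nn: "0 \<le> log 2 (l ^ 3)" using l3 l3' by (subst zero_le_log_cancel_iff) auto
    then have "real (k l) = of_int \<lceil>log 2 (l ^ 3)\<rceil>" by (simp add: k_def)
    then have b: "log 2 (l ^ 3) \<le> real (k l)" "real (k l) \<le> log 2 (l ^ 3) + 1" by linarith+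
    have p: "(2::real) ^ k l = 2 powr real (k l)" by (simp add: powr_realpow)
    have q: "2 powr log 2 (l ^ 3) = l ^ 3" using l3' by (intro powr_log_cancel) auto
    show "l ^ 3 \<le> 2 ^ k l" unfolding p using b(1) by (subst q[symmetric]) simp
    have "2 powr real (k l) \<le> 2 powr (log 2 (l ^ 3) + 1)" using b(2) by simp
    then show "2 ^ k l \<le> 2 * l ^ 3" unfolding p by (simp add: powr_add q)
  qed
  define L1 where "L1 l = l + m - ln 2 - ln (2 * l ^ 3)" for l :: real
  define L2 where "L2 l = l + m + ln 4 + ln (2 * l ^ 3)" for l :: real
  have L1_pos: "eventually (\<lambda>l. 0 < L1 l) at_top" unfolding L1_def by real_asymp
  have L2_top: "filterlim L2 at_top at_top" unfolding L2_def by real_asymp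
  then have L2_pos: "eventually (\<lambda>l. 0 < L2 l) at_top" by (auto simp: filterlim_at_top_dense)
  have upper: "eventually (\<lambda>l. u (exp (- l)) * l\<^sup>2 \<le> V * (l\<^sup>2 / (L1 l)\<^sup>2) + 3 / l) at_top"
    using L1_pos eventually_ge_at_top[of 1]
  proof eventually_elim
    case (elim l)
    note kl = k[OF elim(2)]
    have pos: "2 * l ^ 3 > 0" using elim(2) by simp
    have "exp (m - L1 l) = 2 * (2 * l ^ 3) * exp (- l)"
      using pos by (simp add: L1_def exp_diff exp_add exp_minus field_simps)
    also have "\<dots> \<ge> 2 * 2 ^ k l * exp (- l)" using kl by (intro mult_right_mono mult_left_mono) auto
    finally have "2 * exp (- l) \<le> exp (m - L1 l) / 2 ^ k l" by (simp add: field_simps)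
    then have "u (exp (- l)) \<le> V / (L1 l)\<^sup>2 + 3 / 2 ^ k l" using elim by (intro le) auto
    also have "3 / 2 ^ k l \<le> 3 / l ^ 3" using kl elim(2) by (intro divide_left_mono) auto
    finally have "u (exp (- l)) * l\<^sup>2 \<le> (V / (L1 l)\<^sup>2 + 3 / l ^ 3) * l\<^sup>2" by (intro mult_right_mono) auto
    also have "\<dots> = V * (l\<^sup>2 / (L1 l)\<^sup>2) + 3 / l" using elim(2) by (simp add: field_simps power2_eq_square power3_eq_cube)
    finally show ?case .
  qed
  have lim1: "((\<lambda>l. V * (l\<^sup>2 / (L1 l)\<^sup>2) + 3 / l) \<longlongrightarrow> V) at_top"
  proof -
    have "((\<lambda>l. l\<^sup>2 / (L1 l)\<^sup>2) \<longlongrightarrow> 1) at_top" "((\<lambda>l. 3 / l) \<longlongrightarrow> (0::real)) at_top"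
      unfolding L1_def by real_asymp+
    then have "((\<lambda>l. V * (l\<^sup>2 / (L1 l)\<^sup>2) + 3 / l) \<longlongrightarrow> V * 1 + 0) at_top"
      by (intro tendsto_add tendsto_mult_left)
    then show ?thesis by simp
  qed
  define err where "err \<delta> l = (3 * V + 2 * (L2 l)\<^sup>2) / l ^ 3 + sqrt (L2 l) * (L2 l / l ^ 3 + 2 * V / L2 l)
     + 8 * g (sqrt (L2 l) / 2) + (1 + 1 / \<delta>)\<^sup>2 * (8 * g (\<delta> * L2 l / 2))" for \<delta> l
  have lower: "eventually (\<lambda>l. (V - err \<delta> l) / (1 + \<delta>)\<^sup>2 * (l\<^sup>2 / (L2 l)\<^sup>2) - 3 / l \<le> u (exp (- l)) * l\<^sup>2) at_top"
    if \<delta>: "\<delta> > 0" for \<delta>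
    using L2_pos eventually_ge_at_top[of 1]
  proof eventually_elim
    case (elim l)
    note kl = k[OF elim(2)]
    have pos: "2 * l ^ 3 > 0" using elim(2) by simp
    have l3: "l ^ 3 > 0" using elim(2) by simp
    let ?u = "u (exp (- l))" and ?n = "2 ^ k l :: real"
    have inv: "1 / ?n \<le> 1 / l ^ 3" using kl l3 by (intro divide_left_mono) auto
    have mult: "x / ?n \<le> x / l ^ 3" if "x \<ge> 0" for x
      using mult_left_mono[OF inv that] by simp
    have "2 * ?n * exp (m - L2 l) = 2 * ?n * (exp (- l) / (4 * (2 * l ^ 3)))"
      using pos by (simp add: L2_def exp_diff exp_add exp_minus field_simps)
    also have "\<dots> \<le> 2 * (2 * l ^ 3) * (exp (- l) / (4 * (2 * l ^ 3)))"
      using kl l3 by (intro mult_right_mono mult_left_mono) auto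
    also have "\<dots> = exp (- l) / 2" using elim(2) by simp
    finally have "V \<le> (1 + \<delta>)\<^sup>2 * (L2 l)\<^sup>2 * (?u + 3 / ?n) + ((3 * V + 2 * (L2 l)\<^sup>2) / ?n
        + sqrt (L2 l) * (L2 l / ?n + 2 * V / L2 l) + 8 * g (sqrt (L2 l) / 2) + (1 + 1 / \<delta>)\<^sup>2 * (8 * g (\<delta> * L2 l / 2)))"
      using elim \<delta> by (intro ge) auto
    also have "\<dots> \<le> (1 + \<delta>)\<^sup>2 * (L2 l)\<^sup>2 * (?u + 3 / l ^ 3) + err \<delta> l"
      unfolding err_def using elim V by (intro add_mono mult_left_mono mult order_refl) auto
    finally have "(V - err \<delta> l) \<le> (?u + 3 / l ^ 3) * ((1 + \<delta>)\<^sup>2 * (L2 l)\<^sup>2)" by (simp add: mult_ac)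
    moreover have "(1 + \<delta>)\<^sup>2 * (L2 l)\<^sup>2 > 0" using elim(1) \<delta> by simp
    ultimately have "(V - err \<delta> l) / ((1 + \<delta>)\<^sup>2 * (L2 l)\<^sup>2) \<le> ?u + 3 / l ^ 3"
      by (subst pos_divide_le_eq)
    then have "(V - err \<delta> l) / ((1 + \<delta>)\<^sup>2 * (L2 l)\<^sup>2) * l\<^sup>2 \<le> (?u + 3 / l ^ 3) * l\<^sup>2"
      by (intro mult_right_mono) auto
    also have "(?u + 3 / l ^ 3) * l\<^sup>2 = ?u * l\<^sup>2 + 3 / l"
      using elim(2) by (simp add: field_simps power2_eq_square power3_eq_cube)
    finally show ?case by simp
  qed
  have lim2: "((\<lambda>l. (V - err \<delta> l) / (1 + \<delta>)\<^sup>2 * (l\<^sup>2 / (L2 l)\<^sup>2) - 3 / l) \<longlongrightarrow> V / (1 + \<delta>)\<^sup>2) at_top" if \<delta>: "\<delta> > 0" for \<delta>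
  proof -
    have 1: "((\<lambda>l. l\<^sup>2 / (L2 l)\<^sup>2) \<longlongrightarrow> 1) at_top" "((\<lambda>l. 3 / l) \<longlongrightarrow> (0::real)) at_top"
      "((\<lambda>l. (3 * V + 2 * (L2 l)\<^sup>2) / l ^ 3) \<longlongrightarrow> 0) at_top"
      "((\<lambda>l. sqrt (L2 l) * (L2 l / l ^ 3 + 2 * V / L2 l)) \<longlongrightarrow> 0) at_top"
      unfolding L2_def by real_asymp+
    have f: "filterlim (\<lambda>l. sqrt (L2 l) / 2) at_top at_top" "filterlim (\<lambda>l. \<delta> * L2 l / 2) at_top at_top"
      unfolding L2_def using \<delta> by real_asymp+
    have "(err \<delta> \<longlongrightarrow> 0 + 0 + 8 * 0 + (1 + 1 / \<delta>)\<^sup>2 * (8 * 0)) at_top"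
      unfolding err_def[abs_def]
      by (intro tendsto_intros 1 filterlim_compose[OF g(1) f(1)] filterlim_compose[OF g(1) f(2)])
    then have e: "(err \<delta> \<longlongrightarrow> 0) at_top" by simp
    have "((\<lambda>l. (V - err \<delta> l) / (1 + \<delta>)\<^sup>2 * (l\<^sup>2 / (L2 l)\<^sup>2) - 3 / l) \<longlongrightarrow> (V - 0) / (1 + \<delta>)\<^sup>2 * 1 - 0) at_top"
      using \<delta> by (intro tendsto_intros 1 e) auto
    then show ?thesis by simp
  qed
  have main: "((\<lambda>l. u (exp (- l)) * l\<^sup>2) \<longlongrightarrow> V) at_top"
  proof (rule order_tendstoI)
    fix c assume "c > V"
    from order_tendstoD(2)[OF lim1 this] upper
    show "eventually (\<lambda>l. u (exp (- l)) * l\<^sup>2 < c) at_top" by eventually_elim linarith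
  next
    fix c assume c: "c < V"
    have "((\<lambda>\<delta>. V / (1 + \<delta>)\<^sup>2) \<longlongrightarrow> V / (1 + 0)\<^sup>2) (at_right 0)"
      by (intro tendsto_intros) auto
    then have "eventually (\<lambda>\<delta>. c < V / (1 + \<delta>)\<^sup>2) (at_right 0)" using c by (intro order_tendstoD(1)[where y = V]) simp_all
    moreover have "eventually (\<lambda>\<delta>::real. 0 < \<delta>) (at_right 0)" by (rule eventually_at_right_less)
    ultimately have "eventually (\<lambda>\<delta>. c < V / (1 + \<delta>)\<^sup>2 \<and> 0 < \<delta>) (at_right 0)" by (rule eventually_conj)
    then obtain \<delta> where \<delta>: "c < V / (1 + \<delta>)\<^sup>2" "0 < \<delta>"
      using eventually_happens'[of "at_right (0::real)"] by auto
    from order_tendstoD(1)[OF lim2[OF \<delta>(2)] \<delta>(1)] lower[OF \<delta>(2)]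
    show "eventually (\<lambda>l. c < u (exp (- l)) * l\<^sup>2) at_top" by eventually_elim linarith
  qed
  have "filterlim (\<lambda>\<epsilon>::real. - ln \<epsilon>) at_top (at_right 0)" by real_asymp
  from filterlim_compose[OF main this]
  have "((\<lambda>\<epsilon>. u (exp (- (- ln \<epsilon>))) * (- ln \<epsilon>)\<^sup>2) \<longlongrightarrow> V) (at_right 0)" .
  then show ?thesis
  proof (rule Lim_transform_eventually)
    show "eventually (\<lambda>\<epsilon>. u (exp (- (- ln \<epsilon>))) * (- ln \<epsilon>)\<^sup>2 = u \<epsilon> * (ln \<epsilon>)\<^sup>2) (at_right 0)"
      using eventually_at_right_less[of 0] by eventually_elim simp
  qed
qed

primrec log_weight :: "(nat \<Rightarrow> real) \<Rightarrow> nat \<Rightarrow> real" where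
  "log_weight \<xi> 0 = 0"
| "log_weight \<xi> (Suc t) = - log_weight \<xi> t - \<xi> t"

lemma zero_energy_weights_log_weight:
  assumes "\<And>t. \<beta> t \<noteq> 0"
  shows "zero_energy_weights \<beta> (log_weight (\<lambda>t. ln \<bar>\<beta> t\<bar> - m)) m"
proof
  fix t
  show "\<bar>\<beta> t\<bar> * (exp (log_weight (\<lambda>t. ln \<bar>\<beta> t\<bar> - m) t) * exp (log_weight (\<lambda>t. ln \<bar>\<beta> t\<bar> - m) (Suc t))) = exp m"
    unfolding log_weight.simps exp_add[symmetric] using assms[of t] by (simp add: exp_diff)
qed

lemma (in prob_space) tail_square_expectation_tendsto:
  assumes [measurable]: "X \<in> borel_measurable M" and int: "integrable M (\<lambda>\<omega>. (X \<omega>)\<^sup>2)"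
  shows "((\<lambda>r. expectation (\<lambda>\<omega>. tail_square r (X \<omega>))) \<longlongrightarrow> 0) at_top"
proof -
  have "((\<lambda>r. expectation (\<lambda>\<omega>. tail_square r (X \<omega>))) \<longlongrightarrow> expectation (\<lambda>\<omega>. 0)) at_top"
  proof (rule integral_dominated_convergence_at_top)
    show "AE \<omega> in M. ((\<lambda>r. tail_square r (X \<omega>)) \<longlongrightarrow> 0) at_top"
    proof (rule AE_I2)
      fix \<omega>
      have "eventually (\<lambda>r. tail_square r (X \<omega>) = 0) at_top"
        using eventually_ge_at_top[of "\<bar>X \<omega>\<bar>"] by eventually_elim (simp add: tail_square_def)
      then show "((\<lambda>r. tail_square r (X \<omega>)) \<longlongrightarrow> 0) at_top" by (rule tendsto_eventually)
    qed
    show "\<forall>\<^sub>F r in at_top. AE \<omega> in M. norm (tail_square r (X \<omega>)) \<le> (X \<omega>)\<^sup>2"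
      by (auto simp: tail_square_def)
    show "(\<lambda>\<omega>. tail_square r (X \<omega>)) \<in> borel_measurable M" for r
      unfolding tail_square_def by measurable
  qed (use int in auto)
  then show ?thesis by simp
qed

locale log_square_integrable_weights = iid_weights M a
  for M :: "'s measure" and a :: "int \<Rightarrow> 's \<Rightarrow> real" +
  assumes nonzero: "\<And>i. AE \<omega> in M. a i \<omega> \<noteq> 0"
    and log_square_integrable: "integrable M (\<lambda>\<omega>. (ln \<bar>a 0 \<omega>\<bar>)\<^sup>2)"
begin

definition log_mean :: real where "log_mean = expectation (\<lambda>\<omega>. ln \<bar>a 0 \<omega>\<bar>)"

definition increment :: "nat \<Rightarrow> 's \<Rightarrow> real" where
  "increment t \<omega> = ln \<bar>a (int t + 1) \<omega>\<bar> - log_mean"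

definition log_variance :: real where "log_variance = variance (\<lambda>\<omega>. ln \<bar>a 0 \<omega>\<bar>)"

definition log_tail :: "real \<Rightarrow> real" where
  "log_tail r = expectation (\<lambda>\<omega>. tail_square r (ln \<bar>a 0 \<omega>\<bar> - log_mean))"

lemma log_integrable: "integrable M (\<lambda>\<omega>. ln \<bar>a 0 \<omega>\<bar>)"
  by (rule square_integrable_imp_integrable[OF _ log_square_integrable]) measurable

lemma centred_log_square_integrable: "integrable M (\<lambda>\<omega>. (ln \<bar>a 0 \<omega>\<bar> - log_mean)\<^sup>2)"
  unfolding power2_diff using log_square_integrable log_integrable by simp

lemma log_tail_tendsto: "(log_tail \<longlongrightarrow> 0) at_top"
  unfolding log_tail_def[abs_def] by (rule tail_square_expectation_tendsto[OF _ centred_log_square_integrable]) measurable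

sublocale increments: centred_increments M increment log_variance log_tail
proof
  have f: "(\<lambda>x::real. ln \<bar>x\<bar> - log_mean) \<in> borel_measurable borel" by measurable
  have "indep_vars (\<lambda>_. borel) (\<lambda>t. a (int t + 1)) UNIV"
    using indep_vars_reindex[OF indep, of "\<lambda>t. int t + 1" UNIV] by (simp add: inj_on_def)
  from indep_vars_compose2[OF this, of "\<lambda>_ x. ln \<bar>x\<bar> - log_mean" "\<lambda>_. borel"]
  show "indep_vars (\<lambda>_. borel) increment UNIV" unfolding increment_def[abs_def] using f by simp
  show "integrable M (\<lambda>\<omega>. (increment t \<omega>)\<^sup>2)" for t
    unfolding increment_def by (rule integrable_ident[OF _ centred_log_square_integrable]) measurable
  show "expectation (increment t) = 0" for t
    unfolding increment_def[abs_def] using expectation_ident[OF f, of "int t + 1"] log_integrable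
    by (simp add: log_mean_def prob_space)
  show "expectation (\<lambda>\<omega>. (increment t \<omega>)\<^sup>2) = log_variance" for t
    unfolding increment_def log_variance_def log_mean_def[symmetric]
    by (rule expectation_ident) measurable
  show "expectation (\<lambda>\<omega>. tail_square r (increment t \<omega>)) = log_tail r" for t r
    unfolding increment_def log_tail_def by (rule expectation_ident) (simp add: tail_square_def[abs_def])
qed

lemma log_variance_nonneg: "0 \<le> log_variance"
  unfolding log_variance_def by (rule integral_nonneg_AE) simp

lemma AE_zero_energy_weights:
  "AE \<omega> in M. zero_energy_weights (weights \<omega>) (log_weight (\<lambda>t. increment t \<omega>)) log_mean"
proof -
  have "AE \<omega> in M. \<forall>i. a i \<omega> \<noteq> 0" using nonzero by (simp add: AE_all_countable)
  then show ?thesis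
    by eventually_elim (use zero_energy_weights_log_weight[of "weights _" log_mean] in \<open>simp add: increment_def\<close>)
qed

abbreviation "spectral_measure \<equiv> expected_spectral_measure M random_op"

lemma spectral_measure_upper_bound:
  assumes "0 < \<epsilon>" "0 < L" and small: "2 * \<epsilon> \<le> exp (log_mean - L) / 2 ^ k"
  shows "measure spectral_measure {- \<epsilon><..<\<epsilon>} \<le> log_variance / L\<^sup>2 + 3 / 2 ^ k"
proof -
  let ?N = "2 ^ k :: nat"
  let ?C = "\<lambda>\<omega>. real (completions L (\<lambda>t. increment t \<omega>) (?N - 1))"
  have "measure spectral_measure {- \<epsilon><..<\<epsilon>} \<le> (expectation (\<lambda>\<omega>. ?C \<omega> + 1) + 2) / 2 ^ k"
  proof (rule spectral_measure_le[OF assms(1)])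
    show "integrable M (\<lambda>\<omega>. ?C \<omega> + 1)" using increments.integrable_completions[OF assms(2)] by simp
    from AE_zero_energy_weights
    show "AE \<omega> in M. real (eigenvalue_count ?N (weights \<omega>) {- (2 * \<epsilon>)<..<2 * \<epsilon>}) \<le> ?C \<omega> + 1"
    proof eventually_elim
      case (elim \<omega>)
      have "eigenvalue_count ?N (weights \<omega>) {- (2 * \<epsilon>)<..<2 * \<epsilon>}
          \<le> eigenvalue_count ?N (weights \<omega>) {- (exp (log_mean - L) / real ?N)<..<exp (log_mean - L) / real ?N}"
        by (rule eigenvalue_count_mono) (use small in auto)
      also have "\<dots> \<le> completions L (\<lambda>t. increment t \<omega>) (?N - 1) + 1"
        by (rule count_small_eigenvalues_le[OF _ elim assms(2)]) auto
      finally show ?case by linarith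
    qed
  qed
  also have "expectation (\<lambda>\<omega>. ?C \<omega> + 1) = expectation ?C + 1"
    using increments.integrable_completions[OF assms(2)] by (simp add: prob_space)
  also have "expectation ?C \<le> real ?N * log_variance / L\<^sup>2"
  proof -
    have "L\<^sup>2 * expectation ?C \<le> real (?N - 1) * log_variance"
      by (rule increments.expected_completions_le[OF assms(2)])
    also have "\<dots> \<le> real ?N * log_variance"
      by (intro mult_right_mono log_variance_nonneg) auto
    finally show ?thesis using assms(2) by (simp add: field_simps)
  qed
  finally show ?thesis by (simp add: divide_right_mono field_simps)
qed

lemma spectral_measure_lower_bound:
  assumes "0 < \<epsilon>" "0 < L" "0 < \<delta>" and small: "2 * 2 ^ k * exp (log_mean - L) \<le> \<epsilon> / 2"
  shows "log_variance \<le> (1 + \<delta>)\<^sup>2 * L\<^sup>2 * (measure spectral_measure {- \<epsilon><..<\<epsilon>} + 3 / 2 ^ k) +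
    ((3 * log_variance + 2 * L\<^sup>2) / 2 ^ k + sqrt L * (L / 2 ^ k + 2 * log_variance / L)
      + 8 * log_tail (sqrt L / 2) + (1 + 1 / \<delta>)\<^sup>2 * (8 * log_tail (\<delta> * L / 2)))"
proof -
  let ?N = "2 ^ k :: nat" and ?V = log_variance
  let ?C = "\<lambda>\<omega>. real (completions L (\<lambda>t. increment t \<omega>) (?N - 1))"
  have "(expectation (\<lambda>\<omega>. ?C \<omega> - 1) - 2) / 2 ^ k \<le> measure spectral_measure {- \<epsilon><..<\<epsilon>}"
  proof (rule spectral_measure_ge[OF assms(1)])
    show "integrable M (\<lambda>\<omega>. ?C \<omega> - 1)" using increments.integrable_completions[OF assms(2)] by simp
    from AE_zero_energy_weights
    show "AE \<omega> in M. ?C \<omega> - 1 \<le> real (eigenvalue_count ?N (weights \<omega>) {- (\<epsilon> / 2)<..<\<epsilon> / 2})"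
    proof eventually_elim
      case (elim \<omega>)
      have "completions L (\<lambda>t. increment t \<omega>) (?N - 1) \<le>
         eigenvalue_count ?N (weights \<omega>) {- (2 * real ?N * exp (log_mean - L))<..<2 * real ?N * exp (log_mean - L)} + 1"
        by (rule count_small_eigenvalues_ge[OF _ _ elim assms(2)]) auto
      also have "eigenvalue_count ?N (weights \<omega>) {- (2 * real ?N * exp (log_mean - L))<..<2 * real ?N * exp (log_mean - L)}
         \<le> eigenvalue_count ?N (weights \<omega>) {- (\<epsilon> / 2)<..<\<epsilon> / 2}"
        by (rule eigenvalue_count_mono) (use small in auto)
      finally show ?case by linarith
    qed
  qed
  also have "expectation (\<lambda>\<omega>. ?C \<omega> - 1) = expectation ?C - 1"
    using increments.integrable_completions[OF assms(2)] by (simp add: prob_space)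
  finally have "expectation ?C - 3 \<le> real ?N * measure spectral_measure {- \<epsilon><..<\<epsilon>}"
    by (simp add: divide_le_eq mult.commute)
  then have C: "expectation ?C \<le> real ?N * (measure spectral_measure {- \<epsilon><..<\<epsilon>} + 3 / 2 ^ k)"
    by (simp add: distrib_left)
  let ?T = "real (?N - 1)"
  have T: "?T \<le> real ?N" "?T = real ?N - 1" by (auto simp: of_nat_diff)
  have "?T * ?V \<le> (1 + \<delta>)\<^sup>2 * L\<^sup>2 * expectation ?C
    + (2 * L\<^sup>2 + 2 * ?V + sqrt L * (L + 2 * ?T * ?V / L) + ?T * (8 * log_tail (sqrt L / 2)) + ?T * ((1 + 1 / \<delta>)\<^sup>2 * (8 * log_tail (\<delta> * L / 2))))"
    by (rule increments.expected_completions_ge[OF assms(2,3)]) (use assms(2) in auto)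
  also have "\<dots> \<le> (1 + \<delta>)\<^sup>2 * L\<^sup>2 * (real ?N * (measure spectral_measure {- \<epsilon><..<\<epsilon>} + 3 / 2 ^ k))
    + (2 * L\<^sup>2 + 2 * ?V + sqrt L * (L + 2 * real ?N * ?V / L) + real ?N * (8 * log_tail (sqrt L / 2)) + real ?N * ((1 + 1 / \<delta>)\<^sup>2 * (8 * log_tail (\<delta> * L / 2))))"
    using assms(2) log_variance_nonneg increments.tail_nonneg
    by (intro add_mono mult_left_mono mult_right_mono divide_right_mono C T(1) order_refl) auto
  also have "sqrt L * (L + 2 * real ?N * ?V / L) = real ?N * (sqrt L * (L / 2 ^ k + 2 * ?V / L))"
    by (simp add: distrib_left mult_ac)
  finally have "real ?N * ?V \<le> (3 * ?V + 2 * L\<^sup>2) + (1 + \<delta>)\<^sup>2 * L\<^sup>2 * (real ?N * (measure spectral_measure {- \<epsilon><..<\<epsilon>} + 3 / 2 ^ k))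
    + real ?N * (sqrt L * (L / 2 ^ k + 2 * ?V / L)) + real ?N * (8 * log_tail (sqrt L / 2))
    + real ?N * ((1 + 1 / \<delta>)\<^sup>2 * (8 * log_tail (\<delta> * L / 2)))"
    unfolding T(2) left_diff_distrib by linarith
  also have "3 * ?V + 2 * L\<^sup>2 = real ?N * ((3 * ?V + 2 * L\<^sup>2) / 2 ^ k)" by simp
  finally have "real ?N * ?V \<le> real ?N * ((1 + \<delta>)\<^sup>2 * L\<^sup>2 * (measure spectral_measure {- \<epsilon><..<\<epsilon>} + 3 / 2 ^ k) +
    ((3 * ?V + 2 * L\<^sup>2) / 2 ^ k + sqrt L * (L / 2 ^ k + 2 * ?V / L)
      + 8 * log_tail (sqrt L / 2) + (1 + 1 / \<delta>)\<^sup>2 * (8 * log_tail (\<delta> * L / 2))))"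
    unfolding distrib_left[of "real ?N"] mult.left_commute[of "real ?N" "(1 + \<delta>)\<^sup>2 * L\<^sup>2"] by linarith
  then show ?thesis by (simp only: mult_le_cancel_left_pos[of "real ?N"] of_nat_0_less_iff zero_less_power zero_less_numeral)
qed

theorem spectral_measure_near_zero:
  "((\<lambda>\<epsilon>. measure spectral_measure {- \<epsilon><..<\<epsilon>} * (ln \<epsilon>)\<^sup>2) \<longlongrightarrow> log_variance) (at_right 0)"
  by (rule inverse_square_log_squeeze[OF log_variance_nonneg log_tail_tendsto increments.tail_nonneg
      spectral_measure_upper_bound spectral_measure_lower_bound])

end

theorem theorem1p1:
  fixes M :: "'s measure" and a :: "int \<Rightarrow> 's \<Rightarrow> real" and \<sigma> :: real
  assumes "prob_space M"
    and "prob_space.indep_vars M (\<lambda>_. borel) a UNIV"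
    and "\<And>i. distr M borel (a i) = distr M borel (a 0)"
    and "\<And>i. AE \<omega> in M. a i \<omega> \<noteq> 0"
    and "integrable M (\<lambda>\<omega>. (ln \<bar>a 0 \<omega>\<bar>)\<^sup>2)"
    and "\<sigma>\<^sup>2 = prob_space.variance M (\<lambda>\<omega>. ln \<bar>a 0 \<omega>\<bar>)"
  defines "\<mu>\<^sub>H \<equiv> expected_spectral_measure M (\<lambda>\<omega>. schroedinger_op (\<lambda>i. a i \<omega>))"
  shows "(\<sigma> \<noteq> 0 \<longrightarrow>
            (\<lambda>\<epsilon>. measure \<mu>\<^sub>H {-\<epsilon><..<\<epsilon>}) \<sim>[at_right 0] (\<lambda>\<epsilon>. \<sigma>\<^sup>2 / \<bar>ln \<epsilon>\<bar>\<^sup>2))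
       \<and> (\<sigma> = 0 \<longrightarrow>
            (\<lambda>\<epsilon>. measure \<mu>\<^sub>H {-\<epsilon><..<\<epsilon>}) \<in> o[at_right 0](\<lambda>\<epsilon>. 1 / \<bar>ln \<epsilon>\<bar>\<^sup>2))"
proof -
  interpret log_square_integrable_weights M a
    using assms by (simp add: log_square_integrable_weights_def iid_weights_def iid_weights_axioms_def log_square_integrable_weights_axioms_def)
  let ?u = "\<lambda>\<epsilon>. measure \<mu>\<^sub>H {-\<epsilon><..<\<epsilon>}"
  have lim: "((\<lambda>\<epsilon>. ?u \<epsilon> * (ln \<epsilon>)\<^sup>2) \<longlongrightarrow> \<sigma>\<^sup>2) (at_right 0)"
    using spectral_measure_near_zero unfolding \<mu>\<^sub>H_def log_variance_def assms(6) .
  have ln_neg: "eventually (\<lambda>\<epsilon>::real. ln \<epsilon> < 0) (at_right 0)" by real_asymp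
  have "?u \<sim>[at_right 0] (\<lambda>\<epsilon>. \<sigma>\<^sup>2 / \<bar>ln \<epsilon>\<bar>\<^sup>2)" if "\<sigma> \<noteq> 0"
  proof (rule asymp_equivI')
    have "((\<lambda>\<epsilon>. ?u \<epsilon> * (ln \<epsilon>)\<^sup>2 / \<sigma>\<^sup>2) \<longlongrightarrow> \<sigma>\<^sup>2 / \<sigma>\<^sup>2) (at_right 0)"
      using that by (intro tendsto_intros lim) auto
    then show "((\<lambda>\<epsilon>. ?u \<epsilon> / (\<sigma>\<^sup>2 / \<bar>ln \<epsilon>\<bar>\<^sup>2)) \<longlongrightarrow> 1) (at_right 0)" using that by simp
  qed
  moreover have "?u \<in> o[at_right 0](\<lambda>\<epsilon>. 1 / \<bar>ln \<epsilon>\<bar>\<^sup>2)" if "\<sigma> = 0"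
  proof (rule smalloI_tendsto)
    show "((\<lambda>\<epsilon>. ?u \<epsilon> / (1 / \<bar>ln \<epsilon>\<bar>\<^sup>2)) \<longlongrightarrow> 0) (at_right 0)" using lim that by simp
    show "eventually (\<lambda>\<epsilon>::real. 1 / \<bar>ln \<epsilon>\<bar>\<^sup>2 \<noteq> 0) (at_right 0)"
      using ln_neg by eventually_elim simp
  qed
  ultimately show ?thesis by blast
qed


end
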